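(* Let $\mathcal{M}\subset\mathbb{R}^n$ be an $m$-dimensional embedded Riemannian manifold, with the metric induced from $\mathbb{R}^n$, with boundary $\partial\mathcal{M}$ of bounded curvature. Let $\tilde f = f\,dV$ be a probability density supported on $\mathcal{M}$, where $dV$ is the volume form on $\mathcal{M}$ inherited from the embedding and $f\in\mathcal{C}^4(\mathcal{M})$ is bounded above by a polynomial. Let $K:[0,\infty)\to[0,\infty)$ have exponential decay, and let $X_1,\dots,X_N$ be independent samples of $f$. Let $x\in\mathcal{M}$ be tangible, and let $b_x$ be the geodesic distance from $x$ to $\partial\mathcal{M}$. Then, for $h>0$ sufficiently small, the boundary direction estimator $$ \mu_{h,N}(x) = \frac{1}{N h^{m+1}}\sum_{i=1}^N K\left(\frac{\|x-X_i\|}{h}\right)(X_i-x) $$ has expectation $$ \mathbb{E}[\mu_{h,N}(x)] = -\eta_x\, f(x)\, m_1^{\partial}(x) + \mathcal{O}\big(h\nabla f(x),\, h f(x)\big), $$ where $\eta_x\in T_x\mathcal{M}$ is a unit vector pointing towards the closest boundary point (for $x\in\partial\mathcal{M}$, $\eta_x$ is the outward pointing normal) and $$ m^{\partial}_1(x) = -\int_{\mathbb{R}^{m-1}}\int_{-\infty}^{b_x/h} K(\|z_\perp + z_\parallel\eta_x\|)\,z_\parallel\,dz_\parallel\,dz_\perp . $$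
   Context: Exponential decay of $K$: there exist constants $a_1,a_2>0$ such that $K(z)<a_1e^{-a_2 z}$ for all $z\ge 0$. Norms: $\|x-X_i\|$ is the Euclidean distance in the ambient space $\mathbb{R}^n$; $X_i-x$ is a vector in $\mathbb{R}^n$, and $T_x\mathcal{M}$ is regarded as a subspace of $\mathbb{R}^n$. Integration variables: $z_\parallel$ is a scalar and $z_\perp$ ranges over the $(m-1)$-dimensional subspace $\{z\in T_x\mathcal{M}: z\perp\eta_x\}\cong\mathbb{R}^{m-1}$, so $\|z_\perp+z_\parallel\eta_x\|^2=\|z_\perp\|^2+z_\parallel^2$. Direction to the boundary: let $x^*\in\partial\mathcal{M}$ minimize the geodesic distance to $x$, so that $d(x,x^* )=b_x$. If $x\notin\partial\mathcal{M}$, $\eta_x\in T_x\mathcal{M}$ is the unit vector with $\exp_x(b_x\eta_x)=x^*$; if $x\in\partial\mathcal{M}$, $\eta_x$ is the outward-pointing unit normal to $\partial\mathcal{M}$ in $T_x\mathcal{M}$. For $h$ sufficiently small $x^*$ is unique for points with $b_x<h$ (for points farther away the boundary has a negligible effect). Tangible points: for $x,y\in\mathcal{M}$ set $R(x,y)=\|x-y\|/d_I(x,y)$, where $d_I(x,y)$ is the infimum of the lengths of all differentiable paths in $\mathcal{M}$ connecting $x$ and $y$. The injectivity radius $\mathrm{inj}(x)$ is the maximum radius for which a ball in $T_x\mathcal{M}$ is mapped diffeomorphically into $\mathcal{M}$ by $\exp_x$. A point $x$ is tangible if $\mathrm{inj}(x)>0$ and, in a sufficiently small neighborhood $U$ of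 $x$, $\inf_{y\in U}R(x,y)>0$. For manifolds with boundary, the tangent space at a boundary point is taken to be the half space, and at points near the boundary it is taken to be the space cut at distance $b_x$ in the direction $\eta_x$; the injectivity radius is then the radius of the largest ball such that $\exp_x$ is well defined (a diffeomorphism onto its image) on the intersection of the ball with this half space or cut space. The notation $\mathcal{O}(h\nabla f(x),hf(x))$ denotes an error vector of order $h$ as $h\to0$ (for fixed $x$), whose leading contributions are of order $h$ times $\nabla f(x)$ and $h$ times $f(x)$. *)

theory Defs
  imports "HOL-Probability.Probability" "HOL-Library.Extended_Nat"
begin

section \<open>Smooth maps on subsets of Euclidean space\<close>

primrec Ck_open :: "nat \<Rightarrow> ('a::real_normed_vector \<Rightarrow> 'b::real_normed_vector) \<Rightarrow> 'a set \<Rightarrow> bool" where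
  "Ck_open 0 f U \<longleftrightarrow> continuous_on U f"
| "Ck_open (Suc k) f U \<longleftrightarrow>
     (\<forall>x\<in>U. f differentiable (at x)) \<and> (\<forall>v. Ck_open k (\<lambda>x. frechet_derivative f (at x) v) U)"

text \<open>On an arbitrary set, being of class \<open>C\<^sup>k\<close> means having local \<open>C\<^sup>k\<close> extensions to
  open subsets of the surrounding space. For \<open>k = \<infinity>\<close> a single extension is of every finite class.\<close>

definition Ck_on :: "enat \<Rightarrow> ('a::real_normed_vector \<Rightarrow> 'b::real_normed_vector) \<Rightarrow> 'a set \<Rightarrow> bool" where
  "Ck_on k f A \<longleftrightarrow> (\<forall>x\<in>A. \<exists>U F. open U \<and> x \<in> U \<and>
     (\<forall>j. enat j \<le> k \<longrightarrow> Ck_open j F U) \<and> (\<forall>y\<in>U \<inter> A. F y = f y))"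

definition diffeo_on :: "('a::real_normed_vector \<Rightarrow> 'b::real_normed_vector) \<Rightarrow> 'a set \<Rightarrow> bool" where
  "diffeo_on f A \<longleftrightarrow> inj_on f A \<and> Ck_on \<infinity> f A \<and> Ck_on \<infinity> (inv_into A f) (f ` A)"


section \<open>Embedded submanifolds with boundary\<close>

text \<open>The dimension of the manifold is \<open>CARD('m)\<close>. The argument of type \<open>'m itself\<close> only
  records this index type.\<close>

definition half_space :: "'m::finite \<Rightarrow> (real^'m) set" where
  "half_space k = {u. 0 \<le> u $ k}"

text \<open>Local parametrizations by relatively open pieces of a half space; interior points are
  covered by pieces that do not meet the bounding hyperplane.\<close>

definition local_param ::
  "('a::euclidean_space) set \<Rightarrow> 'm::finite \<Rightarrow> (real^'m) set \<Rightarrow> (real^'m \<Rightarrow> 'a) \<Rightarrow> bool" where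
  "local_param M k W \<phi> \<longleftrightarrow>
     openin (top_of_set (half_space k)) W \<and> openin (top_of_set M) (\<phi> ` W) \<and> diffeo_on \<phi> W"

definition submanifold_with_boundary :: "'m::finite itself \<Rightarrow> ('a::euclidean_space) set \<Rightarrow> bool" where
  "submanifold_with_boundary _ M \<longleftrightarrow>
     (\<forall>x\<in>M. \<exists>(k::'m) W \<phi>. local_param M k W \<phi> \<and> x \<in> \<phi> ` W)"

definition manifold_boundary :: "'m::finite itself \<Rightarrow> ('a::euclidean_space) set \<Rightarrow> 'a set" where
  "manifold_boundary _ M =
     {x. \<exists>(k::'m) W \<phi> u. local_param M k W \<phi> \<and> u \<in> W \<and> u $ k = 0 \<and> \<phi> u = x}"

text \<open>At boundary points too this is the full \<open>m\<close>-dimensional linear tangent space.\<close>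

definition tangent_space :: "'m::finite itself \<Rightarrow> ('a::euclidean_space) set \<Rightarrow> 'a \<Rightarrow> 'a set" where
  "tangent_space _ M x = {w. \<exists>(k::'m) W \<phi> u D. local_param M k W \<phi> \<and> u \<in> W \<and> \<phi> u = x \<and>
     (\<phi> has_derivative D) (at u within W) \<and> w \<in> range D}"

definition outward_normal :: "'m::finite itself \<Rightarrow> ('a::euclidean_space) set \<Rightarrow> 'a \<Rightarrow> 'a \<Rightarrow> bool" where
  "outward_normal _ M x \<nu> \<longleftrightarrow> norm \<nu> = 1 \<and>
     (\<exists>(k::'m) W \<phi> u D v. local_param M k W \<phi> \<and> u \<in> W \<and> u $ k = 0 \<and> \<phi> u = x \<and>
        (\<phi> has_derivative D) (at u within W) \<and>
        D v = \<nu> \<and> v $ k < 0 \<and> (\<forall>w. w $ k = 0 \<longrightarrow> \<nu> \<bullet> D w = 0))"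

definition gram_matrix :: "(real^'m::finite) set \<Rightarrow> (real^'m \<Rightarrow> 'a::euclidean_space) \<Rightarrow> real^'m \<Rightarrow> real^'m^'m" where
  "gram_matrix W \<phi> u = (\<chi> i j. frechet_derivative \<phi> (at u within W) (axis i 1) \<bullet>
                                 frechet_derivative \<phi> (at u within W) (axis j 1))"

text \<open>The Riemannian volume \<open>dV\<close> as a measure on the Borel sets of \<open>M\<close>; the coordinate formula
  \<open>dV = sqrt (det g) du\<close> in all parametrizations determines it uniquely.\<close>

definition volume_measure ::
  "'m::finite itself \<Rightarrow> ('a::euclidean_space) set \<Rightarrow> 'a measure \<Rightarrow> bool" where
  "volume_measure _ M dV \<longleftrightarrow> sets dV = sets (restrict_space borel M) \<and>
     (\<forall>(k::'m) W \<phi> B. local_param M k W \<phi> \<longrightarrow> B \<in> sets dV \<longrightarrow> B \<subseteq> \<phi> ` W \<longrightarrow>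
        emeasure dV B =
          (\<integral>\<^sup>+u. ennreal (sqrt (det (gram_matrix W \<phi> u))) * indicator (W \<inter> \<phi> -` B) u \<partial>lborel))"

definition manifold_gradient ::
  "'m::finite itself \<Rightarrow> ('a::euclidean_space) set \<Rightarrow> ('a \<Rightarrow> real) \<Rightarrow> 'a \<Rightarrow> 'a" where
  "manifold_gradient m M f x =
     (THE g. g \<in> tangent_space m M x \<and> (f has_derivative (\<lambda>v. g \<bullet> v)) (at x within M))"


section \<open>Geodesics, distances and curvature of the boundary\<close>

definition curve_length :: "(real \<Rightarrow> 'a::euclidean_space) \<Rightarrow> real" where
  "curve_length \<gamma> = integral {0..1} (\<lambda>t. norm (vector_derivative \<gamma> (at t within {0..1})))"

text \<open>The value is \<open>\<infinity>\<close> if no continuously differentiable path in \<open>M\<close> joins the two points.\<close>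

definition intrinsic_dist :: "('a::euclidean_space) set \<Rightarrow> 'a \<Rightarrow> 'a \<Rightarrow> ereal" where
  "intrinsic_dist M x y =
     (INF \<gamma>\<in>{\<gamma>. Ck_on 1 \<gamma> {0..1} \<and> \<gamma> ` {0..1} \<subseteq> M \<and> \<gamma> 0 = x \<and> \<gamma> 1 = y}. ereal (curve_length \<gamma>))"

definition boundary_dist :: "'m::finite itself \<Rightarrow> ('a::euclidean_space) set \<Rightarrow> 'a \<Rightarrow> ereal" where
  "boundary_dist m M x = (INF y\<in>manifold_boundary m M. intrinsic_dist M x y)"

definition curve_derivs ::
  "(real \<Rightarrow> 'a::euclidean_space) \<Rightarrow> (real \<Rightarrow> 'a) \<Rightarrow> (real \<Rightarrow> 'a) \<Rightarrow> bool" where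
  "curve_derivs \<gamma> \<gamma>' \<gamma>'' \<longleftrightarrow> (\<forall>t\<in>{0..1}.
     (\<gamma> has_vector_derivative \<gamma>' t) (at t within {0..1}) \<and>
     (\<gamma>' has_vector_derivative \<gamma>'' t) (at t within {0..1}))"

text \<open>For a curve in the boundary, \<open>\<gamma>'' \<bullet> \<nu>\<close> is the second fundamental form of the boundary in
  \<open>M\<close>, evaluated at \<open>(\<gamma>', \<gamma>')\<close>.\<close>

definition bounded_boundary_curvature :: "'m::finite itself \<Rightarrow> ('a::euclidean_space) set \<Rightarrow> bool" where
  "bounded_boundary_curvature m M \<longleftrightarrow> (\<exists>\<kappa>. \<forall>\<gamma> \<gamma>' \<gamma>''. curve_derivs \<gamma> \<gamma>' \<gamma>'' \<longrightarrow>
     \<gamma> ` {0..1} \<subseteq> manifold_boundary m M \<longrightarrow>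
     (\<forall>t\<in>{0..1}. \<forall>\<nu>. outward_normal m M (\<gamma> t) \<nu> \<longrightarrow> \<bar>\<gamma>'' t \<bullet> \<nu>\<bar> \<le> \<kappa> * (norm (\<gamma>' t))\<^sup>2))"

text \<open>For the induced metric the covariant acceleration is the tangential part of \<open>\<gamma>''\<close>.\<close>

definition geodesic :: "'m::finite itself \<Rightarrow> ('a::euclidean_space) set \<Rightarrow> (real \<Rightarrow> 'a) \<Rightarrow> bool" where
  "geodesic m M \<gamma> \<longleftrightarrow> \<gamma> ` {0..1} \<subseteq> M \<and>
     (\<exists>\<gamma>' \<gamma>''. curve_derivs \<gamma> \<gamma>' \<gamma>'' \<and>
        (\<forall>t\<in>{0..1}. \<forall>w\<in>tangent_space m M (\<gamma> t). \<gamma>'' t \<bullet> w = 0))"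

definition geodesic_to ::
  "'m::finite itself \<Rightarrow> ('a::euclidean_space) set \<Rightarrow> 'a \<Rightarrow> 'a \<Rightarrow> 'a \<Rightarrow> bool" where
  "geodesic_to m M x v y \<longleftrightarrow> (\<exists>\<gamma>. geodesic m M \<gamma> \<and> \<gamma> 0 = x \<and> \<gamma> 1 = y \<and>
     (\<gamma> has_vector_derivative v) (at 0 within {0..1}))"

definition exp_domain :: "'m::finite itself \<Rightarrow> ('a::euclidean_space) set \<Rightarrow> 'a \<Rightarrow> 'a set" where
  "exp_domain m M x = {v \<in> tangent_space m M x. \<exists>y. geodesic_to m M x v y}"

definition exp_map :: "'m::finite itself \<Rightarrow> ('a::euclidean_space) set \<Rightarrow> 'a \<Rightarrow> 'a \<Rightarrow> 'a" where
  "exp_map m M x v = (THE y. geodesic_to m M x v y)"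

text \<open>\<open>\<eta>\<close> is a direction from \<open>x\<close> towards a closest boundary point.\<close>

definition boundary_direction ::
  "'m::finite itself \<Rightarrow> ('a::euclidean_space) set \<Rightarrow> 'a \<Rightarrow> 'a \<Rightarrow> bool" where
  "boundary_direction m M x \<eta> \<longleftrightarrow> boundary_dist m M x < \<infinity> \<and>
     (\<exists>xs\<in>manifold_boundary m M. intrinsic_dist M x xs = boundary_dist m M x \<and>
        (if x \<in> manifold_boundary m M then outward_normal m M x \<eta>
         else \<eta> \<in> tangent_space m M x \<and> norm \<eta> = 1 \<and>
              real_of_ereal (boundary_dist m M x) *\<^sub>R \<eta> \<in> exp_domain m M x \<and>
              exp_map m M x (real_of_ereal (boundary_dist m M x) *\<^sub>R \<eta>) = xs))"

text \<open>The tangent space cut at distance \<open>b\<^sub>x\<close> in the direction \<open>\<eta>\<close>. For a boundary point \<open>x\<close>,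
  where \<open>b\<^sub>x = 0\<close> and \<open>\<eta>\<close> is the outward normal, it is the half space of inward vectors.\<close>

definition cut_tangent_space ::
  "'m::finite itself \<Rightarrow> ('a::euclidean_space) set \<Rightarrow> 'a \<Rightarrow> 'a \<Rightarrow> 'a set" where
  "cut_tangent_space m M x \<eta> = {v \<in> tangent_space m M x. ereal (v \<bullet> \<eta>) \<le> boundary_dist m M x}"

definition inj_radius :: "'m::finite itself \<Rightarrow> ('a::euclidean_space) set \<Rightarrow> 'a \<Rightarrow> 'a \<Rightarrow> ereal" where
  "inj_radius m M x \<eta> = Sup {ereal r | r. 0 \<le> r \<and>
     ball 0 r \<inter> cut_tangent_space m M x \<eta> \<subseteq> exp_domain m M x \<and>
     diffeo_on (exp_map m M x) (ball 0 r \<inter> cut_tangent_space m M x \<eta>)}"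

definition dist_ratio :: "('a::euclidean_space) set \<Rightarrow> 'a \<Rightarrow> 'a \<Rightarrow> ereal" where
  "dist_ratio M x y = ereal (norm (x - y)) / intrinsic_dist M x y"

text \<open>The ratio has the form \<open>0 / 0\<close> at \<open>y = x\<close>, so this point is left out of the infimum.\<close>

definition tangible :: "'m::finite itself \<Rightarrow> ('a::euclidean_space) set \<Rightarrow> 'a \<Rightarrow> 'a \<Rightarrow> bool" where
  "tangible m M x \<eta> \<longleftrightarrow> 0 < inj_radius m M x \<eta> \<and>
     (\<exists>U. open U \<and> x \<in> U \<and> 0 < (INF y\<in>U \<inter> M - {x}. dist_ratio M x y))"


section \<open>Densities, kernels and the estimator\<close>

definition density_on_manifold ::
  "('a::euclidean_space) set \<Rightarrow> 'a measure \<Rightarrow> ('a \<Rightarrow> real) \<Rightarrow> bool" where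
  "density_on_manifold M dV f \<longleftrightarrow> Ck_on 4 f M \<and> (\<forall>y\<in>M. 0 \<le> f y) \<and>
     (\<exists>p. real_polynomial_function p \<and> (\<forall>y\<in>M. f y \<le> p y)) \<and>
     prob_space (density dV (\<lambda>y. ennreal (f y)))"

text \<open>A kernel is a function on \<open>[0,\<infinity>)\<close>: its values at negative arguments are never used.\<close>

definition kernel_function :: "(real \<Rightarrow> real) \<Rightarrow> bool" where
  "kernel_function K \<longleftrightarrow> K \<in> borel_measurable (restrict_space borel {0..}) \<and> (\<forall>z\<ge>0. 0 \<le> K z)"

definition exponential_decay :: "(real \<Rightarrow> real) \<Rightarrow> bool" where
  "exponential_decay K \<longleftrightarrow> (\<exists>a1>0. \<exists>a2>0. \<forall>z\<ge>0. K z < a1 * exp (- a2 * z))"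

definition iid_samples ::
  "'w measure \<Rightarrow> 'a measure \<Rightarrow> ('a \<Rightarrow> real) \<Rightarrow> nat \<Rightarrow> (nat \<Rightarrow> 'w \<Rightarrow> 'a) \<Rightarrow> bool" where
  "iid_samples P dV f N X \<longleftrightarrow> prob_space P \<and>
     prob_space.indep_vars P (\<lambda>_. dV) X {1..N} \<and>
     (\<forall>i\<in>{1..N}. distributed P dV (X i) (\<lambda>y. ennreal (f y)))"

definition boundary_estimator ::
  "'m::finite itself \<Rightarrow> (real \<Rightarrow> real) \<Rightarrow> real \<Rightarrow> nat \<Rightarrow> (nat \<Rightarrow> 'w \<Rightarrow> 'a::euclidean_space) \<Rightarrow> 'a \<Rightarrow> 'w \<Rightarrow> 'a" where
  "boundary_estimator _ K h N X x \<omega> =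
     (1 / (real N * h ^ (CARD('m) + 1))) *\<^sub>R
       (\<Sum>i=1..N. K (norm (x - X i \<omega>) / h) *\<^sub>R (X i \<omega> - x))"

text \<open>Lebesgue measure on a linear subspace, transported along an orthonormal basis exactly as in
  the definition of \<^const>\<open>lborel\<close>. The choice of the basis does not matter. On the zero subspace it
  is the unit point mass.\<close>

definition subspace_lborel :: "('a::euclidean_space) set \<Rightarrow> 'a measure" where
  "subspace_lborel V =
     (let B = (SOME B. B \<subseteq> V \<and> pairwise orthogonal B \<and> (\<forall>b\<in>B. norm b = 1) \<and> span B = V)
      in distr (\<Pi>\<^sub>M b\<in>B. lborel) borel (\<lambda>c. \<Sum>b\<in>B. c b *\<^sub>R b))"

definition m1_boundary ::
  "'m::finite itself \<Rightarrow> ('a::euclidean_space) set \<Rightarrow> (real \<Rightarrow> real) \<Rightarrow> 'a \<Rightarrow> 'a \<Rightarrow> real \<Rightarrow> real" where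
  "m1_boundary m M K x \<eta> h =
     - (\<integral>zp. (LBINT zl = - \<infinity>..ereal (real_of_ereal (boundary_dist m M x) / h).
                 K (norm (zp + zl *\<^sub>R \<eta>)) * zl)
          \<partial>subspace_lborel {z \<in> tangent_space m M x. z \<bullet> \<eta> = 0})"

end

theory Submission
  imports Defs
begin

text \<open>The expectation of the estimator is \<open>h^-(m+1)\<close> times the integral of \<open>K (|x -
  y| / h) (y - x)\<close> against \<open>f dV\<close>. The kernel only sees points at distance
  of order \<open>h\<close> from \<open>x\<close>: beyond a fixed distance it is exponentially
  small, and \<open>f dV\<close> is a probability measure. Near \<open>x\<close> the manifold
  looks, to first order, like a cone in the tangent space: the half space of inward vectors if
  \<open>x\<close> is a boundary point, and the whole tangent space otherwise. On the half space
  the reflections in directions orthogonal to \<open>\<eta>\<close> leave only the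
  \<open>\<eta>\<close>-component of the integral of \<open>K (|z|) z\<close>, and this
  component is \<open>- m1\<close>. On the whole space the integral vanishes, and
  \<open>m1\<close> is of order \<open>h\<close> because the boundary is at positive distance.
  In this way the cone integral is \<open>- m1 \<eta>\<close> in both cases, up to a term of
  order \<open>h\<close> (\<open>half_space_kernel_moment\<close>,
  \<open>kernel_flux_bound\<close>, \<open>m1_boundary_coordinates\<close>).

  The delicate point is the comparison of the manifold with the cone. The kernel is merely
  measurable, so an approximation of \<open>|x - y|\<close> inside \<open>K\<close> cannot be
  controlled; the distance has to be kept exactly. For a chart \<open>\<phi>\<close> with
  \<open>\<phi> u0 = x\<close> and derivative \<open>D = L o B\<close>, where \<open>L\<close>
  is an isometry onto the tangent space, the straightening map \<open>G u = (|\<phi> u - x| / |B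
  (u - u0)|) B (u - u0)\<close> has length exactly \<open>|\<phi> u - x|\<close>. It sends rays
  to rays and is increasing along them, so it is injective and carries the part of the chart
  domain within distance \<open>\<delta>\<close> of \<open>x\<close> onto the part of the cone
  of norm less than \<open>\<delta>\<close> (\<open>inj_on_G\<close>, \<open>G_image\<close>).
  Its derivative is \<open>B\<close> up to a relative error of order \<open>|u - u0|\<close>
  (\<open>G'_near_B\<close>). Hence the change of variables \<open>z = G u\<close> turns the
  cone integral into a chart integral with the very same kernel values, and the two integrands
  differ by replacing \<open>\<phi> u - x\<close> by \<open>L (G u)\<close>, the volume density
  by the Jacobian of \<open>G\<close>, and \<open>f (\<phi> u)\<close> by \<open>f x\<close>.
  The first two replacements cost a factor of order \<open>|u - u0|\<close> times \<open>f
  x\<close>, the last one costs \<open>|grad f| |u - u0|\<close> and a second-order Taylor term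
  (\<open>integrand_remainder\<close>). Integrated against the exponential bound for
  \<open>K\<close>, a factor \<open>|u - u0|\<close> becomes a factor \<open>h\<close>
  (\<open>kernel_chart_integral_expansion\<close>). The constant in front of \<open>h f
  x\<close> and \<open>h |grad f|\<close> depends on \<open>M\<close>, \<open>x\<close> and
  \<open>K\<close> but not on \<open>f\<close>, and the Taylor term of \<open>f\<close> goes
  into the \<open>h^2\<close> term.\<close>

section \<open>Lebesgue measure and changes of variables\<close>

text \<open>Lebesgue measure is a product measure over any enumeration of the standard basis. This allows
  products to be indexed by an orthonormal basis of a tangent space or by a renamed index type.\<close>

lemma lborel_eq_distr_PiM:
  fixes \<gamma> :: "'i \<Rightarrow> 'a::euclidean_space"
  assumes "bij_betw \<gamma> I Basis"
  shows "lborel = distr (\<Pi>\<^sub>M i\<in>I. lborel) borel (\<lambda>c. \<Sum>i\<in>I. c i *\<^sub>R \<gamma> i)"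
proof (rule lborel_eqI)
  interpret product_sigma_finite "\<lambda>_::'i. lborel :: real measure" ..
  have fin: "finite I"
    using assms bij_betw_finite finite_Basis by blast
  have [measurable]: "(\<lambda>c. \<Sum>i\<in>I. c i *\<^sub>R \<gamma> i) \<in> borel_measurable (\<Pi>\<^sub>M i\<in>I. lborel)"
    by (intro borel_measurable_sum borel_measurable_scaleR) auto
  have coord: "(\<Sum>i\<in>I. c i *\<^sub>R \<gamma> i) \<bullet> \<gamma> j = c j" if "j \<in> I" for c and j
  proof -
    have "(\<Sum>i\<in>I. c i *\<^sub>R \<gamma> i) \<bullet> \<gamma> j = (\<Sum>i\<in>I. if i = j then c i else 0)"
      unfolding inner_sum_left
    proof (rule sum.cong)
      fix i assume "i \<in> I"
      then have "\<gamma> i \<in> Basis" "\<gamma> j \<in> Basis" "\<gamma> i = \<gamma> j \<longleftrightarrow> i = j"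
        using assms that by (auto simp: bij_betw_def inj_on_eq_iff)
      then show "c i *\<^sub>R \<gamma> i \<bullet> \<gamma> j = (if i = j then c i else 0)"
        by (simp add: inner_Basis)
    qed simp
    then show ?thesis using fin that by simp
  qed
  fix l u :: 'a
  assume le: "\<And>b. b \<in> Basis \<Longrightarrow> l \<bullet> b \<le> u \<bullet> b"
  have "(\<lambda>c. \<Sum>i\<in>I. c i *\<^sub>R \<gamma> i) -` box l u \<inter> space (\<Pi>\<^sub>M i\<in>I. lborel)
      = (\<Pi>\<^sub>E i\<in>I. {l \<bullet> \<gamma> i<..<u \<bullet> \<gamma> i})"
  proof -
    have *: "Basis = \<gamma> ` I" using assms by (auto simp: bij_betw_def)
    show ?thesis
      unfolding box_def * by (auto simp: coord space_PiM PiE_iff)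
  qed
  then have "emeasure (distr (\<Pi>\<^sub>M i\<in>I. lborel) borel (\<lambda>c. \<Sum>i\<in>I. c i *\<^sub>R \<gamma> i)) (box l u)
      = (\<Prod>i\<in>I. emeasure lborel {l \<bullet> \<gamma> i<..<u \<bullet> \<gamma> i})"
    by (simp add: emeasure_distr emeasure_PiM[OF fin])
  also have "\<dots> = (\<Prod>i\<in>I. ennreal ((u - l) \<bullet> \<gamma> i))"
    by (intro prod.cong refl)
       (use le assms in \<open>auto simp: inner_diff_left bij_betw_def intro!: emeasure_lborel_Ioo\<close>)
  also have "\<dots> = (\<Prod>b\<in>Basis. ennreal ((u - l) \<bullet> b))"
    using prod.reindex_bij_betw[OF assms, of "\<lambda>b. ennreal ((u - l) \<bullet> b)"] .
  also have "\<dots> = ennreal (\<Prod>b\<in>Basis. (u - l) \<bullet> b)"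
    by (intro prod_ennreal) (use le in \<open>auto simp: inner_diff_left\<close>)
  finally show "emeasure (distr (\<Pi>\<^sub>M i\<in>I. lborel) borel (\<lambda>c. \<Sum>i\<in>I. c i *\<^sub>R \<gamma> i)) (box l u)
      = (\<Prod>b\<in>Basis. (u - l) \<bullet> b)" .
qed simp

text \<open>The change of variables theorem for Lebesgue integrals is stated for index types with a
  well-order. An arbitrary finite index type is copied and ordered by some enumeration; the
  coordinates are renamed, which changes neither Lebesgue measure nor determinants.\<close>

typedef 'm wo_index = "UNIV :: 'm set" ..

instantiation wo_index :: (finite) wellorder
begin

definition less_eq_wo_index :: "'a wo_index \<Rightarrow> 'a wo_index \<Rightarrow> bool" where
  "less_eq_wo_index i j \<longleftrightarrow>
     (SOME r :: 'a \<Rightarrow> nat. inj r) (Rep_wo_index i) \<le> (SOME r :: 'a \<Rightarrow> nat. inj r) (Rep_wo_index j)"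

definition less_wo_index :: "'a wo_index \<Rightarrow> 'a wo_index \<Rightarrow> bool" where
  "less_wo_index i j \<longleftrightarrow>
     (SOME r :: 'a \<Rightarrow> nat. inj r) (Rep_wo_index i) < (SOME r :: 'a \<Rightarrow> nat. inj r) (Rep_wo_index j)"

instance
proof
  have "\<exists>r :: 'a \<Rightarrow> nat. inj r"
    using finite_imp_inj_to_nat_seg[of "UNIV :: 'a set"] by auto
  then have inj: "inj (SOME r :: 'a \<Rightarrow> nat. inj r)"
    by (rule someI_ex)
  fix i j k :: "'a wo_index"
  show "i < j \<longleftrightarrow> i \<le> j \<and> \<not> j \<le> i" "i \<le> i" "i \<le> j \<or> j \<le> i"
    by (auto simp: less_eq_wo_index_def less_wo_index_def)
  show "i \<le> j \<Longrightarrow> j \<le> k \<Longrightarrow> i \<le> k"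
    by (auto simp: less_eq_wo_index_def)
  show "i \<le> j \<Longrightarrow> j \<le> i \<Longrightarrow> i = j"
    using inj by (auto simp: less_eq_wo_index_def inj_eq Rep_wo_index_inject)
next
  fix P :: "'a wo_index \<Rightarrow> bool" and a :: "'a wo_index"
  assume step: "\<And>i. (\<And>j. j < i \<Longrightarrow> P j) \<Longrightarrow> P i"
  show "P a"
    by (induction a rule: measure_induct_rule[of "\<lambda>i. (SOME r :: 'a \<Rightarrow> nat. inj r) (Rep_wo_index i)"])
       (use step in \<open>auto simp: less_wo_index_def\<close>)
qed

end

instance wo_index :: (finite) finite
proof
  have "(UNIV :: 'a wo_index set) = Abs_wo_index ` UNIV"
    by (metis Abs_wo_index_cases surjI UNIV_I image_iff UNIV_eq_I)
  then show "finite (UNIV :: 'a wo_index set)"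
    by (metis finite_imageI finite)
qed

lemma bij_Rep_wo_index: "bij (Rep_wo_index :: 'm wo_index \<Rightarrow> 'm)"
  by (metis Abs_wo_index_inverse Rep_wo_index_inverse UNIV_I bij_iff)

lemma bij_Abs_wo_index: "bij (Abs_wo_index :: 'm \<Rightarrow> 'm wo_index)"
  by (metis Abs_wo_index_inverse Rep_wo_index_inverse UNIV_I bij_iff)

definition to_wo :: "real^'m \<Rightarrow> real^('m::finite wo_index)" where
  "to_wo v = (\<chi> i. v $ Rep_wo_index i)"

definition from_wo :: "real^('m::finite wo_index) \<Rightarrow> real^'m" where
  "from_wo v = (\<chi> i. v $ Abs_wo_index i)"

lemma from_to_wo [simp]: "from_wo (to_wo v) = v" and to_from_wo [simp]: "to_wo (from_wo w) = w"
  by (simp_all add: from_wo_def to_wo_def vec_eq_iff Abs_wo_index_inverse Rep_wo_index_inverse)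

lemma bounded_linear_to_wo: "bounded_linear (to_wo :: real^'m::finite \<Rightarrow> _)"
  by (intro linear_conv_bounded_linear[THEN iffD1] linearI) (auto simp: to_wo_def vec_eq_iff)

lemma bounded_linear_from_wo: "bounded_linear (from_wo :: _ \<Rightarrow> real^'m::finite)"
  by (intro linear_conv_bounded_linear[THEN iffD1] linearI) (auto simp: from_wo_def vec_eq_iff)

lemma measurable_to_wo [measurable]: "to_wo \<in> borel_measurable borel"
  and measurable_from_wo [measurable]: "from_wo \<in> borel_measurable borel"
  by (simp_all add: bounded_linear_to_wo bounded_linear_from_wo borel_measurable_continuous_onI
      linear_continuous_on)

lemma distr_lborel_to_wo: "distr lborel borel (to_wo :: real^'m::finite \<Rightarrow> _) = lborel"
proof -
  have *: "bij_betw (\<lambda>i. axis i 1) UNIV (Basis :: (real^'m) set)"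
    by (auto simp: bij_betw_def inj_on_def axis_eq_axis Basis_vec_def)
  have **: "bij_betw (\<lambda>i::'m. axis (Abs_wo_index i) 1) UNIV (Basis :: (real^('m wo_index)) set)"
    using bij_Abs_wo_index
    by (auto simp: bij_betw_def inj_on_def axis_eq_axis Basis_vec_def Abs_wo_index_inject
        intro!: image_eqI[of _ _ "Rep_wo_index _"] simp: Rep_wo_index_inverse)
  have m: "(\<lambda>c. \<Sum>i\<in>UNIV. c i *\<^sub>R axis i 1 :: real^'m) \<in> borel_measurable (\<Pi>\<^sub>M i\<in>UNIV. lborel)"
    by (intro borel_measurable_sum borel_measurable_scaleR) auto
  have "to_wo (\<Sum>i\<in>UNIV. c i *\<^sub>R axis i 1 :: real^'m) = (\<Sum>i\<in>UNIV. c i *\<^sub>R axis (Abs_wo_index i) 1)" for c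
    by (simp add: linear_sum[OF bounded_linear.linear[OF bounded_linear_to_wo]])
      (rule sum.cong, auto simp: to_wo_def axis_def vec_eq_iff Abs_wo_index_inverse Rep_wo_index_inverse)
  then show ?thesis
    by (subst lborel_eq_distr_PiM[OF *], subst lborel_eq_distr_PiM[OF **]) (simp add: distr_distr m comp_def)
qed

lemma
  fixes h :: "real^'m::finite \<Rightarrow> 'b::euclidean_space"
  assumes [measurable]: "h \<in> borel_measurable borel"
  shows integrable_from_wo: "integrable lborel (\<lambda>w. h (from_wo w)) \<longleftrightarrow> integrable lborel h"
    and integral_from_wo: "(\<integral>w. h (from_wo w) \<partial>lborel) = (\<integral>v. h v \<partial>lborel)"
  using integrable_distr_eq[of to_wo lborel borel "\<lambda>w. h (from_wo w)"]
    integral_distr[of to_wo lborel borel "\<lambda>w. h (from_wo w)"]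
  by (simp_all add: distr_lborel_to_wo)

text \<open>Conjugation with the renaming is a sign-preserving bijection between the permutations of the two
  index types.\<close>

lemma det_wo_reindex:
  fixes A :: "real^'m::finite^'m"
  shows "det (\<chi> i j. A $ Rep_wo_index i $ Rep_wo_index j) = det A"
proof -
  let ?r = "Rep_wo_index :: 'm wo_index \<Rightarrow> 'm" and ?P = "\<lambda>p :: 'm wo_index \<Rightarrow> _. map_permutation UNIV Rep_wo_index p"
  have bij: "bij_betw ?P {p. p permutes UNIV} {p. p permutes UNIV}"
  proof (rule bij_betwI[where g = "map_permutation UNIV Abs_wo_index"])
    show "?P \<in> {p. p permutes UNIV} \<rightarrow> {p. p permutes UNIV}"
      using map_permutation_permutes[OF bij_Rep_wo_index] by auto
    show "map_permutation UNIV Abs_wo_index \<in> {p :: 'm \<Rightarrow> 'm. p permutes UNIV} \<rightarrow> {p. p permutes UNIV}"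
      using map_permutation_permutes[OF bij_Abs_wo_index] by auto
  next
    fix p :: "'m wo_index \<Rightarrow> 'm wo_index" assume "p \<in> {p. p permutes UNIV}"
    then show "map_permutation UNIV Abs_wo_index (?P p) = p"
      using bij_Rep_wo_index
      by (intro map_permutation_compose_inv[of _ UNIV]) (auto simp: Rep_wo_index_inverse)
  next
    fix p :: "'m \<Rightarrow> 'm" assume "p \<in> {p. p permutes UNIV}"
    then show "?P (map_permutation UNIV Abs_wo_index p) = p"
      using bij_Abs_wo_index
      by (intro map_permutation_compose_inv[of _ UNIV]) (auto simp: Abs_wo_index_inverse)
  qed
  have inj: "inj ?r" using bij_Rep_wo_index by (rule bij_is_inj)
  have app: "?P p (?r i) = ?r (p i)" if "p permutes UNIV" for p i
    using map_permutation_apply[OF inj, of i p] by simp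
  have "det A = (\<Sum>p\<in>{p. p permutes UNIV}. of_int (sign (?P p)) * (\<Prod>i\<in>UNIV. A $ i $ ?P p i))"
    unfolding det_def
    using sum.reindex_bij_betw[OF bij, of "\<lambda>q. of_int (sign q) * (\<Prod>i\<in>UNIV. A $ i $ q i)"]
    by (rule sym)
  also have "\<dots> = (\<Sum>p\<in>{p. p permutes UNIV}. of_int (sign p) * (\<Prod>i\<in>UNIV. A $ ?r i $ ?r (p i)))"
  proof (rule sum.cong, simp)
    fix p :: "'m wo_index \<Rightarrow> 'm wo_index" assume "p \<in> {p. p permutes UNIV}"
    then have p: "p permutes UNIV" by simp
    have "sign (?P p) = sign p"
      by (rule sign_map_permutation) (use p inj in auto)
    moreover have "(\<Prod>i\<in>UNIV. A $ i $ ?P p i) = (\<Prod>i\<in>UNIV. A $ ?r i $ ?P p (?r i))"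
      using prod.reindex_bij_betw[OF bij_Rep_wo_index, of "\<lambda>i. A $ i $ ?P p i"] by simp
    ultimately show "of_int (sign (?P p)) * (\<Prod>i\<in>UNIV. A $ i $ ?P p i) = of_int (sign p) * (\<Prod>i\<in>UNIV. A $ ?r i $ ?r (p i))"
      by (simp add: app[OF p])
  qed
  finally show ?thesis by (simp add: det_def)
qed

lemma set_integral_lebesgue_borel:
  fixes f :: "'a::euclidean_space \<Rightarrow> 'b::euclidean_space"
  assumes "(\<lambda>x. indicator S x *\<^sub>R f x) \<in> borel_measurable borel"
  shows "f absolutely_integrable_on S \<longleftrightarrow> set_integrable lborel S f"
    and "(LINT x:S|lebesgue. f x) = (LINT x:S|lborel. f x)"
  using assms by (simp_all add: set_integrable_def set_lebesgue_integral_def integrable_completion integral_completion)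

text \<open>The variant for Bochner integrals over Borel sets, still over a well-ordered index type.\<close>

lemma change_of_variables_wellorder:
  fixes g :: "real^'m::{finite,wellorder} \<Rightarrow> real^'m::_" and f :: "real^'m::_ \<Rightarrow> real^'n"
  assumes S: "S \<in> sets borel"
    and deriv: "\<And>x. x \<in> S \<Longrightarrow> (g has_derivative g' x) (at x within S)"
    and inj: "inj_on g S"
    and meas: "(\<lambda>x. indicator S x *\<^sub>R (\<bar>det (matrix (g' x))\<bar> *\<^sub>R f (g x))) \<in> borel_measurable borel"
    and f: "set_integrable lborel (g ` S) f"
  shows "set_integrable lborel S (\<lambda>x. \<bar>det (matrix (g' x))\<bar> *\<^sub>R f (g x))"
    and "(LINT x:S|lborel. \<bar>det (matrix (g' x))\<bar> *\<^sub>R f (g x)) = (LINT z:g ` S|lborel. f z)"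
proof -
  have S': "S \<in> sets lebesgue" using S by simp
  have mf: "(\<lambda>x. indicator (g ` S) x *\<^sub>R f x) \<in> borel_measurable borel"
    using f by (simp add: set_integrable_def)
  have af: "f absolutely_integrable_on (g ` S)"
    using f set_integral_lebesgue_borel(1)[OF mf] by simp
  then have ag: "(\<lambda>x. \<bar>det (matrix (g' x))\<bar> *\<^sub>R f (g x)) absolutely_integrable_on S"
    using absolutely_integrable_change_of_variables[OF S' deriv inj] by blast
  then show "set_integrable lborel S (\<lambda>x. \<bar>det (matrix (g' x))\<bar> *\<^sub>R f (g x))"
    using set_integral_lebesgue_borel(1)[OF meas] by simp
  have "integral (g ` S) f = integral S (\<lambda>x. \<bar>det (matrix (g' x))\<bar> *\<^sub>R f (g x))"
    using integral_change_of_variables[OF S' deriv inj] af by blast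
  then show "(LINT x:S|lborel. \<bar>det (matrix (g' x))\<bar> *\<^sub>R f (g x)) = (LINT z:g ` S|lborel. f z)"
    using set_lebesgue_integral_eq_integral(2)[OF af] set_lebesgue_integral_eq_integral(2)[OF ag]
      set_integral_lebesgue_borel(2)[OF mf] set_integral_lebesgue_borel(2)[OF meas] by simp
qed

lemma change_of_variables_lborel:
  fixes g :: "real^'m::finite \<Rightarrow> real^'m::_" and f :: "real^'m::_ \<Rightarrow> real^'n"
  assumes S: "S \<in> sets borel"
    and deriv: "\<And>x. x \<in> S \<Longrightarrow> (g has_derivative g' x) (at x within S)"
    and inj: "inj_on g S"
    and meas: "(\<lambda>x. indicator S x *\<^sub>R (\<bar>det (matrix (g' x))\<bar> *\<^sub>R f (g x))) \<in> borel_measurable borel"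
    and f: "set_integrable lborel (g ` S) f"
  shows "set_integrable lborel S (\<lambda>x. \<bar>det (matrix (g' x))\<bar> *\<^sub>R f (g x))" (is ?int)
    and "(LINT x:S|lborel. \<bar>det (matrix (g' x))\<bar> *\<^sub>R f (g x)) = (LINT z:g ` S|lborel. f z)" (is ?eq)
proof -
  let ?S = "from_wo -` S" and ?g = "\<lambda>w. to_wo (g (from_wo w))"
    and ?g' = "\<lambda>w v. to_wo (g' (from_wo w) (from_wo v))" and ?f = "\<lambda>z. f (from_wo z)"
  have img: "?g ` ?S = from_wo -` (g ` S)"
  proof (intro set_eqI iffI)
    fix z assume "z \<in> from_wo -` (g ` S)"
    then obtain s where s: "s \<in> S" "from_wo z = g s" by auto
    then have "z = ?g (to_wo s)" "to_wo s \<in> ?S"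
      by (metis from_to_wo to_from_wo, simp)
    then show "z \<in> ?g ` ?S" by blast
  qed auto
  have indS: "indicator ?S w = (indicator S (from_wo w) :: real)" for w
    by (auto simp: indicator_def)
  have indI: "indicator (from_wo -` (g ` S)) w = (indicator (g ` S) (from_wo w) :: real)" for w
    by (auto simp: indicator_def)
  have det: "det (matrix (?g' w)) = det (matrix (g' (from_wo w)))" for w
  proof -
    have "from_wo (axis j 1) = axis (Rep_wo_index j) (1::real)" for j :: "'m wo_index"
      by (auto simp: from_wo_def axis_def vec_eq_iff Abs_wo_index_inverse Rep_wo_index_inverse)
    then have "matrix (?g' w) = (\<chi> i j. matrix (g' (from_wo w)) $ Rep_wo_index i $ Rep_wo_index j)"
      by (simp add: matrix_def to_wo_def)
    then show ?thesis by (simp add: det_wo_reindex)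
  qed
  have 1: "?S \<in> sets borel"
    using measurable_sets[OF measurable_from_wo S] by simp
  have 2: "(?g has_derivative ?g' w) (at w within ?S)" if "w \<in> ?S" for w
  proof -
    have "(from_wo has_derivative from_wo) (at w within ?S)"
      using bounded_linear_from_wo by (rule bounded_linear_imp_has_derivative)
    moreover have "(g has_derivative g' (from_wo w)) (at (from_wo w) within from_wo ` ?S)"
      by (rule has_derivative_subset[OF deriv]) (use that in auto)
    ultimately have "((\<lambda>w. g (from_wo w)) has_derivative (\<lambda>v. g' (from_wo w) (from_wo v))) (at w within ?S)"
      by (rule has_derivative_in_compose)
    then show ?thesis
      by (rule bounded_linear.has_derivative[OF bounded_linear_to_wo])
  qed
  have 3: "inj_on ?g ?S"
    using inj by (auto simp: inj_on_def) (metis from_to_wo to_from_wo)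
  have 4: "(\<lambda>w. indicator ?S w *\<^sub>R (\<bar>det (matrix (?g' w))\<bar> *\<^sub>R ?f (?g w))) \<in> borel_measurable borel"
    using measurable_compose[OF measurable_from_wo meas] by (simp add: det indS)
  have 5: "set_integrable lborel (?g ` ?S) ?f"
    unfolding img set_integrable_def indI
    using f integrable_from_wo[of "\<lambda>z. indicator (g ` S) z *\<^sub>R f z"]
    by (simp add: set_integrable_def)
  note cv = change_of_variables_wellorder[OF 1 2 3 4 5, simplified det img]
  show ?int
    using cv(1) integrable_from_wo[OF meas] by (simp add: set_integrable_def indS)
  have "(LINT z:from_wo -` (g ` S)|lborel. ?f z) = (LINT z:g ` S|lborel. f z)"
    using integral_from_wo[of "\<lambda>z. indicator (g ` S) z *\<^sub>R f z"] f
    by (simp add: set_lebesgue_integral_def indI set_integrable_def)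
  then show ?eq
    using cv(2) integral_from_wo[OF meas] by (simp add: set_lebesgue_integral_def indS)
qed

section \<open>Moments of an exponentially decaying kernel\<close>

lemma power_exp_bound:
  fixes a t :: real
  assumes "a > 0" "t \<ge> 0"
  shows "t ^ p * exp (- a * t) \<le> fact p / a ^ p"
proof -
  have "(\<Sum>n\<in>{p}. (a * t) ^ n /\<^sub>R fact n) \<le> (\<Sum>n. (a * t) ^ n /\<^sub>R fact n)"
    by (rule sum_le_suminf[OF summable_exp_generic]) (use assms in auto)
  then have "(a * t) ^ p / fact p \<le> exp (a * t)"
    by (simp add: exp_def divide_inverse mult.commute)
  then have "t ^ p \<le> fact p / a ^ p * exp (a * t)"
    using assms by (simp add: field_simps)
  then have "t ^ p * exp (- a * t) \<le> fact p / a ^ p * exp (a * t) * exp (- a * t)"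
    by (rule mult_right_mono) simp
  also have "\<dots> = fact p / a ^ p"
    by (simp add: mult.assoc flip: exp_add)
  finally show ?thesis .
qed

lemma integrable_exp_abs:
  assumes "c > 0"
  shows "integrable lborel (\<lambda>t::real. exp (- c * \<bar>t\<bar>))"
proof -
  have "integrable lborel (exponential_density c)"
  proof (rule integrableI_nonneg)
    interpret prob_space "density lborel (exponential_density c)"
      using assms by (rule prob_space_exponential_density)
    show "(\<integral>\<^sup>+ x. ennreal (exponential_density c x) \<partial>lborel) < \<infinity>"
      using emeasure_space_1 by (simp add: emeasure_density)
  qed (use exponential_density_nonneg[OF assms] in auto)
  then have int: "integrable lborel (\<lambda>t. exponential_density c t + exponential_density c (0 + (- 1) * t))"
    by (intro Bochner_Integration.integrable_add lborel_integrable_real_affine) auto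
  show ?thesis
  proof (rule Bochner_Integration.integrable_bound[OF Bochner_Integration.integrable_mult_right[OF int, of "1 / c"]])
    show "AE t in lborel. norm (exp (- c * \<bar>t\<bar>))
        \<le> norm (1 / c * (exponential_density c t + exponential_density c (0 + (- 1) * t)))"
      using assms by (intro always_eventually allI) (auto simp: exponential_density_def mult.commute)
  qed simp
qed

text \<open>The norm dominates the mean of the absolute values of the coordinates, so the function is
  dominated by a product of one-dimensional exponentials.\<close>

lemma integrable_exp_norm:
  assumes "a > 0"
  shows "integrable lborel (\<lambda>z::'a::euclidean_space. exp (- a * norm z))"
proof -
  let ?c = "a / DIM('a)"
  interpret product_sigma_finite "\<lambda>_::'a. lborel :: real measure" ..
  have c: "?c > 0" using assms by simp
  have "integrable (\<Pi>\<^sub>M b\<in>Basis. lborel) (\<lambda>x. \<Prod>b\<in>(Basis::'a set). exp (- ?c * \<bar>x b\<bar>))"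
    by (rule product_integrable_prod) (use integrable_exp_abs[OF c] in auto)
  also have "?this \<longleftrightarrow> integrable (\<Pi>\<^sub>M b\<in>Basis. lborel)
      (\<lambda>x. \<Prod>b\<in>(Basis::'a set). exp (- ?c * \<bar>(\<Sum>i\<in>Basis. x i *\<^sub>R i) \<bullet> b\<bar>))"
    by (intro Bochner_Integration.integrable_cong refl prod.cong) (simp add: inner_sum_left_Basis)
  finally have int: "integrable lborel (\<lambda>z::'a. \<Prod>b\<in>Basis. exp (- ?c * \<bar>z \<bullet> b\<bar>))"
    by (subst lborel_eq) (simp add: integrable_distr_eq)
  show ?thesis
  proof (rule Bochner_Integration.integrable_bound[OF int])
    show "AE z in lborel. norm (exp (- a * norm z)) \<le> norm (\<Prod>b\<in>(Basis::'a set). exp (- ?c * \<bar>z \<bullet> b\<bar>))"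
    proof (intro always_eventually allI)
      fix z :: 'a
      have "(\<Sum>b\<in>(Basis::'a set). \<bar>z \<bullet> b\<bar>) \<le> (\<Sum>b\<in>(Basis::'a set). norm z)"
        by (intro sum_mono Basis_le_norm)
      then have "?c * (\<Sum>b\<in>(Basis::'a set). \<bar>z \<bullet> b\<bar>) \<le> ?c * (DIM('a) * norm z)"
        using c by (intro mult_left_mono) auto
      also have "\<dots> = a * norm z" by simp
      finally show "norm (exp (- a * norm z)) \<le> norm (\<Prod>b\<in>(Basis::'a set). exp (- ?c * \<bar>z \<bullet> b\<bar>))"
        by (simp add: sum_distrib_left sum_negf flip: exp_sum)
    qed
  qed simp
qed

lemma integrable_norm_power_exp:
  assumes "a > 0"
  shows "integrable lborel (\<lambda>z::'a::euclidean_space. norm z ^ p * exp (- a * norm z))"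
proof (rule Bochner_Integration.integrable_bound)
  show "integrable lborel (\<lambda>z::'a. fact p / (a / 2) ^ p * exp (- (a / 2) * norm z))"
    using assms by (intro integrable_mult_right integrable_exp_norm) simp
  show "AE z::'a in lborel. norm (norm z ^ p * exp (- a * norm z))
      \<le> norm (fact p / (a / 2) ^ p * exp (- (a / 2) * norm z))"
  proof (intro always_eventually allI)
    fix z :: 'a
    have "norm z ^ p * exp (- a * norm z)
        = (norm z ^ p * exp (- (a / 2) * norm z)) * exp (- (a / 2) * norm z)"
      by (simp add: mult.assoc flip: exp_add)
    also have "\<dots> \<le> fact p / (a / 2) ^ p * exp (- (a / 2) * norm z)"
      using power_exp_bound[of "a / 2" "norm z" p] assms by (intro mult_right_mono) auto
    finally show "norm (norm z ^ p * exp (- a * norm z))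
        \<le> norm (fact p / (a / 2) ^ p * exp (- (a / 2) * norm z))"
      using assms by (simp add: abs_mult)
  qed
qed simp

lemma
  fixes f :: "'a::euclidean_space \<Rightarrow> 'b::euclidean_space"
  assumes f [measurable]: "f \<in> borel_measurable borel" and c: "c \<noteq> 0"
  shows integrable_lborel_affine: "integrable lborel (\<lambda>z. f (t + c *\<^sub>R z)) \<longleftrightarrow> integrable lborel f"
    and integral_lborel_affine: "(\<integral>z. f z \<partial>lborel) = \<bar>c\<bar> ^ DIM('a) *\<^sub>R (\<integral>z. f (t + c *\<^sub>R z) \<partial>lborel)"
proof -
  let ?d = "density (distr lborel borel (\<lambda>x. t + c *\<^sub>R x)) (\<lambda>_. ennreal (\<bar>c\<bar> ^ DIM('a)))"
  have d: "?d = lborel"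
    using lborel_affine[OF c, of t] by (simp add: ennreal_power)
  have "integrable ?d f \<longleftrightarrow> integrable lborel (\<lambda>z. f (t + c *\<^sub>R z))"
  proof -
    have "integrable ?d f \<longleftrightarrow> integrable lborel (\<lambda>z. \<bar>c\<bar> ^ DIM('a) *\<^sub>R f (t + c *\<^sub>R z))"
      by (subst integrable_density) (auto simp: integrable_distr_eq)
    moreover have "integrable lborel (\<lambda>z. f (t + c *\<^sub>R z))"
      if "integrable lborel (\<lambda>z. \<bar>c\<bar> ^ DIM('a) *\<^sub>R f (t + c *\<^sub>R z))"
      using integrable_scaleR_right[of "inverse (\<bar>c\<bar> ^ DIM('a))", OF that] c by simp
    ultimately show ?thesis by (auto intro: integrable_scaleR_right)
  qed
  then show "integrable lborel (\<lambda>z. f (t + c *\<^sub>R z)) \<longleftrightarrow> integrable lborel f"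
    unfolding d by simp
  have "(\<integral>z. f z \<partial>?d) = \<bar>c\<bar> ^ DIM('a) *\<^sub>R (\<integral>z. f (t + c *\<^sub>R z) \<partial>lborel)"
    by (subst integral_density) (auto simp: integral_distr)
  then show "(\<integral>z. f z \<partial>lborel) = \<bar>c\<bar> ^ DIM('a) *\<^sub>R (\<integral>z. f (t + c *\<^sub>R z) \<partial>lborel)"
    unfolding d .
qed

lemma integral_lborel_reflect:
  fixes f :: "'a::euclidean_space \<Rightarrow> 'b::euclidean_space"
  assumes f [measurable]: "f \<in> borel_measurable borel" and b: "b \<in> Basis"
  shows "(\<integral>z. f (z - (2 * (z \<bullet> b)) *\<^sub>R b) \<partial>lborel) = (\<integral>z. f z \<partial>lborel)"
proof -
  let ?c = "\<lambda>j. if j = b then - 1 else (1::real)"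
  let ?T = "\<lambda>x::'a. 0 + (\<Sum>j\<in>Basis. (?c j * (x \<bullet> j)) *\<^sub>R j)"
  have T: "?T x = x - (2 * (x \<bullet> b)) *\<^sub>R b" for x
    by (rule euclidean_eqI) (use b in \<open>auto simp: inner_diff_left inner_sum_left inner_Basis if_distrib sum.delta cong: if_cong\<close>)
  have "lborel = density (distr lborel borel ?T) (\<lambda>_. ennreal (\<Prod>j\<in>Basis. \<bar>?c j\<bar>))"
    by (rule lborel_affine_euclidean) auto
  then have "lborel = distr lborel borel ?T"
    by (simp add: prod.neutral density_1)
  then have "(\<integral>z. f z \<partial>lborel) = (\<integral>z. f z \<partial>distr lborel borel ?T)" by simp
  also have "\<dots> = (\<integral>z. f (?T z) \<partial>lborel)" by (rule integral_distr) auto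
  finally show ?thesis unfolding T by simp
qed

text \<open>The constants of the exponential decay are fixed, as all error terms are computed from them.\<close>

locale decaying_kernel =
  fixes K :: "real \<Rightarrow> real" and a1 a2 :: real
  assumes kernel: "kernel_function K"
    and a1: "a1 > 0" and a2: "a2 > 0"
    and decay: "\<And>z. z \<ge> 0 \<Longrightarrow> K z \<le> a1 * exp (- a2 * z)"
begin

lemma kernel_nonneg: "z \<ge> 0 \<Longrightarrow> 0 \<le> K z"
  using kernel by (simp add: kernel_function_def)

text \<open>The kernel is measurable on the nonnegative half-line only, so it may be composed only with
  nonnegative functions.\<close>

lemma measurable_kernel:
  assumes "g \<in> borel_measurable M" "\<And>x. x \<in> space M \<Longrightarrow> 0 \<le> g x"
  shows "(\<lambda>x. K (g x)) \<in> borel_measurable M"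
proof (rule measurable_compose[of g M "restrict_space borel {0..}" K borel])
  show "g \<in> M \<rightarrow>\<^sub>M restrict_space borel {0..}"
    using assms by (intro measurable_restrict_space2) auto
  show "K \<in> borel_measurable (restrict_space borel {0..})"
    using kernel by (simp add: kernel_function_def)
qed

lemma measurable_kernel_norm [measurable]:
  "f \<in> borel_measurable M \<Longrightarrow> (\<lambda>x. K (norm (f x :: 'a::euclidean_space))) \<in> borel_measurable M"
  by (rule measurable_kernel) auto

lemma integrable_kernel_moment:
  "integrable lborel (\<lambda>z::'a::euclidean_space. K (norm z) * norm z ^ p)"
proof (rule Bochner_Integration.integrable_bound)
  show "integrable lborel (\<lambda>z::'a. a1 * (norm z ^ p * exp (- a2 * norm z)))"
    using a2 by (intro integrable_mult_right integrable_norm_power_exp)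
  show "AE z::'a in lborel. norm (K (norm z) * norm z ^ p) \<le> norm (a1 * (norm z ^ p * exp (- a2 * norm z)))"
  proof (intro always_eventually allI)
    fix z :: 'a
    have "K (norm z) * norm z ^ p \<le> a1 * exp (- a2 * norm z) * norm z ^ p"
      using decay by (intro mult_right_mono) auto
    then show "norm (K (norm z) * norm z ^ p) \<le> norm (a1 * (norm z ^ p * exp (- a2 * norm z)))"
      using kernel_nonneg[of "norm z"] a1 by (simp add: abs_mult mult_ac)
  qed
qed simp

lemma integrable_kernel_vector:
  fixes L :: "'a::euclidean_space \<Rightarrow> 'b::euclidean_space"
  assumes [measurable]: "S \<in> sets borel" "L \<in> borel_measurable borel" and L: "\<And>z. norm (L z) \<le> norm z"
  shows "integrable lborel (\<lambda>z. indicator S z *\<^sub>R (K (norm z) *\<^sub>R L z))"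
proof (rule Bochner_Integration.integrable_bound[OF integrable_kernel_moment[of 1]])
  show "AE z in lborel. norm (indicator S z *\<^sub>R (K (norm z) *\<^sub>R L z)) \<le> norm (K (norm z) * norm z ^ 1)"
    using L by (intro always_eventually allI)
      (auto simp: indicator_def abs_mult intro!: mult_left_mono)
qed simp

abbreviation cone_moment :: "'a::euclidean_space set \<Rightarrow> 'a" where
  "cone_moment S \<equiv> \<integral>z. indicator S z *\<^sub>R (K (norm z) *\<^sub>R z) \<partial>lborel"

abbreviation half_space_flux :: "'a::euclidean_space \<Rightarrow> real \<Rightarrow> real" where
  "half_space_flux e t \<equiv> \<integral>z. indicator {z. z \<bullet> e < t} z * (K (norm z) * (z \<bullet> e)) \<partial>lborel"

abbreviation kernel_mean :: "'a::euclidean_space measure \<Rightarrow> 'a \<Rightarrow> real \<Rightarrow> 'a" where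
  "kernel_mean \<mu> x h \<equiv> \<integral>y. K (norm (x - y) / h) *\<^sub>R (y - x) \<partial>\<mu>"

text \<open>The reflection in a coordinate direction \<open>b\<close> other than \<open>e\<close> preserves
  the half space and the norm and changes the sign of \<open>z \<bullet> b\<close>. So only the
  component along \<open>e\<close> survives. The strict inequality on the right-hand side is the
  one in the definition of \<open>m1\<close>; on the hyperplane the integrand is zero.\<close>

lemma half_space_kernel_moment:
  fixes e :: "'a::euclidean_space"
  assumes e: "e \<in> Basis"
  shows "(\<integral>z. indicator {z. z \<bullet> e \<le> 0} z *\<^sub>R (K (norm z) *\<^sub>R z) \<partial>lborel)
       = (half_space_flux e 0) *\<^sub>R e"
proof (rule euclidean_eqI)
  fix b :: 'a assume b: "b \<in> Basis"
  let ?f = "\<lambda>z::'a. indicator {z. z \<bullet> e \<le> 0} z * (K (norm z) * (z \<bullet> b))"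
  have [measurable]: "{z. z \<bullet> e \<le> 0} \<in> sets (borel :: 'a measure)"
    by (intro borel_closed closed_Collect_le continuous_intros)
  have int: "integrable lborel (\<lambda>z::'a. indicator {z. z \<bullet> e \<le> 0} z *\<^sub>R (K (norm z) *\<^sub>R z))"
    by (rule integrable_kernel_vector) auto
  have lhs: "(\<integral>z. indicator {z. z \<bullet> e \<le> 0} z *\<^sub>R (K (norm z) *\<^sub>R z) \<partial>lborel) \<bullet> b = (\<integral>z. ?f z \<partial>lborel)"
    by (subst integral_inner_left[symmetric]) (use int in \<open>auto simp: mult.assoc\<close>)
  show "(\<integral>z. indicator {z. z \<bullet> e \<le> 0} z *\<^sub>R (K (norm z) *\<^sub>R z) \<partial>lborel) \<bullet> b
      = ((half_space_flux e 0) *\<^sub>R e) \<bullet> b"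
  proof (cases "b = e")
    case True
    have "(\<integral>z. ?f z \<partial>lborel) = (half_space_flux e 0)"
      using True by (intro Bochner_Integration.integral_cong) (auto simp: indicator_def)
    then show ?thesis using lhs True e by simp
  next
    case False
    then have be: "b \<bullet> e = 0" using b e by (simp add: inner_Basis)
    have "norm (z - (2 * (z \<bullet> b)) *\<^sub>R b) = norm z" for z :: 'a
      using b by (simp add: norm_eq_sqrt_inner inner_diff_left inner_diff_right algebra_simps inner_commute)
    then have "?f (z - (2 * (z \<bullet> b)) *\<^sub>R b) = - ?f z" for z
      using b by (simp add: inner_diff_left be indicator_def algebra_simps)
    then have "(\<integral>z. ?f z \<partial>lborel) = (\<integral>z. - ?f z \<partial>lborel)"
      using integral_lborel_reflect[of ?f b] b by simp
    then have "(\<integral>z. ?f z \<partial>lborel) = 0" by simp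
    then show ?thesis using lhs be by (simp add: inner_commute)
  qed
qed

lemma full_space_kernel_moment:
  "(\<integral>z. K (norm z) *\<^sub>R (z::'a::euclidean_space) \<partial>lborel) = 0"
proof -
  have "(\<integral>z. K (norm z) *\<^sub>R (z::'a) \<partial>lborel) = (\<integral>z. - (K (norm z) *\<^sub>R (z::'a)) \<partial>lborel)"
    using integral_lborel_affine[of "\<lambda>z::'a. K (norm z) *\<^sub>R z" "-1" 0] by simp
  also have "\<dots> = - (\<integral>z. K (norm z) *\<^sub>R (z::'a) \<partial>lborel)" by simp
  finally have "2 *\<^sub>R (\<integral>z. K (norm z) *\<^sub>R (z::'a) \<partial>lborel) = 0"
    unfolding scaleR_2 by (rule eq_neg_iff_add_eq_0[THEN iffD1])
  then show ?thesis by simp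
qed

text \<open>This is \<open>m1\<close> at an interior point. The integral over the whole space is zero by
  symmetry, and on the missing part \<open>z \<bullet> e \<ge> b / h\<close> a factor \<open>1
  \<le> (h / b) |z \<bullet> e|\<close> can be inserted.\<close>

lemma kernel_flux_bound:
  fixes e :: "'a::euclidean_space"
  assumes e: "e \<in> Basis" and b: "b > 0" and h: "h > 0"
  shows "\<bar>\<integral>z. indicator {z. z \<bullet> e < b / h} z * (K (norm z) * (z \<bullet> e)) \<partial>lborel\<bar>
       \<le> h * ((\<integral>z. K (norm z) * norm (z::'a) ^ 2 \<partial>lborel) / b)"
proof -
  have [measurable]: "{z. z \<bullet> e < b / h} \<in> sets (borel :: 'a measure)"
    by (intro borel_open open_Collect_less continuous_intros)
  have eb: "\<bar>z \<bullet> e\<bar> \<le> norm z" for z using e by (rule Basis_le_norm)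
  have int: "integrable lborel (\<lambda>z. indicator S z *\<^sub>R (K (norm z) *\<^sub>R (z \<bullet> e)))"
    if "S \<in> sets borel" for S
    using that eb by (intro integrable_kernel_vector) auto
  have zero: "(\<integral>z. K (norm z) * (z \<bullet> e) \<partial>lborel) = 0"
  proof -
    have "integrable lborel (\<lambda>z. K (norm z) *\<^sub>R (z::'a))"
      using integrable_kernel_vector[of UNIV "\<lambda>z::'a. z"] by simp
    then have "(\<integral>z. (K (norm z) *\<^sub>R z) \<bullet> e \<partial>lborel) = (\<integral>z. K (norm z) *\<^sub>R (z::'a) \<partial>lborel) \<bullet> e"
      by (intro integral_inner_left)
    then show ?thesis by (simp add: full_space_kernel_moment)
  qed
  let ?f = "\<lambda>z. indicator {z. z \<bullet> e < b / h} z * (K (norm z) * (z \<bullet> e))"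
  have "(\<integral>z. ?f z \<partial>lborel) = (\<integral>z. ?f z - K (norm z) * (z \<bullet> e) \<partial>lborel)"
    using int[of "{z. z \<bullet> e < b / h}"] int[of UNIV] zero
    by (subst Bochner_Integration.integral_diff) auto
  also have "norm \<dots> \<le> (\<integral>z. h / b * (K (norm z) * norm (z::'a) ^ 2) \<partial>lborel)"
  proof (rule Bochner_Integration.integral_norm_bound_integral)
    show "integrable lborel (\<lambda>z. ?f z - K (norm z) * (z \<bullet> e))"
      using int[of "{z. z \<bullet> e < b / h}"] int[of UNIV] by (intro Bochner_Integration.integrable_diff) auto
    show "integrable lborel (\<lambda>z::'a. h / b * (K (norm z) * norm z ^ 2))"
      by (intro integrable_mult_right integrable_kernel_moment)
    fix z :: 'a
    show "norm (?f z - K (norm z) * (z \<bullet> e)) \<le> h / b * (K (norm z) * norm z ^ 2)"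
    proof (cases "z \<bullet> e < b / h")
      case True
      then show ?thesis using kernel_nonneg[of "norm z"] b h by simp
    next
      case False
      then have "b \<le> h * (z \<bullet> e)" using h by (simp add: field_simps)
      also have "\<dots> \<le> h * \<bar>z \<bullet> e\<bar>" using h by (intro mult_left_mono) auto
      finally have "1 \<le> h / b * \<bar>z \<bullet> e\<bar>" using b by (simp add: field_simps)
      then have "\<bar>z \<bullet> e\<bar> * 1 \<le> \<bar>z \<bullet> e\<bar> * (h / b * \<bar>z \<bullet> e\<bar>)"
        by (intro mult_left_mono) auto
      also have "\<dots> = h / b * (\<bar>z \<bullet> e\<bar> * \<bar>z \<bullet> e\<bar>)" by simp
      also have "\<dots> \<le> h / b * (norm z * norm z)"
        using eb b h by (intro mult_left_mono mult_mono) auto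
      finally have "K (norm z) * \<bar>z \<bullet> e\<bar> \<le> K (norm z) * (h / b * (norm z * norm z))"
        using kernel_nonneg[of "norm z"] by (intro mult_left_mono) auto
      then show ?thesis
        using False kernel_nonneg[of "norm z"] by (simp add: abs_mult power2_eq_square mult_ac)
    qed
  qed
  finally show ?thesis by simp
qed

end

section \<open>Orthonormal coordinates on the tangent space\<close>

text \<open>The orthonormal basis chosen in the definition of the Lebesgue measure on the hyperplane
  orthogonal to \<open>\<eta>\<close>, together with \<open>\<eta>\<close> itself, is an
  orthonormal basis of \<open>T\<close>. Mapping the standard basis onto it gives the isometry
  \<open>L\<close>, and the iterated integral over hyperplane and normal line is an integral
  over coordinate space. The scalar variable is kept as a second argument of \<open>f\<close>,
  because the outer measure lives on the whole surrounding space, where \<open>zl\<close> is not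
  determined by \<open>zp + zl \<eta>\<close>.\<close>

lemma subspace_integral_coordinates:
  fixes T :: "'a::euclidean_space set" and \<eta> :: 'a
  assumes T: "subspace T" and dim: "dim T = DIM('v::euclidean_space)"
    and \<eta>: "\<eta> \<in> T" "norm \<eta> = 1"
  obtains L :: "'v::euclidean_space \<Rightarrow> 'a" and e where "linear L" "\<And>z. norm (L z) = norm z" "range L = T"
    "e \<in> Basis" "L e = \<eta>"
    "\<And>f :: 'a \<Rightarrow> real \<Rightarrow> real. case_prod f \<in> borel_measurable (borel \<Otimes>\<^sub>M borel) \<Longrightarrow>
       integrable lborel (\<lambda>z. f (L z) (z \<bullet> e)) \<Longrightarrow>
       (\<integral>zp. (\<integral>zl. f (zp + zl *\<^sub>R \<eta>) zl \<partial>lborel) \<partial>subspace_lborel {z \<in> T. z \<bullet> \<eta> = 0})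
         = (\<integral>z. f (L z) (z \<bullet> e) \<partial>lborel)"
proof -
  let ?V = "{z \<in> T. z \<bullet> \<eta> = 0}"
  let ?Q = "\<lambda>B. B \<subseteq> ?V \<and> pairwise orthogonal B \<and> (\<forall>b\<in>B. norm b = 1) \<and> span B = ?V"
  have "subspace ?V"
    using T by (auto simp: subspace_def inner_add_left)
  then have "\<exists>B. ?Q B"
    by (rule orthonormal_basis_subspace) auto
  define B where "B = (SOME B. ?Q B)"
  have "?Q B"
    unfolding B_def using \<open>\<exists>B. ?Q B\<close> by (rule someI_ex)
  then have B: "B \<subseteq> ?V" "pairwise orthogonal B" "\<And>b. b \<in> B \<Longrightarrow> norm b = 1" "span B = ?V"
    by auto
  have \<eta>\<eta>: "\<eta> \<bullet> \<eta> = 1" using \<eta> by (simp add: norm_eq_1)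
  then have \<eta>B: "\<eta> \<notin> B" using B(1) by auto
  define I where "I = insert \<eta> B"
  have orth: "i \<bullet> j = (if i = j then 1 else 0)" if "i \<in> I" "j \<in> I" for i j
    using that B(1-3) \<eta>\<eta> by (auto simp: I_def pairwise_def orthogonal_def inner_commute norm_eq_1)
  have indep: "independent I"
    by (rule pairwise_orthogonal_independent)
       (use orth in \<open>auto simp: pairwise_def orthogonal_def split: if_splits\<close>, metis inner_zero_left zero_neq_one)
  then have fin: "finite I" by (rule independent_imp_finite)
  then have finB: "finite B" by (simp add: I_def)
  have span: "span I = T"
  proof
    show "span I \<subseteq> T"
      using T \<eta> B(1) by (intro span_minimal) (auto simp: I_def)
    show "T \<subseteq> span I"
    proof
      fix z assume z: "z \<in> T"
      have "z - (z \<bullet> \<eta>) *\<^sub>R \<eta> \<in> ?V"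
        using z T \<eta> \<eta>\<eta> by (auto simp: inner_diff_left subspace_diff subspace_scale)
      then have "z - (z \<bullet> \<eta>) *\<^sub>R \<eta> \<in> span I"
        unfolding B(4)[symmetric] I_def using span_mono[of B "insert \<eta> B"] by blast
      moreover have "(z \<bullet> \<eta>) *\<^sub>R \<eta> \<in> span I"
        by (intro span_scale span_base) (simp add: I_def)
      ultimately have "(z - (z \<bullet> \<eta>) *\<^sub>R \<eta>) + (z \<bullet> \<eta>) *\<^sub>R \<eta> \<in> span I" by (rule span_add)
      then show "z \<in> span I" by simp
    qed
  qed
  have "card I = DIM('v)"
    using dim_span_eq_card_independent[OF indep] span dim by simp
  then obtain \<gamma> :: "'a \<Rightarrow> 'v" where \<gamma>: "bij_betw \<gamma> I Basis"
    using finite_same_card_bij[OF fin, of "Basis :: 'v set"] by auto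
  have \<gamma>\<gamma>: "\<gamma> i \<bullet> \<gamma> j = (if i = j then 1 else 0)" "\<gamma> i \<in> Basis" if "i \<in> I" "j \<in> I" for i j
    using that bij_betw_imp_inj_on[OF \<gamma>] bij_betwE[OF \<gamma>] by (auto simp: inner_Basis inj_on_eq_iff)
  define L where "L z = (\<Sum>i\<in>I. (z \<bullet> \<gamma> i) *\<^sub>R i)" for z
  define e where "e = \<gamma> \<eta>"
  have lin: "linear L"
    unfolding L_def by (intro linearI) (simp_all add: inner_add_left scaleR_add_left sum.distrib scaleR_sum_right)
  then have measL [measurable]: "L \<in> borel_measurable borel"
    by (intro borel_measurable_continuous_onI linear_continuous_on linear_conv_bounded_linear[THEN iffD1])
  have L\<gamma>: "L (\<gamma> i) = i" if "i \<in> I" for i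
  proof -
    have "L (\<gamma> i) = (\<Sum>j\<in>I. if j = i then i else 0)"
      unfolding L_def by (rule sum.cong) (use \<gamma>\<gamma> that in auto)
    then show ?thesis using fin that by simp
  qed
  have norm: "norm (L z) = norm z" for z
  proof -
    have "L z \<bullet> L z = (\<Sum>i\<in>I. \<Sum>j\<in>I. (z \<bullet> \<gamma> i) * ((z \<bullet> \<gamma> j) * (i \<bullet> j)))"
      unfolding L_def inner_sum_left
      by (rule sum.cong) (simp_all add: inner_sum_right sum_distrib_left mult.left_commute)
    also have "\<dots> = (\<Sum>i\<in>I. \<Sum>j\<in>I. if j = i then (z \<bullet> \<gamma> i)\<^sup>2 else 0)"
      by (intro sum.cong refl) (auto simp: orth power2_eq_square)
    also have "\<dots> = (\<Sum>i\<in>I. (z \<bullet> \<gamma> i)\<^sup>2)"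
      using fin by simp
    also have "\<dots> = (\<Sum>b\<in>Basis. (z \<bullet> b)\<^sup>2)"
      using sum.reindex_bij_betw[OF \<gamma>, of "\<lambda>b. (z \<bullet> b)\<^sup>2"] .
    also have "\<dots> = z \<bullet> z"
      by (simp add: euclidean_inner[of z z] power2_eq_square)
    finally show ?thesis by (simp add: norm_eq_sqrt_inner)
  qed
  have range: "range L = T"
  proof
    show "range L \<subseteq> T"
    proof (intro image_subsetI)
      show "L z \<in> T" for z
        unfolding span[symmetric] L_def by (intro span_sum span_scale span_base)
    qed
    have "I \<subseteq> range L" using L\<gamma> by (metis rangeI subsetI)
    moreover have "subspace (range L)" using lin by (simp add: linear_subspace_image)
    ultimately show "T \<subseteq> range L"
      unfolding span[symmetric] by (rule span_minimal)
  qed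
  show ?thesis
  proof (rule that[OF lin norm range])
    show "e \<in> Basis" "L e = \<eta>"
      using \<gamma>\<gamma> L\<gamma> by (auto simp: e_def I_def)
    fix f :: "'a \<Rightarrow> real \<Rightarrow> real"
    assume [measurable]: "case_prod f \<in> borel_measurable (borel \<Otimes>\<^sub>M borel)"
      and int: "integrable lborel (\<lambda>z. f (L z) (z \<bullet> e))"
    interpret product_sigma_finite "\<lambda>_::'a. lborel :: real measure" ..
    let ?s = "\<lambda>c. \<Sum>i\<in>I. c i *\<^sub>R \<gamma> i"
    have [measurable]: "?s \<in> borel_measurable (\<Pi>\<^sub>M i\<in>I. lborel)"
      by (intro borel_measurable_sum borel_measurable_scaleR) auto
    have fmeas: "(\<lambda>z. f (L z) (z \<bullet> e)) \<in> borel_measurable borel" by measurable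
    have Ls: "L (?s c) = (\<Sum>i\<in>I. c i *\<^sub>R i)" for c
      by (simp add: linear_sum[OF lin] linear_scale[OF lin] L\<gamma>)
    have se: "?s c \<bullet> e = c \<eta>" for c
    proof -
      have "?s c \<bullet> e = (\<Sum>i\<in>I. if i = \<eta> then c i else 0)"
        unfolding inner_sum_left by (rule sum.cong) (auto simp: e_def \<gamma>\<gamma> I_def)
      then show ?thesis using fin by (simp add: I_def)
    qed
    let ?g = "\<lambda>c. f (\<Sum>i\<in>I. c i *\<^sub>R i) (c \<eta>)"
    have "integrable (\<Pi>\<^sub>M i\<in>I. lborel) (\<lambda>c. f (L (?s c)) (?s c \<bullet> e))"
      using int fmeas by (subst (asm) lborel_eq_distr_PiM[OF \<gamma>]) (simp add: integrable_distr_eq)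
    then have intg: "integrable (\<Pi>\<^sub>M i\<in>insert \<eta> B. lborel) ?g"
      unfolding Ls se by (simp add: I_def)
    have "(\<integral>z. f (L z) (z \<bullet> e) \<partial>lborel) = (\<integral>c. f (L (?s c)) (?s c \<bullet> e) \<partial>(\<Pi>\<^sub>M i\<in>I. lborel))"
      using fmeas by (subst lborel_eq_distr_PiM[OF \<gamma>]) (simp add: integral_distr)
    also have "\<dots> = (\<integral>c. ?g c \<partial>(\<Pi>\<^sub>M i\<in>insert \<eta> B. lborel))"
      unfolding Ls se by (simp add: I_def)
    also have "\<dots> = (\<integral>c. (\<integral>t. ?g (c(\<eta> := t)) \<partial>lborel) \<partial>(\<Pi>\<^sub>M i\<in>B. lborel))"
      by (rule product_integral_insert[OF finB \<eta>B intg])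
    also have "\<dots> = (\<integral>c. (\<integral>t. f ((\<Sum>b\<in>B. c b *\<^sub>R b) + t *\<^sub>R \<eta>) t \<partial>lborel) \<partial>(\<Pi>\<^sub>M i\<in>B. lborel))"
    proof -
      have "(\<Sum>i\<in>I. (c(\<eta> := t)) i *\<^sub>R i) = (\<Sum>b\<in>B. c b *\<^sub>R b) + t *\<^sub>R \<eta>" for c t
      proof -
        have "(\<Sum>b\<in>B. (c(\<eta> := t)) b *\<^sub>R b) = (\<Sum>b\<in>B. c b *\<^sub>R b)"
          by (rule sum.cong) (use \<eta>B in auto)
        then show ?thesis using finB \<eta>B by (simp add: I_def)
      qed
      then show ?thesis by simp
    qed
    also have "\<dots> = (\<integral>zp. (\<integral>zl. f (zp + zl *\<^sub>R \<eta>) zl \<partial>lborel) \<partial>distr (\<Pi>\<^sub>M b\<in>B. lborel) borel (\<lambda>c. \<Sum>b\<in>B. c b *\<^sub>R b))"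
    proof (rule integral_distr[symmetric])
      show "(\<lambda>c. \<Sum>b\<in>B. c b *\<^sub>R b) \<in> borel_measurable (\<Pi>\<^sub>M b\<in>B. lborel)"
        by (intro borel_measurable_sum borel_measurable_scaleR) auto
      show "(\<lambda>zp. \<integral>zl. f (zp + zl *\<^sub>R \<eta>) zl \<partial>lborel) \<in> borel_measurable borel"
        by measurable
    qed
    finally show "(\<integral>zp. (\<integral>zl. f (zp + zl *\<^sub>R \<eta>) zl \<partial>lborel) \<partial>subspace_lborel ?V)
         = (\<integral>z. f (L z) (z \<bullet> e) \<partial>lborel)"
      by (simp add: subspace_lborel_def Let_def flip: B_def)
  qed
qed

context decaying_kernel
begin

lemma m1_boundary_coordinates:
  fixes L :: "real^'m::finite \<Rightarrow> 'a::euclidean_space" and M :: "'a set"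
  assumes lin: "linear L" and norm: "\<And>z. norm (L z) = norm z"
    and b: "boundary_dist TYPE('m) M x = ereal b" and e: "e \<in> Basis"
    and fub: "\<And>f :: 'a \<Rightarrow> real \<Rightarrow> real. case_prod f \<in> borel_measurable (borel \<Otimes>\<^sub>M borel) \<Longrightarrow>
       integrable lborel (\<lambda>z. f (L z) (z \<bullet> e)) \<Longrightarrow>
       (\<integral>zp. (\<integral>zl. f (zp + zl *\<^sub>R \<eta>) zl \<partial>lborel)
         \<partial>subspace_lborel {z \<in> tangent_space TYPE('m) M x. z \<bullet> \<eta> = 0})
       = (\<integral>z. f (L z) (z \<bullet> e) \<partial>lborel)"
  shows "m1_boundary TYPE('m) M K x \<eta> h
       = - (half_space_flux e (b / h))"
proof -
  let ?f = "\<lambda>y t. indicator {..<b / h} t * (K (norm y) * t)"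
  have meas: "case_prod ?f \<in> borel_measurable ((borel :: 'a measure) \<Otimes>\<^sub>M borel)"
    by measurable
  have eq: "?f (L z) (z \<bullet> e) = indicator {z. z \<bullet> e < b / h} z * (K (norm z) * (z \<bullet> e))" for z
    by (simp add: norm indicator_def)
  have "{z. z \<bullet> e < b / h} \<in> sets (borel :: (real^'m) measure)"
    by (intro borel_open open_Collect_less continuous_intros)
  then have "integrable lborel (\<lambda>z. indicator {z. z \<bullet> e < b / h} z *\<^sub>R (K (norm z) *\<^sub>R (z \<bullet> e)))"
    using Basis_le_norm[OF e] by (intro integrable_kernel_vector) auto
  then have int: "integrable lborel (\<lambda>z. ?f (L z) (z \<bullet> e))"
    unfolding eq by simp
  have "(LBINT zl = - \<infinity>..ereal (b / h). K (norm (zp + zl *\<^sub>R \<eta>)) * zl)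
      = (\<integral>zl. ?f (zp + zl *\<^sub>R \<eta>) zl \<partial>lborel)" for zp
    by (simp add: interval_lebesgue_integral_def set_lebesgue_integral_def einterval_def
        lessThan_def indicator_def)
  then show ?thesis
    using fub[OF meas int] by (simp add: m1_boundary_def b eq)
qed

end

section \<open>Smooth maps and charts\<close>

lemma differentiable_imp_locally_lipschitz_at:
  fixes f :: "'a::real_normed_vector \<Rightarrow> 'b::real_normed_vector"
  assumes "f differentiable (at x)"
  obtains C where "C \<ge> 0" "\<forall>\<^sub>F y in nhds x. norm (f y - f x) \<le> C * norm (y - x)"
proof -
  obtain f' where "(f has_derivative f') (at x)"
    using assms by (auto simp: differentiable_def)
  then have lin: "bounded_linear f'"
    and "\<forall>e>0. \<exists>d>0. \<forall>y. norm (y - x) < d \<longrightarrow> norm (f y - f x - f' (y - x)) \<le> e * norm (y - x)"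
    by (auto simp: has_derivative_at_alt)
  then obtain d where d: "d > 0" "\<And>y. norm (y - x) < d \<Longrightarrow> norm (f y - f x - f' (y - x)) \<le> 1 * norm (y - x)"
    using zero_less_one by blast
  show ?thesis
  proof (rule that)
    show "0 \<le> 1 + onorm f'" using onorm_pos_le[OF lin] by simp
    have "norm (f y - f x) \<le> (1 + onorm f') * norm (y - x)" if "dist y x < d" for y
    proof -
      have "norm (f y - f x) \<le> norm (f y - f x - f' (y - x)) + norm (f' (y - x))"
        using norm_triangle_ineq[of "f y - f x - f' (y - x)" "f' (y - x)"] by simp
      also have "\<dots> \<le> 1 * norm (y - x) + onorm f' * norm (y - x)"
        using d(2)[of y] that onorm[OF lin, of "y - x"] by (intro add_mono) (auto simp: dist_norm)
      finally show ?thesis by (simp add: algebra_simps)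
    qed
    then show "\<forall>\<^sub>F y in nhds x. norm (f y - f x) \<le> (1 + onorm f') * norm (y - x)"
      unfolding eventually_nhds_metric using d(1) by blast
  qed
qed

lemma Ck_on_extension:
  assumes "Ck_on k f A" "x \<in> A"
  obtains U F where "open U" "x \<in> U" "\<forall>j. enat j \<le> k \<longrightarrow> Ck_open j F U" "\<forall>y\<in>U \<inter> A. F y = f y"
proof -
  obtain U F where "open U" "x \<in> U" "\<forall>j. enat j \<le> k \<longrightarrow> Ck_open j F U" "\<forall>y\<in>U \<inter> A. F y = f y"
    using bspec[OF assms(1)[unfolded Ck_on_def] assms(2)] by (elim exE conjE)
  then show ?thesis by (rule that)
qed

lemma Ck_open_differentiable:
  "Ck_open (Suc k) F U \<Longrightarrow> x \<in> U \<Longrightarrow> (F has_derivative frechet_derivative F (at x)) (at x)"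
  unfolding Ck_open.simps(2) frechet_derivative_works by blast

lemma Ck_on_imp_continuous_on:
  assumes "Ck_on k f A"
  shows "continuous_on A f"
proof -
  have "continuous (at x within A) f" if x: "x \<in> A" for x
  proof -
    obtain U F where U: "open U" "x \<in> U" and F: "\<forall>j. enat j \<le> k \<longrightarrow> Ck_open j F U" "\<forall>y\<in>U \<inter> A. F y = f y"
      using Ck_on_extension[OF assms x] .
    have "continuous_on U F" using F(1)[rule_format, of 0] by (simp add: zero_enat_def[symmetric])
    then have "continuous (at x within A) F"
      using U by (simp add: continuous_on_eq_continuous_at continuous_at_imp_continuous_at_within)
    moreover have "\<forall>\<^sub>F y in at x within A. F y = f y"
      using U F(2) by (auto simp: eventually_at_topological)
    ultimately show ?thesis
      using F(2) U x by (auto simp: continuous_within cong: filterlim_cong)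
  qed
  then show ?thesis by (simp add: continuous_on_eq_continuous_within)
qed

text \<open>Differentiability of the partial derivatives at the single point \<open>x\<close> already bounds
  the increment of the derivative linearly, and the mean value inequality on the ball of radius
  \<open>norm (u - x)\<close> then gives the quadratic Taylor remainder.\<close>

lemma C2_derivative_lipschitz_at:
  fixes F :: "'a::euclidean_space \<Rightarrow> 'b::real_normed_vector"
  assumes F: "Ck_open 2 F U" and U: "open U" "x \<in> U"
  obtains C where "C \<ge> 0"
    "\<forall>\<^sub>F u in nhds x. \<forall>v. norm (frechet_derivative F (at u) v - frechet_derivative F (at x) v) \<le> C * norm (u - x) * norm v"
    "\<forall>\<^sub>F u in nhds x. norm (F u - F x - frechet_derivative F (at x) (u - x)) \<le> C * (norm (u - x))\<^sup>2"
proof -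
  let ?F' = "\<lambda>u. frechet_derivative F (at u)"
  have der: "(F has_derivative ?F' u) (at u)" if "u \<in> U" for u
    using F that unfolding numeral_2_eq_2 by (rule Ck_open_differentiable)
  have F2: "Ck_open (Suc 0) (\<lambda>u. ?F' u v) U" for v
    using F unfolding numeral_2_eq_2 Ck_open.simps(2)[of "Suc 0"] by blast
  have lin: "linear (?F' u)" if "u \<in> U" for u
    using der[OF that] by (rule has_derivative_linear)
  have "\<exists>C\<ge>0. \<forall>\<^sub>F u in nhds x. norm (?F' u b - ?F' x b) \<le> C * norm (u - x)" for b
  proof -
    have "(\<lambda>u. ?F' u b) differentiable (at x)"
      using F2 U(2) unfolding Ck_open.simps(2)[of 0] by blast
    then show ?thesis by (rule differentiable_imp_locally_lipschitz_at) blast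
  qed
  then have "\<forall>b. \<exists>C. C \<ge> 0 \<and> (\<forall>\<^sub>F u in nhds x. norm (?F' u b - ?F' x b) \<le> C * norm (u - x))"
    by simp
  from choice[OF this] obtain c where c: "\<And>b. c b \<ge> 0"
    "\<And>b. \<forall>\<^sub>F u in nhds x. norm (?F' u b - ?F' x b) \<le> c b * norm (u - x)"
    by blast
  define C where "C = (\<Sum>b\<in>Basis. c b)"
  have C: "C \<ge> 0" using c(1) by (simp add: C_def sum_nonneg)
  have "\<forall>\<^sub>F u in nhds x. \<forall>b\<in>Basis. norm (?F' u b - ?F' x b) \<le> c b * norm (u - x)"
    using c(2) by (intro eventually_ball_finite) auto
  moreover have "\<forall>\<^sub>F u in nhds x. u \<in> U" using U by (rule eventually_nhds_in_open)
  ultimately have "\<forall>\<^sub>F u in nhds x. u \<in> U \<and> (\<forall>v. norm (?F' u v - ?F' x v) \<le> C * norm (u - x) * norm v)"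
  proof eventually_elim
    case (elim u)
    have "norm (?F' u v - ?F' x v) \<le> C * norm (u - x) * norm v" for v
    proof -
      have "?F' w v = (\<Sum>b\<in>Basis. (v \<bullet> b) *\<^sub>R ?F' w b)" if "w \<in> U" for w
        using lin[OF that] by (subst euclidean_representation[symmetric, of v]) (simp add: linear_sum linear_scale)
      then have "?F' u v - ?F' x v = (\<Sum>b\<in>Basis. (v \<bullet> b) *\<^sub>R (?F' u b - ?F' x b))"
        using elim U(2) by (simp add: sum_subtractf scaleR_diff_right)
      also have "norm \<dots> \<le> (\<Sum>b\<in>Basis. norm v * (c b * norm (u - x)))"
        using elim by (intro sum_norm_le) (auto intro!: mult_mono Basis_le_norm)
      also have "\<dots> = C * norm (u - x) * norm v"
        by (simp add: C_def sum_distrib_left sum_distrib_right mult_ac)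
      finally show ?thesis .
    qed
    then show ?case using elim by blast
  qed
  then obtain d where d: "d > 0"
    "\<And>u. dist u x < d \<Longrightarrow> u \<in> U \<and> (\<forall>v. norm (?F' u v - ?F' x v) \<le> C * norm (u - x) * norm v)"
    unfolding eventually_nhds_metric by blast
  show ?thesis
  proof (rule that[OF C])
    show "\<forall>\<^sub>F u in nhds x. \<forall>v. norm (?F' u v - ?F' x v) \<le> C * norm (u - x) * norm v"
      unfolding eventually_nhds_metric using d by blast
    have "norm (F u - F x - ?F' x (u - x)) \<le> C * (norm (u - x))\<^sup>2" if u: "dist u x < d" for u
    proof -
      have sub: "y \<in> U" "norm (y - x) \<le> norm (u - x)" "dist y x < d" if "y \<in> cball x (norm (u - x))" for y
        using that u d(2)[of y] by (auto simp: dist_norm norm_minus_commute)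
      have "norm (F u - F x - ?F' x (u - x)) \<le> norm (u - x) * (C * norm (u - x))"
      proof (rule differentiable_bound_linearization[where S = "cball x (norm (u - x))"])
        show "x + t *\<^sub>R (u - x) \<in> cball x (norm (u - x))" if "t \<in> {0..1}" for t
          using that by (auto simp: dist_norm mult_left_le_one_le)
        show "(F has_derivative ?F' y) (at y within cball x (norm (u - x)))" if "y \<in> cball x (norm (u - x))" for y
          using der[OF sub(1)[OF that]] by (rule has_derivative_at_withinI)
        show "onorm (?F' y - ?F' x) \<le> C * norm (u - x)" if "y \<in> cball x (norm (u - x))" for y
        proof (rule onorm_le)
          fix v
          have "norm (?F' y v - ?F' x v) \<le> C * norm (y - x) * norm v"
            using d(2)[of y] sub[OF that] by blast
          also have "\<dots> \<le> C * norm (u - x) * norm v"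
            using sub(2)[OF that] C by (intro mult_right_mono mult_left_mono) auto
          finally show "norm ((?F' y - ?F' x) v) \<le> C * norm (u - x) * norm v" by simp
        qed
      qed simp
      then show ?thesis by (simp add: power2_eq_square mult_ac)
    qed
    then show "\<forall>\<^sub>F u in nhds x. norm (F u - F x - ?F' x (u - x)) \<le> C * (norm (u - x))\<^sup>2"
      unfolding eventually_nhds_metric using d(1) by blast
  qed
qed

lemma openin_half_space_ball:
  assumes "openin (top_of_set (half_space k)) W" "u \<in> W"
  obtains r where "r > 0" "half_space k \<inter> ball u r \<subseteq> W"
  using assms by (metis Int_commute openin_contains_ball)

text \<open>At a point of the bounding hyperplane every coordinate direction can still be approached from
  one side within the half space.\<close>

lemma has_derivative_unique_half_space:
  fixes f :: "real^'m::finite \<Rightarrow> 'b::real_normed_vector"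
  assumes W: "openin (top_of_set (half_space k)) W" "u \<in> W"
    and D: "(f has_derivative D) (at u within W)" "(f has_derivative D') (at u within W)"
  shows "D = D'"
proof (rule frechet_derivative_unique_within[OF D])
  fix i :: "real^'m" and e :: real
  assume i: "i \<in> Basis" and e: "e > 0"
  obtain r where r: "r > 0" "half_space k \<inter> ball u r \<subseteq> W"
    using openin_half_space_ball[OF W] .
  define d where "d = min e r / 2"
  have d: "0 < d" "d < e" "d < r" using e r(1) by (auto simp: d_def)
  have "i $ k \<ge> 0" using i by (auto simp: Basis_vec_def axis_def)
  moreover have "u \<in> half_space k"
    using W openin_imp_subset by blast
  ultimately have "u + d *\<^sub>R i \<in> half_space k"
    using d(1) by (simp add: half_space_def)
  moreover have "u + d *\<^sub>R i \<in> ball u r"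
    using i d by (simp add: dist_norm)
  ultimately show "\<exists>d. 0 < \<bar>d\<bar> \<and> \<bar>d\<bar> < e \<and> u + d *\<^sub>R i \<in> W"
    using d r(2) by (intro exI[of _ d]) auto
qed

lemma local_param_continuous:
  "local_param M k W \<phi> \<Longrightarrow> continuous_on W \<phi>"
  by (auto simp: local_param_def diffeo_on_def intro: Ck_on_imp_continuous_on)

lemma Ck_on_subset_cong:
  assumes "Ck_on k f A" "B \<subseteq> A" "\<And>x. x \<in> B \<Longrightarrow> f x = g x"
  shows "Ck_on k g B"
  unfolding Ck_on_def
proof
  fix x assume "x \<in> B"
  then have "x \<in> A" using assms(2) by blast
  obtain U F where U: "open U" "x \<in> U" and F: "\<forall>j. enat j \<le> k \<longrightarrow> Ck_open j F U" "\<forall>y\<in>U \<inter> A. F y = f y"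
    using Ck_on_extension[OF assms(1) \<open>x \<in> A\<close>] .
  have "\<forall>y\<in>U \<inter> B. F y = g y" using F(2) assms(2,3) by auto
  then show "\<exists>U F. open U \<and> x \<in> U \<and> (\<forall>j. enat j \<le> k \<longrightarrow> Ck_open j F U) \<and> (\<forall>y\<in>U \<inter> B. F y = g y)"
    using U F(1) by blast
qed

text \<open>Smaller pieces of a chart are again charts, so the domain can be cut down to a half ball on
  which all estimates hold.\<close>

lemma local_param_subset:
  fixes M :: "'a::euclidean_space set"
  assumes lp: "local_param M k W \<phi>" and V: "openin (top_of_set (half_space k)) V" "V \<subseteq> W"
  shows "local_param M k V \<phi>"
proof -
  have W: "openin (top_of_set (half_space k)) W" "openin (top_of_set M) (\<phi> ` W)"
    and inj: "inj_on \<phi> W" and smooth: "Ck_on \<infinity> \<phi> W" "Ck_on \<infinity> (inv_into W \<phi>) (\<phi> ` W)"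
    using lp by (auto simp: local_param_def diffeo_on_def)
  have injV: "inj_on \<phi> V" using inj V(2) by (rule inj_on_subset)
  have "openin (top_of_set W) V"
    using V W(1) openin_imp_subset openin_subset_trans by metis
  moreover have "\<phi> ` V = \<phi> ` W \<inter> inv_into W \<phi> -` V"
    using V(2) inj by (auto simp: inv_into_f_f)
  moreover have "inv_into W \<phi> \<in> \<phi> ` W \<rightarrow> W" by (auto intro: inv_into_into)
  ultimately have "openin (top_of_set (\<phi> ` W)) (\<phi> ` V)"
    using continuous_openin_preimage[OF Ck_on_imp_continuous_on[OF smooth(2)], of W V] by simp
  then have "openin (top_of_set M) (\<phi> ` V)"
    using W(2) openin_trans by blast
  moreover have "Ck_on \<infinity> (inv_into V \<phi>) (\<phi> ` V)"
  proof (rule Ck_on_subset_cong[OF smooth(2)])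
    show "\<phi> ` V \<subseteq> \<phi> ` W" using V(2) by (rule image_mono)
    show "inv_into W \<phi> y = inv_into V \<phi> y" if "y \<in> \<phi> ` V" for y
      using that V(2) by (auto simp: inv_into_f_f[OF inj] inv_into_f_f[OF injV])
  qed
  ultimately show ?thesis
    using V injV Ck_on_subset_cong[OF smooth(1) V(2)] by (simp add: local_param_def diffeo_on_def)
qed

lemma local_param_image_subset: "local_param M k W \<phi> \<Longrightarrow> \<phi> ` W \<subseteq> M"
  unfolding local_param_def by (elim conjE openin_imp_subset)

lemma local_param_preimage:
  assumes lp: "local_param M k W \<phi>" "u \<in> W" and V: "open V" "\<phi> u \<in> V"
  shows "openin (top_of_set (half_space k)) (W \<inter> \<phi> -` V)" "u \<in> W \<inter> \<phi> -` V"
proof -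
  have "openin (top_of_set W) (W \<inter> \<phi> -` V)"
    using local_param_continuous[OF lp(1)] V(1) by (rule continuous_openin_preimage_gen)
  then show "openin (top_of_set (half_space k)) (W \<inter> \<phi> -` V)"
    using lp(1) openin_trans by (auto simp: local_param_def)
qed (use lp V in auto)

text \<open>The inverse of a chart extends smoothly to the surrounding space. This is what makes the
  derivative injective and allows a comparison of charts.\<close>

lemma local_param_left_inverse:
  fixes M :: "'a::euclidean_space set" and \<phi> :: "real^'m::finite \<Rightarrow> 'a"
  assumes lp: "local_param M k W \<phi>" and u: "u \<in> W"
  obtains V and H :: "'a \<Rightarrow> real^'m" and H' where "open V" "\<phi> u \<in> V" "(H has_derivative H') (at (\<phi> u))"
    "\<forall>w\<in>W. \<phi> w \<in> V \<longrightarrow> H (\<phi> w) = w"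
proof -
  have inj: "inj_on \<phi> W" and smooth: "Ck_on \<infinity> (inv_into W \<phi>) (\<phi> ` W)"
    using lp by (auto simp: local_param_def diffeo_on_def)
  obtain V H where V: "open V" "\<phi> u \<in> V" and H: "\<forall>j. enat j \<le> \<infinity> \<longrightarrow> Ck_open j H V"
    "\<forall>y\<in>V \<inter> \<phi> ` W. H y = inv_into W \<phi> y"
    using Ck_on_extension[OF smooth imageI[OF u]] .
  show ?thesis
  proof (rule that[OF V])
    show "(H has_derivative frechet_derivative H (at (\<phi> u))) (at (\<phi> u))"
      using H(1) V(2) by (intro Ck_open_differentiable[of 0]) auto
    show "\<forall>w\<in>W. \<phi> w \<in> V \<longrightarrow> H (\<phi> w) = w"
      using H(2) inj by (simp add: inv_into_f_f)
  qed
qed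

text \<open>Near the common point the first chart factors through the second one as \<open>\<phi>1 = \<phi>2
  o H o \<phi>1\<close>, where \<open>H\<close> is a smooth left inverse of
  \<open>\<phi>2\<close>.\<close>

lemma local_param_tangent_subset:
  fixes M :: "'a::euclidean_space set" and \<phi>1 \<phi>2 :: "real^'m::finite \<Rightarrow> 'a"
  assumes lp1: "local_param M k1 W1 \<phi>1" "u1 \<in> W1" "(\<phi>1 has_derivative D1) (at u1 within W1)"
    and lp2: "local_param M k2 W2 \<phi>2" "u2 \<in> W2" "(\<phi>2 has_derivative D2) (at u2 within W2)"
    and eq: "\<phi>1 u1 = \<phi>2 u2"
  shows "\<exists>H'. \<forall>v. D1 v = D2 (H' (D1 v))"
proof -
  obtain V H H' where V: "open V" "\<phi>2 u2 \<in> V" and H: "(H has_derivative H') (at (\<phi>2 u2))"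
    and inv: "\<forall>w\<in>W2. \<phi>2 w \<in> V \<longrightarrow> H (\<phi>2 w) = w"
    using local_param_left_inverse[OF lp2(1,2)] .
  obtain O2 where O2: "open O2" "\<phi>2 ` W2 = M \<inter> O2"
    using lp2(1) by (auto simp: local_param_def openin_open)
  have sub1: "\<phi>1 ` W1 \<subseteq> M"
    using lp1(1) by (rule local_param_image_subset)
  let ?W = "W1 \<inter> \<phi>1 -` (V \<inter> O2)"
  have "\<phi>2 u2 \<in> O2" using O2(2) lp2(2) by blast
  then have "open (V \<inter> O2)" "\<phi>1 u1 \<in> V \<inter> O2" using V O2(1) eq by auto
  note W = local_param_preimage(1)[OF lp1(1,2) this] and u1 = local_param_preimage(2)[OF lp1(1,2) this]
  have D1: "(\<phi>1 has_derivative D1) (at u1 within ?W)"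
    using lp1(3) by (rule has_derivative_subset) auto
  have lift: "H (\<phi>1 w) \<in> W2 \<and> \<phi>2 (H (\<phi>1 w)) = \<phi>1 w" if "w \<in> ?W" for w
  proof -
    have "\<phi>1 w \<in> \<phi>2 ` W2" using that sub1 O2(2) by auto
    then obtain w2 where "w2 \<in> W2" "\<phi>1 w = \<phi>2 w2" by auto
    then show ?thesis using inv that by auto
  qed
  have HW: "((\<lambda>w. H (\<phi>1 w)) has_derivative (\<lambda>v. H' (D1 v))) (at u1 within ?W)"
    by (rule has_derivative_compose[OF D1 H[folded eq]])
  have "H (\<phi>1 u1) = u2" using inv lp2(2) V(2) eq by simp
  moreover have "(\<lambda>w. H (\<phi>1 w)) ` ?W \<subseteq> W2" using lift by blast
  ultimately have "(\<phi>2 has_derivative D2) (at (H (\<phi>1 u1)) within (\<lambda>w. H (\<phi>1 w)) ` ?W)"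
    using lp2(3) has_derivative_subset by metis
  then have "((\<lambda>w. \<phi>2 (H (\<phi>1 w))) has_derivative (\<lambda>v. D2 (H' (D1 v)))) (at u1 within ?W)"
    by (rule has_derivative_in_compose[OF HW])
  then have "(\<phi>1 has_derivative (\<lambda>v. D2 (H' (D1 v)))) (at u1 within ?W)"
    by (rule has_derivative_transform[OF u1, rotated]) (use lift in auto)
  from has_derivative_unique_half_space[OF W u1 D1 this]
  have "D1 v = D2 (H' (D1 v))" for v by (rule fun_cong)
  then show ?thesis by blast
qed

text \<open>All charts give the same tangent space, so a single convenient chart suffices.\<close>

lemma tangent_space_eq_range:
  fixes M :: "'a::euclidean_space set" and \<phi> :: "real^'m::finite \<Rightarrow> 'a"
  assumes lp: "local_param M k W \<phi>" "u \<in> W" "(\<phi> has_derivative D) (at u within W)"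
  shows "tangent_space TYPE('m) M (\<phi> u) = range D"
proof
  show "range D \<subseteq> tangent_space TYPE('m) M (\<phi> u)"
    unfolding tangent_space_def using lp by blast
  show "tangent_space TYPE('m) M (\<phi> u) \<subseteq> range D"
  proof
    fix w assume "w \<in> tangent_space TYPE('m) M (\<phi> u)"
    then obtain k1 :: 'm and W1 \<phi>1 u1 D1 where 1: "local_param M k1 W1 \<phi>1" "u1 \<in> W1" "\<phi>1 u1 = \<phi> u"
      "(\<phi>1 has_derivative D1) (at u1 within W1)" "w \<in> range D1"
      unfolding tangent_space_def by blast
    from local_param_tangent_subset[OF 1(1,2,4) lp 1(3)] 1(5) show "w \<in> range D" by blast
  qed
qed

text \<open>The derivative of a smooth left inverse is a left inverse of the derivative.\<close>

lemma local_param_derivative_bounded_below: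
  fixes M :: "'a::euclidean_space set" and \<phi> :: "real^'m::finite \<Rightarrow> 'a"
  assumes lp: "local_param M k W \<phi>" "u \<in> W" "(\<phi> has_derivative D) (at u within W)"
  obtains c where "c > 0" "\<And>v. c * norm v \<le> norm (D v)"
proof -
  obtain V H H' where V: "open V" "\<phi> u \<in> V" and H: "(H has_derivative H') (at (\<phi> u))"
    and inv: "\<forall>w\<in>W. \<phi> w \<in> V \<longrightarrow> H (\<phi> w) = w"
    using local_param_left_inverse[OF lp(1,2)] .
  let ?W = "W \<inter> \<phi> -` V"
  note W' = local_param_preimage(1)[OF lp(1,2) V] and u = local_param_preimage(2)[OF lp(1,2) V]
  have "(\<phi> has_derivative D) (at u within ?W)"
    using lp(3) by (rule has_derivative_subset) auto
  then have "((\<lambda>w. H (\<phi> w)) has_derivative (\<lambda>v. H' (D v))) (at u within ?W)"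
    using H by (rule has_derivative_compose)
  then have "((\<lambda>w. w) has_derivative (\<lambda>v. H' (D v))) (at u within ?W)"
    by (rule has_derivative_transform[OF u, rotated]) (use inv in auto)
  from has_derivative_unique_half_space[OF W' u has_derivative_ident this]
  have id: "v = H' (D v)" for v by (rule fun_cong)
  have bl: "bounded_linear H'" using H by (rule has_derivative_bounded_linear)
  obtain B where B: "B > 0" "\<And>y. norm (H' y) \<le> norm y * B"
    using bounded_linear.pos_bounded[OF bl] by blast
  show ?thesis
  proof (rule that[of "1 / B"])
    show "1 / B * norm v \<le> norm (D v)" for v
      using B(2)[of "D v"] id[of v] B(1) by (simp add: field_simps)
  qed (use B in simp)
qed


section \<open>Gradient and volume in a chart\<close>

text \<open>The gradient is defined by a definite description, so existence and uniqueness are needed. The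
  tangential part of the gradient of a smooth extension is a candidate: on the manifold the
  identity has derivative \<open>D o H\<close>, which takes values in the tangent space, so the
  normal part does not contribute. Uniqueness holds because derivatives along the chart
  determine the inner products with all tangent vectors.\<close>

lemma manifold_gradient_inner:
  fixes M :: "'a::euclidean_space set" and \<phi> :: "real^'m::finite \<Rightarrow> 'a"
  assumes lp: "local_param M k W \<phi>" "u \<in> W" "(\<phi> has_derivative D) (at u within W)"
    and V: "open V" "\<phi> u \<in> V" and g: "(g has_derivative g') (at (\<phi> u))" and eq: "\<forall>y\<in>V \<inter> M. g y = f y"
  shows "manifold_gradient TYPE('m) M f (\<phi> u) \<bullet> D w = g' (D w)"
proof -
  let ?x = "\<phi> u" and ?T = "tangent_space TYPE('m) M (\<phi> u)"
  let ?P = "\<lambda>a. a \<in> ?T \<and> (f has_derivative (\<lambda>v. a \<bullet> v)) (at ?x within M)"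
  have T: "?T = range D" by (rule tangent_space_eq_range[OF lp])
  have linD: "linear D" using lp(3) by (rule has_derivative_linear)
  have subT: "subspace (range D)" using linD by (simp add: linear_subspace_image)
  obtain O1 where O1: "open O1" "\<phi> ` W = M \<inter> O1"
    using lp(1) by (auto simp: local_param_def openin_open)
  then have WM: "\<phi> ` W \<subseteq> M" by simp
  have xM: "?x \<in> M" "?x \<in> O1" using O1(2) lp(2) by auto
  let ?W = "W \<inter> \<phi> -` V"
  note W = local_param_preimage(1)[OF lp(1,2) V] and uW = local_param_preimage(2)[OF lp(1,2) V]
  have DW: "(\<phi> has_derivative D) (at u within ?W)"
    using lp(3) by (rule has_derivative_subset) auto
  have along: "b \<bullet> D v = g' (D v)" if b: "?P b" for b v
  proof -
    have "(f has_derivative (\<lambda>v. b \<bullet> v)) (at ?x within \<phi> ` ?W)"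
      by (rule has_derivative_subset[OF conjunct2[OF b]]) (use WM in auto)
    then have 1: "((\<lambda>w. f (\<phi> w)) has_derivative (\<lambda>v. b \<bullet> D v)) (at u within ?W)"
      by (rule has_derivative_in_compose[OF DW])
    have "((\<lambda>w. g (\<phi> w)) has_derivative (\<lambda>v. g' (D v))) (at u within ?W)"
      by (rule has_derivative_compose[OF DW g])
    then have "((\<lambda>w. f (\<phi> w)) has_derivative (\<lambda>v. g' (D v))) (at u within ?W)"
      by (rule has_derivative_transform[OF uW, rotated]) (use eq WM in auto)
    with 1 have "(\<lambda>v. b \<bullet> D v) = (\<lambda>v. g' (D v))"
      by (rule has_derivative_unique_half_space[OF W uW])
    then show ?thesis by (rule fun_cong)
  qed
  have ex: "\<exists>a. ?P a"
  proof -
    obtain V2 H H' where V2: "open V2" "?x \<in> V2" and H: "(H has_derivative H') (at ?x)"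
      and inv: "\<forall>w\<in>W. \<phi> w \<in> V2 \<longrightarrow> H (\<phi> w) = w"
      using local_param_left_inverse[OF lp(1,2)] .
    have g'lin: "linear g'" using g by (rule has_derivative_linear)
    define a0 where "a0 = adjoint g' 1"
    have a0: "g' v = a0 \<bullet> v" for v
      using adjoint_works[OF g'lin, of v 1] by (simp add: a0_def inner_commute)
    obtain a z where a: "a \<in> span (range D)" and z: "\<And>w. w \<in> span (range D) \<Longrightarrow> orthogonal z w" and az: "a0 = a + z"
      using orthogonal_subspace_decomp_exists[of "range D" a0] by blast
    have aT: "a \<in> range D" and zD: "z \<bullet> D v = 0" for v
      using a z[of "D v"] subT by (auto simp: span_eq_iff[THEN iffD2] orthogonal_def)
    let ?N = "M \<inter> (V \<inter> V2 \<inter> O1)"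
    have xN: "?x \<in> ?N" using xM V V2 by auto
    have HN: "H y \<in> W \<and> \<phi> (H y) = y" if "y \<in> ?N" for y
    proof -
      have "y \<in> \<phi> ` W" using that O1(2) by auto
      then show ?thesis using inv that by auto
    qed
    have "H ?x = u" using inv lp(2) V2 by auto
    have HW: "H ` ?N \<subseteq> W" using HN by blast
    have "(\<phi> has_derivative D) (at (H ?x) within H ` ?N)"
      unfolding \<open>H ?x = u\<close> by (rule has_derivative_subset[OF lp(3) HW])
    then have "((\<lambda>y. \<phi> (H y)) has_derivative (\<lambda>v. D (H' v))) (at ?x within ?N)"
      by (rule has_derivative_in_compose[OF has_derivative_at_withinI[OF H]])
    then have id: "((\<lambda>y. y) has_derivative (\<lambda>v. D (H' v))) (at ?x within ?N)"
      by (rule has_derivative_transform[OF xN, rotated]) (use HN in auto)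
    have "((\<lambda>y. g y - a \<bullet> y) has_derivative (\<lambda>v. g' v - a \<bullet> v)) (at ?x)"
      using g by (auto intro!: derivative_eq_intros)
    from has_derivative_compose[OF id this]
    have "((\<lambda>y. g y - a \<bullet> y) has_derivative (\<lambda>v. 0)) (at ?x within ?N)"
      by (simp add: a0 az inner_add_left zD)
    then have "((\<lambda>y. (g y - a \<bullet> y) + a \<bullet> y) has_derivative (\<lambda>v. 0 + a \<bullet> v)) (at ?x within ?N)"
      by (intro has_derivative_add) (auto intro!: derivative_eq_intros)
    then have "(g has_derivative (\<lambda>v. a \<bullet> v)) (at ?x within ?N)" by simp
    then have "(f has_derivative (\<lambda>v. a \<bullet> v)) (at ?x within ?N)"
      by (rule has_derivative_transform[OF xN, rotated]) (use eq in auto)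
    moreover have "at ?x within ?N = at ?x within M"
      by (rule at_within_nhd[of _ "V \<inter> V2 \<inter> O1"]) (use xN V(1) V2(1) O1(1) in auto)
    ultimately show ?thesis using aT T by auto
  qed
  have uniq: "a = b" if "?P a" "?P b" for a b
  proof -
    have "a - b \<in> range D" using that subT T by (auto intro: subspace_diff)
    then obtain v where "a - b = D v" by auto
    then have "(a - b) \<bullet> (a - b) = a \<bullet> D v - b \<bullet> D v" by (metis inner_diff_left)
    then have "(a - b) \<bullet> (a - b) = 0"
      using along[OF that(1), of v] along[OF that(2), of v] by simp
    then show ?thesis by simp
  qed
  have "?P (manifold_gradient TYPE('m) M f ?x)"
    unfolding manifold_gradient_def by (rule theI', rule ex_ex1I[OF ex uniq])
  then show ?thesis by (rule along)
qed

text \<open>First-order Taylor expansion of a function on the manifold. The linear term is bounded by the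
  norm of the gradient with a factor that depends only on the chart; the constant of the
  quadratic term may depend on \<open>f\<close>.\<close>

lemma density_expansion_along_chart:
  fixes M :: "'a::euclidean_space set" and \<phi> :: "real^'m::finite \<Rightarrow> 'a"
  assumes lp: "local_param M k W \<phi>" "u0 \<in> W" "(\<phi> has_derivative D) (at u0 within W)"
    and f: "Ck_on 4 f M"
    and taylor: "\<forall>\<^sub>F u in nhds u0. u \<in> W \<longrightarrow> norm (\<phi> u - \<phi> u0 - D (u - u0)) \<le> C * (norm (u - u0))\<^sup>2"
  obtains A where "A \<ge> 0"
    "\<forall>\<^sub>F u in nhds u0. u \<in> W \<longrightarrow> \<bar>f (\<phi> u) - f (\<phi> u0)\<bar>
       \<le> onorm D * norm (manifold_gradient TYPE('m) M f (\<phi> u0)) * norm (u - u0) + A * (norm (u - u0))\<^sup>2"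
proof -
  let ?x = "\<phi> u0" and ?grad = "manifold_gradient TYPE('m) M f (\<phi> u0)"
  have WM: "\<phi> ` W \<subseteq> M"
    using lp(1) by (rule local_param_image_subset)
  then have xM: "?x \<in> M" using lp(2) by auto
  obtain V g where V: "open V" "?x \<in> V" and gC: "\<forall>j. enat j \<le> 4 \<longrightarrow> Ck_open j g V"
    and eq: "\<forall>y\<in>V \<inter> M. g y = f y"
    using Ck_on_extension[OF f xM] .
  have g2: "Ck_open 2 g V" using gC by (simp add: numeral_eq_enat)
  let ?g' = "frechet_derivative g (at ?x)"
  have der: "(g has_derivative ?g') (at ?x)"
    using g2 V(2) unfolding numeral_2_eq_2 by (rule Ck_open_differentiable)
  have grad: "?g' (D w) = ?grad \<bullet> D w" for w
    using manifold_gradient_inner[OF lp V der eq, of w] by simp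
  have blg: "bounded_linear ?g'" using der by (rule has_derivative_bounded_linear)
  have blD: "bounded_linear D" using lp(3) by (rule has_derivative_bounded_linear)
  obtain Cg where Cg: "Cg \<ge> 0"
    and gT: "\<forall>\<^sub>F y in nhds ?x. norm (g y - g ?x - ?g' (y - ?x)) \<le> Cg * (norm (y - ?x))\<^sup>2"
    using C2_derivative_lipschitz_at[OF g2 V] by blast
  define B where "B = onorm D + \<bar>C\<bar>"
  have B: "B \<ge> 0" using onorm_pos_le[OF blD] by (simp add: B_def)
  have tend: "(\<phi> \<longlongrightarrow> ?x) (at u0 within W)"
    using local_param_continuous[OF lp(1)] lp(2) by (simp add: continuous_on)
  have "\<forall>\<^sub>F u in at u0 within W. \<phi> u \<in> V \<and> norm (g (\<phi> u) - g ?x - ?g' (\<phi> u - ?x)) \<le> Cg * (norm (\<phi> u - ?x))\<^sup>2"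
    using topological_tendstoD[OF tend V] eventually_compose_filterlim[OF gT tend] by (rule eventually_conj)
  then have "\<forall>\<^sub>F u in nhds u0. u \<in> W \<longrightarrow> \<phi> u \<in> V \<and> norm (g (\<phi> u) - g ?x - ?g' (\<phi> u - ?x)) \<le> Cg * (norm (\<phi> u - ?x))\<^sup>2"
    unfolding eventually_at_filter by (rule eventually_mono) (use V in \<open>auto simp: linear_0[OF bounded_linear.linear[OF blg]]\<close>)
  moreover have "\<forall>\<^sub>F u in nhds u0. norm (u - u0) < 1"
    unfolding eventually_nhds_metric by (auto simp: dist_norm intro!: exI[of _ 1])
  ultimately have ev: "\<forall>\<^sub>F u in nhds u0. u \<in> W \<longrightarrow> \<bar>f (\<phi> u) - f ?x\<bar>
       \<le> onorm D * norm ?grad * norm (u - u0) + (onorm ?g' * \<bar>C\<bar> + Cg * B\<^sup>2) * (norm (u - u0))\<^sup>2"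
    using taylor
  proof eventually_elim
    case (elim u)
    show ?case
    proof
      assume u: "u \<in> W"
      let ?w = "u - u0"
      have t: "norm (\<phi> u - ?x - D ?w) \<le> \<bar>C\<bar> * (norm ?w)\<^sup>2"
        using elim u by (meson abs_ge_self mult_right_mono order_trans zero_le_power2)
      have n1: "(norm ?w)\<^sup>2 \<le> norm ?w"
        using elim mult_left_le_one_le[of "norm ?w" "norm ?w"] by (simp add: power2_eq_square)
      have "norm (\<phi> u - ?x) \<le> norm (D ?w) + norm (\<phi> u - ?x - D ?w)"
        using norm_triangle_ineq[of "D ?w" "\<phi> u - ?x - D ?w"] by simp
      also have "\<dots> \<le> onorm D * norm ?w + \<bar>C\<bar> * norm ?w"
        using onorm[OF blD, of ?w] order_trans[OF t mult_left_mono[OF n1 abs_ge_zero]]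
        by (rule add_mono)
      finally have d: "norm (\<phi> u - ?x) \<le> B * norm ?w" by (simp add: B_def algebra_simps)
      have "f (\<phi> u) - f ?x = (g (\<phi> u) - g ?x - ?g' (\<phi> u - ?x)) + ?g' (\<phi> u - ?x - D ?w) + ?grad \<bullet> D ?w"
        using eq elim u WM V xM linear_diff[OF bounded_linear.linear[OF blg]] grad[of ?w] by auto
      also have "\<bar>\<dots>\<bar> \<le> Cg * (norm (\<phi> u - ?x))\<^sup>2 + onorm ?g' * norm (\<phi> u - ?x - D ?w) + norm ?grad * norm (D ?w)"
        using elim u onorm[OF blg, of "\<phi> u - ?x - D ?w"] Cauchy_Schwarz_ineq2[of ?grad "D ?w"]
        by (auto simp: abs_le_iff)
      also have "\<dots> \<le> Cg * (B * norm ?w)\<^sup>2 + onorm ?g' * (\<bar>C\<bar> * (norm ?w)\<^sup>2) + norm ?grad * (onorm D * norm ?w)"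
        using d t Cg onorm_pos_le[OF blg] onorm[OF blD, of ?w]
        by (intro add_mono mult_left_mono power_mono) auto
      finally show "\<bar>f (\<phi> u) - f ?x\<bar> \<le> onorm D * norm ?grad * norm ?w + (onorm ?g' * \<bar>C\<bar> + Cg * B\<^sup>2) * (norm ?w)\<^sup>2"
        by (simp add: algebra_simps power_mult_distrib)
    qed
  qed
  show ?thesis
    by (rule that[OF _ ev]) (use Cg onorm_pos_le[OF blg] in simp)
qed

text \<open>The formula for the volume of Borel sets identifies the volume restricted to \<open>N\<close>
  with the image under the chart of the measure with density \<open>J\<close>; both claims
  follow from this equality of measures.\<close>

lemma volume_measure_chart_integral:
  fixes M :: "'a::euclidean_space set" and \<phi> :: "real^'m::finite \<Rightarrow> 'a" and G :: "'a \<Rightarrow> 'b::euclidean_space"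
  assumes vol: "volume_measure TYPE('m) M dV" and lp: "local_param M k W \<phi>"
    and N: "N \<in> sets dV" "N \<subseteq> \<phi> ` W" and G [measurable]: "G \<in> borel_measurable dV"
    and J: "continuous_on W J" "\<And>u. u \<in> W \<Longrightarrow> J u = sqrt (det (gram_matrix W \<phi> u))" "\<And>u. u \<in> W \<Longrightarrow> J u \<ge> 0"
  shows "(\<integral>y. indicator N y *\<^sub>R G y \<partial>dV) = (\<integral>u. indicator (W \<inter> \<phi> -` N) u *\<^sub>R (J u *\<^sub>R G (\<phi> u)) \<partial>lborel)"
    and "(\<lambda>u. indicator (W \<inter> \<phi> -` N) u *\<^sub>R (J u *\<^sub>R G (\<phi> u))) \<in> borel_measurable borel"
proof -
  have sdV: "sets dV = sets (restrict_space borel M)"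
    and em: "\<And>B. B \<in> sets dV \<Longrightarrow> B \<subseteq> \<phi> ` W \<Longrightarrow> emeasure dV B =
          (\<integral>\<^sup>+u. ennreal (sqrt (det (gram_matrix W \<phi> u))) * indicator (W \<inter> \<phi> -` B) u \<partial>lborel)"
    using vol lp unfolding volume_measure_def by auto
  have spdV: "space dV = M"
    using sets_eq_imp_space_eq[OF sdV] by (simp add: space_restrict_space)
  have "closed (half_space k)"
    unfolding half_space_def by (intro closed_Collect_le continuous_intros)
  moreover obtain O1 where "open O1" "W = half_space k \<inter> O1"
    using lp by (auto simp: local_param_def openin_open)
  ultimately have Wb: "W \<in> sets borel" by auto
  let ?R = "restrict_space lborel W"
  have sR: "sets ?R = sets (restrict_space borel W)" by (simp add: sets_restrict_space)
  have WM: "\<phi> ` W \<subseteq> M"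
    using lp by (rule local_param_image_subset)
  have "\<phi> \<in> borel_measurable (restrict_space borel W)"
    using local_param_continuous[OF lp] by (rule borel_measurable_continuous_on_restrict)
  then have "\<phi> \<in> restrict_space borel W \<rightarrow>\<^sub>M restrict_space borel M"
    using WM by (intro measurable_restrict_space2) (auto simp: space_restrict_space)
  then have phi [measurable]: "\<phi> \<in> ?R \<rightarrow>\<^sub>M dV"
    using measurable_cong_sets[OF sR sdV] by blast
  have "J \<in> borel_measurable (restrict_space borel W)"
    using J(1) by (rule borel_measurable_continuous_on_restrict)
  then have Jm [measurable]: "J \<in> borel_measurable ?R"
    using measurable_cong_sets[OF sR refl] by blast
  have Nm [measurable]: "N \<in> sets dV" by fact
  let ?d = "density ?R (\<lambda>u. ennreal (J u) * indicator N (\<phi> u))"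
  have eq: "density dV (indicator N) = distr ?d dV \<phi>"
  proof (rule measure_eqI)
    fix A assume "A \<in> sets (density dV (indicator N))"
    then have A [measurable]: "A \<in> sets dV" by simp
    have "emeasure (density dV (indicator N)) A = emeasure dV (N \<inter> A)"
      by (simp add: emeasure_density flip: indicator_inter_arith)
    also have "\<dots> = (\<integral>\<^sup>+u. ennreal (sqrt (det (gram_matrix W \<phi> u))) * indicator (W \<inter> \<phi> -` (N \<inter> A)) u \<partial>lborel)"
      using N by (intro em) auto
    also have "\<dots> = (\<integral>\<^sup>+u. (ennreal (J u) * indicator N (\<phi> u) * indicator (\<phi> -` A \<inter> space ?d) u) * indicator W u \<partial>lborel)"
      using J(2) by (intro nn_integral_cong) (auto simp: indicator_def space_restrict_space)
    also have "\<dots> = (\<integral>\<^sup>+u. (ennreal (J u) * indicator N (\<phi> u) * indicator (\<phi> -` A \<inter> space ?d) u) \<partial>?R)"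
      using Wb by (subst nn_integral_restrict_space) auto
    also have "\<dots> = emeasure (distr ?d dV \<phi>) A"
      using measurable_sets[OF phi A] by (subst emeasure_distr) (auto simp: emeasure_density)
    finally show "emeasure (density dV (indicator N)) A = emeasure (distr ?d dV \<phi>) A" .
  qed simp
  have d: "?d = density ?R (\<lambda>u. ennreal (J u * indicator N (\<phi> u)))"
    by (intro density_cong) (auto simp: indicator_def intro!: AE_I2)
  have "(\<integral>y. indicator N y *\<^sub>R G y \<partial>dV) = (\<integral>y. G y \<partial>density dV (\<lambda>y. ennreal (indicator N y)))"
    by (subst integral_density) auto
  also have "\<dots> = (\<integral>y. G y \<partial>distr ?d dV \<phi>)"
    using eq by (simp add: ennreal_indicator)
  also have "\<dots> = (\<integral>u. G (\<phi> u) \<partial>?d)"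
    by (rule integral_distr) auto
  also have "\<dots> = (\<integral>u. (J u * indicator N (\<phi> u)) *\<^sub>R G (\<phi> u) \<partial>?R)"
    unfolding d using J(3) by (intro integral_density) (auto simp: space_restrict_space intro!: AE_I2)
  also have "\<dots> = (\<integral>u. indicator W u *\<^sub>R ((J u * indicator N (\<phi> u)) *\<^sub>R G (\<phi> u)) \<partial>lborel)"
    using Wb by (subst integral_restrict_space) auto
  also have "\<dots> = (\<integral>u. indicator (W \<inter> \<phi> -` N) u *\<^sub>R (J u *\<^sub>R G (\<phi> u)) \<partial>lborel)"
    by (intro Bochner_Integration.integral_cong) (auto simp: indicator_def)
  finally show "(\<integral>y. indicator N y *\<^sub>R G y \<partial>dV) = (\<integral>u. indicator (W \<inter> \<phi> -` N) u *\<^sub>R (J u *\<^sub>R G (\<phi> u)) \<partial>lborel)" .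
  have "(\<lambda>u. (J u * indicator N (\<phi> u)) *\<^sub>R G (\<phi> u)) \<in> borel_measurable ?R" by measurable
  then have "(\<lambda>u. indicator W u *\<^sub>R ((J u * indicator N (\<phi> u)) *\<^sub>R G (\<phi> u))) \<in> borel_measurable lborel"
    using Wb by (subst (asm) borel_measurable_restrict_space_iff) auto
  also have "(\<lambda>u. indicator W u *\<^sub>R ((J u * indicator N (\<phi> u)) *\<^sub>R G (\<phi> u)))
      = (\<lambda>u. indicator (W \<inter> \<phi> -` N) u *\<^sub>R (J u *\<^sub>R G (\<phi> u)))"
    by (auto simp: indicator_def)
  finally show "(\<lambda>u. indicator (W \<inter> \<phi> -` N) u *\<^sub>R (J u *\<^sub>R G (\<phi> u))) \<in> borel_measurable borel" by simp
qed

section \<open>Straightening a chart\<close>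

text \<open>A pointwise condition between differentiability and continuity at \<open>x\<close>. It is stable
  under composition and is all that is needed to compare a Jacobian near \<open>x\<close> with
  its value at \<open>x\<close>.\<close>

definition lipschitz_at :: "('a::real_normed_vector \<Rightarrow> 'b::real_normed_vector) \<Rightarrow> 'a \<Rightarrow> bool" where
  "lipschitz_at f x \<longleftrightarrow> (\<exists>C\<ge>0. \<forall>\<^sub>F y in nhds x. norm (f y - f x) \<le> C * norm (y - x))"

lemma differentiable_imp_lipschitz_at: "f differentiable (at x) \<Longrightarrow> lipschitz_at f x"
  unfolding lipschitz_at_def by (erule differentiable_imp_locally_lipschitz_at) blast

lemma lipschitz_at_tendsto:
  assumes "lipschitz_at f x"
  shows "(f \<longlongrightarrow> f x) (nhds x)"
proof -
  obtain C where "\<forall>\<^sub>F y in nhds x. norm (f y - f x) \<le> C * norm (y - x)"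
    using assms by (auto simp: lipschitz_at_def)
  moreover have "((\<lambda>y. C * norm (y - x)) \<longlongrightarrow> C * norm (x - x)) (nhds x)"
    by (intro tendsto_intros filterlim_ident)
  then have "((\<lambda>y. C * norm (y - x)) \<longlongrightarrow> 0) (nhds x)" by simp
  ultimately have "((\<lambda>y. f y - f x) \<longlongrightarrow> 0) (nhds x)"
    by (rule Lim_null_comparison)
  then show ?thesis by (simp add: LIM_zero_iff)
qed

lemma lipschitz_at_compose:
  assumes f: "lipschitz_at f x" and g: "lipschitz_at g (f x)"
  shows "lipschitz_at (\<lambda>y. g (f y)) x"
proof -
  obtain C where C: "C \<ge> 0" "\<forall>\<^sub>F y in nhds x. norm (f y - f x) \<le> C * norm (y - x)"
    using f by (auto simp: lipschitz_at_def)
  obtain B where B: "B \<ge> 0" "\<forall>\<^sub>F z in nhds (f x). norm (g z - g (f x)) \<le> B * norm (z - f x)"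
    using g by (auto simp: lipschitz_at_def)
  have "\<forall>\<^sub>F y in nhds x. norm (g (f y) - g (f x)) \<le> B * norm (f y - f x)"
    using eventually_compose_filterlim[OF B(2) lipschitz_at_tendsto[OF f]] .
  with C(2) have "\<forall>\<^sub>F y in nhds x. norm (g (f y) - g (f x)) \<le> B * C * norm (y - x)"
  proof eventually_elim
    case (elim y)
    have "B * norm (f y - f x) \<le> B * (C * norm (y - x))"
      using elim(1) B(1) by (rule mult_left_mono)
    then show ?case using elim(2) by simp
  qed
  then show ?thesis
    unfolding lipschitz_at_def using B(1) C(1) by (intro exI[of _ "B * C"]) simp
qed

lemma lipschitz_at_vec:
  fixes f :: "'a::real_normed_vector \<Rightarrow> 'b::real_normed_vector^'n::finite"
  assumes "\<And>i. lipschitz_at (\<lambda>y. f y $ i) x"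
  shows "lipschitz_at f x"
proof -
  have "\<forall>i. \<exists>C. C \<ge> 0 \<and> (\<forall>\<^sub>F y in nhds x. norm (f y $ i - f x $ i) \<le> C * norm (y - x))"
    using assms by (auto simp: lipschitz_at_def)
  from choice[OF this] obtain C where C: "\<And>i. C i \<ge> 0"
    "\<And>i. \<forall>\<^sub>F y in nhds x. norm (f y $ i - f x $ i) \<le> C i * norm (y - x)"
    by blast
  have "\<forall>\<^sub>F y in nhds x. \<forall>i. norm (f y $ i - f x $ i) \<le> C i * norm (y - x)"
    using C(2) by (rule eventually_all_finite)
  then have "\<forall>\<^sub>F y in nhds x. norm (f y - f x) \<le> (\<Sum>i\<in>UNIV. C i) * norm (y - x)"
  proof eventually_elim
    case (elim y)
    have "norm (f y - f x) \<le> (\<Sum>i\<in>UNIV. norm ((f y - f x) $ i))"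
      unfolding norm_vec_def by (rule L2_set_le_sum) simp
    also have "\<dots> \<le> (\<Sum>i\<in>UNIV. C i * norm (y - x))"
      using elim by (intro sum_mono) simp
    finally show ?case by (simp add: sum_distrib_right)
  qed
  then show ?thesis
    unfolding lipschitz_at_def using C(1) by (intro exI[of _ "\<Sum>i\<in>UNIV. C i"]) (simp add: sum_nonneg)
qed

lemma lipschitz_at_det: "lipschitz_at (det :: real^'n::finite^'n \<Rightarrow> real) A"
proof (rule differentiable_imp_lipschitz_at)
  have nth: "((\<lambda>X::real^'n^'n. X $ i $ j) has_derivative (\<lambda>h. h $ i $ j)) (at A)" for i j
    by (intro bounded_linear_imp_has_derivative bounded_linear_compose[OF bounded_linear_vec_nth bounded_linear_vec_nth])
  have "((\<lambda>X. \<Sum>p | p permutes UNIV. of_int (sign p) * (\<Prod>i\<in>UNIV. X $ i $ p i)) has_derivative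
      (\<lambda>h. \<Sum>p | p permutes UNIV. of_int (sign p) * (\<Sum>i\<in>UNIV. h $ i $ p i * (\<Prod>j\<in>UNIV - {i}. A $ j $ p j)))) (at A)"
    by (intro has_derivative_sum has_derivative_mult_right has_derivative_prod nth)
  then show "det differentiable (at A)"
    unfolding det_def[abs_def] by (rule differentiableI)
qed

lemma continuous_on_det:
  fixes f :: "'a::topological_space \<Rightarrow> real^'n::finite^'n"
  assumes "\<And>i j. continuous_on S (\<lambda>x. f x $ i $ j)"
  shows "continuous_on S (\<lambda>x. det (f x))"
  unfolding det_def by (intro continuous_intros assms)

text \<open>A parametrization together with the quantitative estimates around its centre. The condition
  \<open>C * r \<le> c / 4\<close> makes the quadratic remainder at most a quarter of the linear
  term.\<close>

locale regular_chart =
  fixes F :: "real^'m::finite \<Rightarrow> 'a::euclidean_space" and F' :: "real^'m \<Rightarrow> real^'m \<Rightarrow> 'a"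
    and u0 :: "real^'m" and r C c :: real
  assumes r: "r > 0" and C: "C \<ge> 0" and c: "c > 0" and small: "C * r \<le> c / 4"
    and derivative: "\<And>u. u \<in> ball u0 r \<Longrightarrow> (F has_derivative F' u) (at u)"
    and derivative_continuous: "\<And>v. continuous_on (ball u0 r) (\<lambda>u. F' u v)"
    and derivative_lipschitz: "\<And>u v. u \<in> ball u0 r \<Longrightarrow> norm (F' u v - F' u0 v) \<le> C * norm (u - u0) * norm v"
    and taylor: "\<And>u. u \<in> ball u0 r \<Longrightarrow> norm (F u - F u0 - F' u0 (u - u0)) \<le> C * (norm (u - u0))\<^sup>2"
    and bounded_below: "\<And>v. c * norm v \<le> norm (F' u0 v)"

lemma regular_chart_shrink:
  assumes "regular_chart F F' u0 r C c" "0 < r'" "r' \<le> r"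
  shows "regular_chart F F' u0 r' C c"
proof -
  interpret regular_chart F F' u0 r C c by fact
  have "C * r' \<le> C * r" using assms C by (intro mult_left_mono)
  moreover have "ball u0 r' \<subseteq> ball u0 r" using assms(3) by (rule subset_ball)
  ultimately show ?thesis
    using assms(2) C c derivative derivative_lipschitz taylor bounded_below order_trans[OF _ small]
      continuous_on_subset[OF derivative_continuous]
    unfolding regular_chart_def by blast
qed

lemma local_param_regular_chart:
  fixes M :: "'a::euclidean_space set" and \<phi> :: "real^'m::finite \<Rightarrow> 'a"
  assumes lp: "local_param M k W \<phi>" "u0 \<in> W"
  obtains F r C c where "regular_chart F (\<lambda>u. frechet_derivative F (at u)) u0 r C c"
    "half_space k \<inter> ball u0 r \<subseteq> W" "\<And>u. u \<in> half_space k \<inter> ball u0 r \<Longrightarrow> \<phi> u = F u"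
    "(\<phi> has_derivative frechet_derivative F (at u0)) (at u0 within W)"
    "\<And>v. (\<lambda>u. frechet_derivative F (at u) v) differentiable (at u0)"
proof -
  have W: "openin (top_of_set (half_space k)) W" and smooth: "Ck_on \<infinity> \<phi> W"
    using lp by (auto simp: local_param_def diffeo_on_def)
  obtain U F where U: "open U" "u0 \<in> U" and F: "\<forall>j. enat j \<le> \<infinity> \<longrightarrow> Ck_open j F U"
    and eq: "\<forall>u\<in>U \<inter> W. F u = \<phi> u"
    using Ck_on_extension[OF smooth lp(2)] .
  let ?F' = "\<lambda>u. frechet_derivative F (at u)"
  have F2: "Ck_open 2 F U" using F by simp
  have der: "(F has_derivative ?F' u) (at u)" if "u \<in> U" for u
    using F2 that unfolding numeral_2_eq_2 by (rule Ck_open_differentiable)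
  have F1: "Ck_open (Suc 0) (\<lambda>u. ?F' u v) U" for v
    using F2 unfolding numeral_2_eq_2 Ck_open.simps(2)[of "Suc 0"] by blast
  have cont: "continuous_on U (\<lambda>u. ?F' u v)" for v
  proof -
    have "\<forall>u\<in>U. (\<lambda>u. ?F' u v) differentiable (at u)"
      using F1[of v] unfolding Ck_open.simps(2)[of 0] by blast
    then show ?thesis
      by (intro differentiable_imp_continuous_on differentiable_at_imp_differentiable_on) auto
  qed
  have diff: "(\<lambda>u. ?F' u v) differentiable (at u0)" for v
    using F1[of v] U(2) unfolding Ck_open.simps(2)[of 0] by blast
  obtain r1 where r1: "r1 > 0" "half_space k \<inter> ball u0 r1 \<subseteq> W"
    using openin_half_space_ball[OF W lp(2)] .
  obtain C where C: "C \<ge> 0"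
    and lip: "\<forall>\<^sub>F u in nhds u0. \<forall>v. norm (?F' u v - ?F' u0 v) \<le> C * norm (u - u0) * norm v"
    and tay: "\<forall>\<^sub>F u in nhds u0. norm (F u - F u0 - ?F' u0 (u - u0)) \<le> C * (norm (u - u0))\<^sup>2"
    using C2_derivative_lipschitz_at[OF F2 U] by blast
  have "\<forall>\<^sub>F u in nhds u0. u \<in> U \<and> (\<forall>v. norm (?F' u v - ?F' u0 v) \<le> C * norm (u - u0) * norm v)
      \<and> norm (F u - F u0 - ?F' u0 (u - u0)) \<le> C * (norm (u - u0))\<^sup>2"
    using lip tay U by (intro eventually_conj) (auto intro: eventually_nhds_in_open)
  then obtain r2 where r2: "r2 > 0" "\<And>u. dist u u0 < r2 \<Longrightarrow> u \<in> U \<and> (\<forall>v. norm (?F' u v - ?F' u0 v) \<le> C * norm (u - u0) * norm v)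
      \<and> norm (F u - F u0 - ?F' u0 (u - u0)) \<le> C * (norm (u - u0))\<^sup>2"
    unfolding eventually_nhds_metric by blast
  have u0: "u0 \<in> U \<inter> W" using U lp(2) by simp
  have "(\<phi> has_derivative ?F' u0) (at u0 within U \<inter> W)"
    by (rule has_derivative_transform[OF u0 _ has_derivative_at_withinI[OF der[OF U(2)]]]) (use eq in simp)
  moreover have "at u0 within U \<inter> W = at u0 within W"
    by (rule at_within_nhd[OF U(2,1)]) auto
  ultimately have D: "(\<phi> has_derivative ?F' u0) (at u0 within W)" by simp
  obtain c where c: "c > 0" "\<And>v. c * norm v \<le> norm (?F' u0 v)"
    using local_param_derivative_bounded_below[OF lp D] by blast
  \<comment> \<open>the summand 1 keeps the quotient meaningful for C = 0\<close>
  define r where "r = min (min r1 r2) (c / (4 * (C + 1)))"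
  have r: "0 < r" "r \<le> r1" "r \<le> r2" "r \<le> c / (4 * (C + 1))"
    using r1 r2 c C by (auto simp: r_def)
  have "C * r \<le> C * (c / (4 * (C + 1)))" using r(4) C by (rule mult_left_mono)
  also have "\<dots> \<le> c / 4" using c C by (simp add: field_simps)
  finally have small: "C * r \<le> c / 4" .
  have sub: "u \<in> U \<and> dist u u0 < r2" if "u \<in> ball u0 r" for u
    using that r(3) r2(2)[of u] by (auto simp: dist_commute)
  show ?thesis
  proof (rule that)
    show "regular_chart F ?F' u0 r C c"
    proof
      show "continuous_on (ball u0 r) (\<lambda>u. ?F' u v)" for v
        by (rule continuous_on_subset[OF cont]) (use sub in blast)
    qed (use r(1) C c small der sub r2(2) in auto)
    show sW: "half_space k \<inter> ball u0 r \<subseteq> W"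
      using r1(2) r(2) by auto
    show "\<phi> u = F u" if "u \<in> half_space k \<inter> ball u0 r" for u
    proof -
      have "u \<in> U \<inter> W" using that sW sub[of u] by blast
      then show ?thesis using eq by simp
    qed
    show "(\<phi> has_derivative ?F' u0) (at u0 within W)" by fact
    show "(\<lambda>u. ?F' u v) differentiable (at u0)" for v by fact
  qed
qed

text \<open>The derivative at the centre is split into an isometry \<open>L\<close> onto the tangent space
  and a linear map \<open>B\<close> of coordinate space.\<close>

locale straightened_chart = regular_chart F F' u0 r C c
  for F :: "real^'m::finite \<Rightarrow> 'a::euclidean_space" and F' u0 r C c +
  fixes L :: "real^'m \<Rightarrow> 'a" and B :: "real^'m \<Rightarrow> real^'m"
  assumes linear_L: "linear L" and norm_L: "\<And>z. norm (L z) = norm z"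
    and linear_B: "linear B" and LB: "\<And>v. F' u0 v = L (B v)"
begin

text \<open>The straightening map: direction of the linearized displacement, length of the true
  displacement. At \<open>u0\<close> the value is \<open>0\<close>, since there the quotient is
  multiplied by the zero vector.\<close>

definition G :: "real^'m \<Rightarrow> real^'m" where
  "G u = (norm (F u - F u0) / norm (B (u - u0))) *\<^sub>R B (u - u0)"

lemma norm_B: "norm (B v) = norm (F' u0 v)"
  by (simp add: LB norm_L)

lemma B_below: "c * norm v \<le> norm (B v)"
  using bounded_below norm_B by simp

lemma B_eq_0_iff [simp]: "B v = 0 \<longleftrightarrow> v = 0"
proof
  assume "B v = 0"
  then have "c * norm v \<le> 0" using B_below[of v] by simp
  then show "v = 0" using c by (simp add: mult_le_0_iff)
qed (simp add: linear_0[OF linear_B])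

lemma inner_L: "L a \<bullet> L b = a \<bullet> b"
  by (simp add: dot_norm norm_L flip: linear_add[OF linear_L])

lemma displacement_relative:
  assumes "u \<in> ball u0 r"
  shows "norm (F u - F u0 - L (B (u - u0))) \<le> norm (B (u - u0)) / 4"
proof -
  let ?w = "u - u0"
  have "norm ?w \<le> r" using assms by (simp add: dist_norm norm_minus_commute)
  have "norm (F u - F u0 - L (B ?w)) \<le> C * norm ?w * norm ?w"
    using taylor[OF assms] by (simp add: LB power2_eq_square)
  also have "\<dots> \<le> C * r * norm ?w"
    using \<open>norm ?w \<le> r\<close> C by (intro mult_right_mono mult_left_mono) auto
  also have "\<dots> \<le> c / 4 * norm ?w"
    using small by (rule mult_right_mono) simp
  also have "\<dots> \<le> norm (B ?w) / 4"
    using B_below[of ?w] by simp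
  finally show ?thesis .
qed

lemma displacement_lower:
  assumes "u \<in> ball u0 r"
  shows "3 / 4 * norm (B (u - u0)) \<le> norm (F u - F u0)"
proof -
  have "norm (B (u - u0)) = norm (L (B (u - u0)))" by (simp add: norm_L)
  also have "\<dots> \<le> norm (F u - F u0) + norm (F u - F u0 - L (B (u - u0)))"
    by (metis norm_minus_commute norm_triangle_sub)
  finally show ?thesis using displacement_relative[OF assms] by simp
qed

lemma displacement_lower_norm:
  assumes "u \<in> ball u0 r"
  shows "c / 2 * norm (u - u0) \<le> norm (F u - F u0)"
proof -
  have "c / 2 * norm (u - u0) \<le> norm (B (u - u0)) / 2"
    using B_below[of "u - u0"] by simp
  also have "\<dots> \<le> 3 / 4 * norm (B (u - u0))" by simp
  finally show ?thesis using displacement_lower[OF assms] by simp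
qed

lemma norm_G: "u \<in> ball u0 r \<Longrightarrow> norm (G u) = norm (F u - F u0)"
  by (cases "u = u0") (simp_all add: G_def)

text \<open>The relative error of the linearization also holds for increments between two points of the
  ball; this is what makes distances increase along rays.\<close>

lemma displacement_increment:
  assumes "u1 \<in> ball u0 r" "u2 \<in> ball u0 r"
  shows "norm (F u2 - F u1 - L (B (u2 - u1))) \<le> norm (B (u2 - u1)) / 4"
proof -
  have seg: "u1 + t *\<^sub>R (u2 - u1) \<in> ball u0 r" if "t \<in> {0..1}" for t
    using convexD_alt[OF convex_ball assms, of t] that by (simp add: algebra_simps)
  have "norm (F u2 - F u1 - F' u0 (u2 - u1)) \<le> norm (u2 - u1) * (C * r)"
  proof (rule differentiable_bound_linearization[where S = "ball u0 r"])
    show "(F has_derivative F' u) (at u within ball u0 r)" if "u \<in> ball u0 r" for u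
      using derivative[OF that] by (rule has_derivative_at_withinI)
    show "onorm (F' u - F' u0) \<le> C * r" if "u \<in> ball u0 r" for u
    proof (rule onorm_le)
      fix v
      have "norm (F' u v - F' u0 v) \<le> C * norm (u - u0) * norm v"
        using derivative_lipschitz[OF that] .
      also have "\<dots> \<le> C * r * norm v"
        using that C by (intro mult_right_mono mult_left_mono) (auto simp: dist_norm norm_minus_commute)
      finally show "norm ((F' u - F' u0) v) \<le> C * r * norm v" by simp
    qed
  qed (use seg r in auto)
  also have "\<dots> \<le> norm (u2 - u1) * (c / 4)"
    using small by (intro mult_left_mono) auto
  also have "\<dots> \<le> norm (B (u2 - u1)) / 4"
    using B_below[of "u2 - u1"] by (simp add: mult.commute)
  finally show ?thesis by (simp add: LB)
qed

text \<open>Both the difference and the sum of the two displacements are within a quarter of multiples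
  \<open>(t - 1) l\<close> and \<open>(t + 1) l\<close> of the same vector \<open>l\<close>.
  Their inner product, which is the difference of the squared norms, is therefore positive.\<close>

lemma displacement_radially_increasing:
  assumes u: "u0 + w \<in> ball u0 r" "u0 + t *\<^sub>R w \<in> ball u0 r" and t: "t > 1" and w: "w \<noteq> 0"
  shows "norm (F (u0 + w) - F u0) < norm (F (u0 + t *\<^sub>R w) - F u0)"
proof -
  let ?p = "F (u0 + w) - F u0" and ?q = "F (u0 + t *\<^sub>R w) - F u0" and ?l = "L (B w)"
  have lin: "L (B (s *\<^sub>R w)) = s *\<^sub>R ?l" for s
    by (simp add: linear_scale[OF linear_B] linear_scale[OF linear_L])
  define n where "n = norm (B w)"
  have n: "n > 0" using w by (simp add: n_def)
  define e1 where "e1 = ?q - ?p - (t - 1) *\<^sub>R ?l"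
  define e2 where "e2 = ?q + ?p - (t + 1) *\<^sub>R ?l"
  have "norm e1 \<le> norm (B ((t - 1) *\<^sub>R w)) / 4"
    using displacement_increment[OF u] by (simp add: e1_def lin flip: scaleR_diff_left[of t 1 w, simplified])
  then have e1: "norm e1 \<le> (t - 1) * n / 4"
    using t by (simp add: linear_scale[OF linear_B] n_def)
  have "norm (?p - ?l) \<le> n / 4"
    using displacement_relative[OF u(1)] by (simp add: n_def)
  moreover have "norm (?q - t *\<^sub>R ?l) \<le> t * n / 4"
    using displacement_relative[OF u(2)] t by (simp add: n_def linear_scale[OF linear_B] linear_scale[OF linear_L])
  moreover have "e2 = (?p - ?l) + (?q - t *\<^sub>R ?l)"
    by (simp add: e2_def algebra_simps)
  then have "norm e2 \<le> norm (?p - ?l) + norm (?q - t *\<^sub>R ?l)"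
    by (simp only: norm_triangle_ineq)
  ultimately have e2: "norm e2 \<le> (t + 1) * n / 4"
    by (simp add: distrib_right add_divide_distrib)
  have nl: "norm ?l = n" by (simp add: norm_L n_def)
  have "?q \<bullet> ?q - ?p \<bullet> ?p = (?q - ?p) \<bullet> (?q + ?p)"
    unfolding inner_diff_left[of ?q] inner_add_right by (simp add: inner_commute)
  also have "\<dots> = ((t - 1) *\<^sub>R ?l + e1) \<bullet> ((t + 1) *\<^sub>R ?l + e2)"
    by (simp add: e1_def e2_def)
  also have "\<dots> = (t - 1) * (t + 1) * n\<^sup>2 + (t - 1) * (?l \<bullet> e2) + (t + 1) * (e1 \<bullet> ?l) + e1 \<bullet> e2"
    by (simp add: inner_add_left inner_add_right dot_square_norm nl algebra_simps)
  finally have eq: "?q \<bullet> ?q - ?p \<bullet> ?p = \<dots>" .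
  have "\<bar>?l \<bullet> e2\<bar> \<le> n * ((t + 1) * n / 4)"
    using Cauchy_Schwarz_ineq2[of ?l e2] e2 n nl by (smt (verit) mult_left_mono)
  then have 1: "(t - 1) * (?l \<bullet> e2) \<ge> - ((t - 1) * (n * ((t + 1) * n / 4)))"
    using t by (smt (verit) mult_left_mono mult_minus_right)
  have "\<bar>e1 \<bullet> ?l\<bar> \<le> ((t - 1) * n / 4) * n"
    using Cauchy_Schwarz_ineq2[of e1 ?l] e1 n nl by (smt (verit) mult_right_mono)
  then have 2: "(t + 1) * (e1 \<bullet> ?l) \<ge> - ((t + 1) * (((t - 1) * n / 4) * n))"
    using t by (smt (verit) mult_left_mono mult_minus_right)
  have "\<bar>e1 \<bullet> e2\<bar> \<le> ((t - 1) * n / 4) * ((t + 1) * n / 4)"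
    using Cauchy_Schwarz_ineq2[of e1 e2] mult_mono[OF e1 e2] t n by (smt (verit) mult_nonneg_nonneg norm_ge_zero divide_nonneg_nonneg)
  then have 3: "\<bar>e1 \<bullet> e2\<bar> \<le> (t - 1) * (t + 1) * n\<^sup>2 / 16"
    by (simp add: power2_eq_square mult_ac)
  have "(t - 1) * (n * ((t + 1) * n / 4)) = (t - 1) * (t + 1) * n\<^sup>2 / 4"
    by (simp only: power2_eq_square times_divide_eq_left times_divide_eq_right mult_ac)
  note 1 = 1[unfolded this]
  have "(t + 1) * (((t - 1) * n / 4) * n) = (t - 1) * (t + 1) * n\<^sup>2 / 4"
    by (simp only: power2_eq_square times_divide_eq_left times_divide_eq_right mult_ac)
  note 2 = 2[unfolded this]
  have "P * (7 / 16) \<le> P + a + b + d"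
    if "- (P / 4) \<le> a" "- (P / 4) \<le> b" "\<bar>d\<bar> \<le> P / 16" for P a b d :: real
    using that by linarith
  from this[OF 1 2 3] have "?q \<bullet> ?q - ?p \<bullet> ?p \<ge> (t - 1) * (t + 1) * n\<^sup>2 * (7 / 16)"
    unfolding eq .
  moreover have "(t - 1) * (t + 1) * n\<^sup>2 * (7 / 16) > 0"
    using t n by (intro mult_pos_pos) auto
  ultimately have "(norm ?p)\<^sup>2 < (norm ?q)\<^sup>2" by (simp add: power2_norm_eq_inner)
  then show ?thesis by (rule power2_less_imp_less) simp
qed

text \<open>Points with the same image lie on a common ray from \<open>u0\<close> and have the same distance
  from the centre.\<close>

lemma inj_on_G: "inj_on G (ball u0 r)"
proof (rule inj_onI)
  fix u1 u2 assume u: "u1 \<in> ball u0 r" "u2 \<in> ball u0 r" and eq: "G u1 = G u2"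
  let ?w = "\<lambda>u. u - u0"
  have n: "norm (F u1 - F u0) = norm (F u2 - F u0)"
    using norm_G u eq by metis
  have zero: "u = u0" if "norm (F u - F u0) = 0" "u \<in> ball u0 r" for u
    using displacement_lower_norm[OF that(2)] that(1) c by (simp add: mult_le_0_iff)
  show "u1 = u2"
  proof (cases "norm (F u1 - F u0) = 0")
    case True
    then show ?thesis using zero u n by metis
  next
    case False
    then have ne: "?w u1 \<noteq> 0" "?w u2 \<noteq> 0" using n by auto
    define t where "t = norm (B (?w u2)) / norm (B (?w u1))"
    have t: "t > 0" using ne by (simp add: t_def)
    have "(1 / norm (B (?w u1))) *\<^sub>R B (?w u1) = (1 / norm (B (?w u2))) *\<^sub>R B (?w u2)"
      using arg_cong[OF eq, of "\<lambda>z. (1 / norm (F u1 - F u0)) *\<^sub>R z"] False n by (simp add: G_def)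
    then have "norm (B (?w u2)) *\<^sub>R ((1 / norm (B (?w u1))) *\<^sub>R B (?w u1))
        = norm (B (?w u2)) *\<^sub>R ((1 / norm (B (?w u2))) *\<^sub>R B (?w u2))"
      by (rule arg_cong)
    then have "B (?w u2) = t *\<^sub>R B (?w u1)"
      using ne by (simp add: t_def)
    then have "B (?w u2 - t *\<^sub>R ?w u1) = 0"
      by (simp add: linear_diff[OF linear_B] linear_scale[OF linear_B])
    then have w2: "u2 = u0 + t *\<^sub>R ?w u1" by (simp add: algebra_simps)
    have w1: "u1 = u0 + (1 / t) *\<^sub>R ?w u2" using t by (simp add: w2)
    consider "t = 1" | "t > 1" | "1 / t > 1" using t by fastforce
    then show ?thesis
    proof cases
      case 1 then show ?thesis using w2 by simp
    next
      case 2
      have "norm (F u1 - F u0) < norm (F u2 - F u0)"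
        using displacement_radially_increasing[of "?w u1" t] u w2 2 ne by simp
      then show ?thesis using n by simp
    next
      case 3
      have "norm (F u2 - F u0) < norm (F u1 - F u0)"
        using displacement_radially_increasing[of "?w u2" "1 / t"] u w1 3 ne by simp
      then show ?thesis using n by simp
    qed
  qed
qed

text \<open>Along the ray in direction \<open>q\<close> the length of the displacement runs continuously
  from zero to at least \<open>\<delta>\<close>, so every \<open>z\<close> in the cone with norm
  below \<open>\<delta>\<close> is reached.\<close>

lemma G_image:
  assumes Q: "\<And>v t. v \<in> Q \<Longrightarrow> t \<ge> 0 \<Longrightarrow> t *\<^sub>R v \<in> Q" "0 \<in> Q" and \<delta>: "0 < \<delta>" "\<delta> \<le> c * r / 4"
  shows "G ` {u \<in> ball u0 r. u - u0 \<in> Q \<and> norm (F u - F u0) < \<delta>} = {z \<in> B ` Q. norm z < \<delta>}"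
proof (intro equalityI subsetI)
  fix z assume "z \<in> G ` {u \<in> ball u0 r. u - u0 \<in> Q \<and> norm (F u - F u0) < \<delta>}"
  then obtain u where u: "u \<in> ball u0 r" "u - u0 \<in> Q" "norm (F u - F u0) < \<delta>" "z = G u" by auto
  have "z = B ((norm (F u - F u0) / norm (B (u - u0))) *\<^sub>R (u - u0))"
    by (simp add: u(4) G_def linear_scale[OF linear_B])
  then show "z \<in> {z \<in> B ` Q. norm z < \<delta>}"
    using u norm_G[OF u(1)] Q(1) by auto
next
  fix z assume "z \<in> {z \<in> B ` Q. norm z < \<delta>}"
  then obtain q where q: "q \<in> Q" "z = B q" and z: "norm z < \<delta>" by auto
  show "z \<in> G ` {u \<in> ball u0 r. u - u0 \<in> Q \<and> norm (F u - F u0) < \<delta>}"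
  proof (cases "q = 0")
    case True
    then have "z = G u0" by (simp add: q G_def linear_0[OF linear_B])
    then show ?thesis using r Q(2) \<delta>(1) by (intro image_eqI[of _ _ u0]) auto
  next
    case False
    define t1 where "t1 = r / (2 * norm q)"
    have t1: "t1 > 0" using r False by (simp add: t1_def)
    have inb: "u0 + t *\<^sub>R q \<in> ball u0 r" if "0 \<le> t" "t \<le> t1" for t
    proof -
      have "t * norm q \<le> t1 * norm q" using that by (intro mult_right_mono) auto
      also have "\<dots> < r" using r False by (simp add: t1_def)
      finally show ?thesis using that by (simp add: dist_norm)
    qed
    let ?g = "\<lambda>t. norm (F (u0 + t *\<^sub>R q) - F u0)"
    have contF: "continuous_on (ball u0 r) F"
      using derivative by (meson continuous_at_imp_continuous_on has_derivative_continuous)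
    have cont: "continuous_on {0..t1} ?g"
      by (intro continuous_intros continuous_on_compose2[OF contF]) (use inb in auto)
    have "c * (r / 2) \<le> norm (B (t1 *\<^sub>R q))"
      using B_below[of "t1 *\<^sub>R q"] t1 False r by (simp add: t1_def)
    moreover have "c * r > 0" using c r by simp
    ultimately have "\<delta> \<le> ?g t1"
      using displacement_lower[OF inb[of t1]] t1 \<delta>(2) by simp
    then obtain t where t: "0 \<le> t" "t \<le> t1" "?g t = norm z"
      using IVT'[of ?g 0 "norm z" t1] cont z t1 by auto
    have "z \<noteq> 0" using False q by simp
    then have tpos: "t > 0" using t by (cases "t = 0") auto
    have "G (u0 + t *\<^sub>R q) = z"
      using t(3) tpos \<open>z \<noteq> 0\<close> by (simp add: G_def linear_scale[OF linear_B] q(2))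
    then show ?thesis
      using inb[of t] t z Q(1)[OF q(1) t(1)] by (intro image_eqI[of _ _ "u0 + t *\<^sub>R q"]) auto
  qed
qed

text \<open>The derivative of \<open>G\<close> away from \<open>u0\<close>, as given by the quotient and
  product rules.\<close>

definition G' :: "real^'m \<Rightarrow> real^'m \<Rightarrow> real^'m" where
  "G' u v = (norm (F u - F u0) / norm (B (u - u0))) *\<^sub>R B v +
     (((F' u v \<bullet> sgn (F u - F u0)) * norm (B (u - u0)) - norm (F u - F u0) * (B v \<bullet> sgn (B (u - u0))))
        / (norm (B (u - u0)) * norm (B (u - u0)))) *\<^sub>R B (u - u0)"

lemma displacement_nonzero: "u \<in> ball u0 r \<Longrightarrow> u \<noteq> u0 \<Longrightarrow> F u - F u0 \<noteq> 0"
  using displacement_lower_norm[of u] c by (auto simp: mult_le_0_iff)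

lemma G_has_derivative:
  assumes u: "u \<in> ball u0 r" "u \<noteq> u0"
  shows "(G has_derivative G' u) (at u)"
proof -
  have dF: "((\<lambda>u. F u - F u0) has_derivative F' u) (at u)"
    using has_derivative_diff[OF derivative[OF u(1)] has_derivative_const[of "F u0"]] by simp
  have dB: "((\<lambda>u. B (u - u0)) has_derivative B) (at u)"
    using linear_B by (auto intro!: derivative_eq_intros bounded_linear.has_derivative[of B]
        simp: linear_conv_bounded_linear)
  have 1: "((\<lambda>u. norm (F u - F u0)) has_derivative (\<lambda>v. F' u v \<bullet> sgn (F u - F u0))) (at u)"
    using has_derivative_compose[OF dF has_derivative_norm[OF displacement_nonzero[OF u]]] .
  have B0: "B (u - u0) \<noteq> 0" using u(2) by simp
  have 2: "((\<lambda>u. norm (B (u - u0))) has_derivative (\<lambda>v. B v \<bullet> sgn (B (u - u0)))) (at u)"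
    using has_derivative_compose[OF dB has_derivative_norm[OF B0]] .
  have 3: "norm (B (u - u0)) \<noteq> 0" using B0 by simp
  show ?thesis
    unfolding G_def[abs_def] G'_def[abs_def]
    by (rule has_derivative_scaleR[OF has_derivative_divide'[OF 1 2 3] dB])
qed

lemma norm_sgn_diff_le:
  fixes p q :: 'a
  assumes "q \<noteq> 0" "p \<noteq> 0"
  shows "norm (sgn p - sgn q) \<le> 2 * norm (p - q) / norm q"
proof -
  have "sgn p - sgn q = (1 / norm q) *\<^sub>R (p - q) + (1 / norm p - 1 / norm q) *\<^sub>R p"
    by (simp add: sgn_div_norm algebra_simps divide_inverse)
  also have "norm \<dots> \<le> norm (p - q) / norm q + \<bar>1 / norm p - 1 / norm q\<bar> * norm p"
    by (rule order_trans[OF norm_triangle_ineq]) (simp add: divide_inverse mult.commute)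
  also have "\<bar>1 / norm p - 1 / norm q\<bar> * norm p = \<bar>norm q - norm p\<bar> / norm q"
    using assms by (simp add: field_simps abs_mult abs_divide flip: abs_mult_pos)
  also have "\<dots> \<le> norm (p - q) / norm q"
    using norm_triangle_ineq3[of p q] by (intro divide_right_mono) (simp_all add: abs_minus_commute)
  finally show ?thesis by simp
qed

text \<open>The ratio \<open>|p| / |B w|\<close> and the two unit vectors \<open>p / |p|\<close> and
  \<open>L (B w) / |B w|\<close>, with \<open>p\<close> the displacement and \<open>w = u -
  u0\<close>, differ from \<open>1\<close> and from each other by order \<open>|w|\<close>,
  because the Taylor remainder is quadratic and \<open>B\<close> is bounded below.\<close>

lemma G'_near_B:
  assumes u: "u \<in> ball u0 r" "u \<noteq> u0"
  shows "norm (G' u v - B v) \<le> (C + 4 * C * onorm B / c) * norm (u - u0) * norm v"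
proof -
  define w where "w = u - u0"
  define p where "p = F u - F u0"
  define b where "b = B w"
  define q where "q = L b"
  have w: "w \<noteq> 0" using u by (simp add: w_def)
  then have b: "b \<noteq> 0" by (simp add: b_def)
  then have n: "norm b > 0" by simp
  have nq: "norm q = norm b" by (simp add: q_def norm_L)
  then have q: "q \<noteq> 0" using b by auto
  have p: "p \<noteq> 0" using displacement_nonzero[OF u] by (simp add: p_def)
  have blB: "bounded_linear B" using linear_B by (simp add: linear_conv_bounded_linear)
  let ?\<beta> = "onorm B"
  have Bv: "norm (B v) \<le> ?\<beta> * norm v" using onorm[OF blB] .
  have "norm (p - q) \<le> C * norm w * norm w"
    using taylor[OF u(1)] by (simp add: p_def q_def b_def w_def LB power2_eq_square)
  moreover have "c * norm w \<le> norm b" using B_below by (simp add: b_def)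
  ultimately have pq: "norm (p - q) / norm b \<le> C / c * norm w"
  proof -
    have "norm (p - q) \<le> (C / c * norm w) * (c * norm w)"
      using \<open>norm (p - q) \<le> C * norm w * norm w\<close> c by (simp add: field_simps)
    also have "\<dots> \<le> (C / c * norm w) * norm b"
      using \<open>c * norm w \<le> norm b\<close> C c by (intro mult_left_mono) auto
    finally show ?thesis using n by (simp add: divide_le_eq)
  qed
  let ?s = "norm p / norm b"
  have "?s - 1 = (norm p - norm q) / norm b" using n nq by (simp add: field_simps)
  then have s: "\<bar>?s - 1\<bar> \<le> C / c * norm w"
    using order_trans[OF divide_right_mono[OF norm_triangle_ineq3[of p q], of "norm b"] pq]
    by (simp add: abs_divide)
  define E where "E = F' u v \<bullet> sgn p - ?s * (B v \<bullet> sgn b)"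
  have "sgn q = L (sgn b)"
    by (simp add: q_def sgn_div_norm norm_L linear_scale[OF linear_L])
  then have Bs: "B v \<bullet> sgn b = L (B v) \<bullet> sgn q" by (simp add: inner_L)
  have E: "\<bar>E\<bar> \<le> C * norm w * norm v + 3 * (C / c * norm w) * (?\<beta> * norm v)"
  proof -
    have "E = (F' u v - F' u0 v) \<bullet> sgn p + L (B v) \<bullet> (sgn p - sgn q) + (1 - ?s) * (B v \<bullet> sgn b)"
      by (simp add: E_def Bs LB inner_diff_left inner_diff_right algebra_simps)
    also have "\<bar>\<dots>\<bar> \<le> \<bar>(F' u v - F' u0 v) \<bullet> sgn p\<bar> + \<bar>L (B v) \<bullet> (sgn p - sgn q)\<bar> + \<bar>(1 - ?s) * (B v \<bullet> sgn b)\<bar>"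
      by linarith
    also have "\<dots> \<le> C * norm w * norm v + (?\<beta> * norm v) * (2 * (C / c * norm w)) + (C / c * norm w) * (?\<beta> * norm v)"
    proof (intro add_mono)
      have "\<bar>(F' u v - F' u0 v) \<bullet> sgn p\<bar> \<le> norm (F' u v - F' u0 v) * norm (sgn p)"
        by (rule Cauchy_Schwarz_ineq2)
      also have "\<dots> \<le> C * norm w * norm v"
        using derivative_lipschitz[OF u(1), of v] p by (simp add: norm_sgn w_def)
      finally show "\<bar>(F' u v - F' u0 v) \<bullet> sgn p\<bar> \<le> C * norm w * norm v" .
      have "\<bar>L (B v) \<bullet> (sgn p - sgn q)\<bar> \<le> norm (B v) * norm (sgn p - sgn q)"
        using Cauchy_Schwarz_ineq2[of "L (B v)"] by (simp add: norm_L)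
      also have "\<dots> \<le> (?\<beta> * norm v) * (2 * (C / c * norm w))"
        using norm_sgn_diff_le[OF q p] pq nq Bv onorm_pos_le[OF blB] by (intro mult_mono) auto
      finally show "\<bar>L (B v) \<bullet> (sgn p - sgn q)\<bar> \<le> (?\<beta> * norm v) * (2 * (C / c * norm w))" .
      have "\<bar>B v \<bullet> sgn b\<bar> \<le> ?\<beta> * norm v"
        using Cauchy_Schwarz_ineq2[of "B v" "sgn b"] Bv b by (simp add: norm_sgn)
      then show "\<bar>(1 - ?s) * (B v \<bullet> sgn b)\<bar> \<le> (C / c * norm w) * (?\<beta> * norm v)"
        unfolding abs_mult using s C c by (intro mult_mono) (auto simp: abs_minus_commute)
    qed
    finally show ?thesis by (simp add: algebra_simps)
  qed
  have "((F' u v \<bullet> sgn p) * norm b - norm p * (B v \<bullet> sgn b)) / (norm b * norm b) = E / norm b"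
    using n by (simp add: E_def field_simps)
  then have "G' u v - B v = (?s - 1) *\<^sub>R B v + (E / norm b) *\<^sub>R b"
    unfolding G'_def w_def[symmetric] p_def[symmetric] b_def[symmetric] by (simp add: scaleR_diff_left)
  also have "norm \<dots> \<le> \<bar>?s - 1\<bar> * norm (B v) + \<bar>E\<bar>"
    by (rule order_trans[OF norm_triangle_ineq]) (use n in simp)
  also have "\<dots> \<le> (C / c * norm w) * (?\<beta> * norm v) + (C * norm w * norm v + 3 * (C / c * norm w) * (?\<beta> * norm v))"
    using s Bv C c E by (intro add_mono mult_mono) auto
  also have "\<dots> = (C + 4 * C * ?\<beta> / c) * norm w * norm v"
    by (simp add: algebra_simps)
  finally show ?thesis by (simp add: w_def)
qed

lemma det_G'_lipschitz:
  "\<exists>A\<ge>0. \<forall>\<^sub>F u in nhds u0. u \<noteq> u0 \<longrightarrow> \<bar>\<bar>det (matrix (G' u))\<bar> - \<bar>det (matrix B)\<bar>\<bar> \<le> A * norm (u - u0)"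
proof -
  \<comment> \<open>at the centre the derivative is replaced by its limit, so that the Lipschitz condition applies\<close>
  define X where "X u = (if u = u0 then matrix B else matrix (G' u))" for u
  let ?A = "C + 4 * C * onorm B / c"
  have blB: "bounded_linear B" using linear_B by (simp add: linear_conv_bounded_linear)
  have A: "?A \<ge> 0" using C c onorm_pos_le[OF blB] by simp
  have "lipschitz_at (\<lambda>u. X u $ i $ j) u0" for i j
  proof -
    have "norm (X u $ i $ j - X u0 $ i $ j) \<le> ?A * norm (u - u0)" if "u \<in> ball u0 r" for u
    proof (cases "u = u0")
      case False
      have "norm (X u $ i $ j - X u0 $ i $ j) = norm ((G' u (axis j 1) - B (axis j 1)) $ i)"
        using False by (simp add: X_def matrix_def)
      also have "\<dots> \<le> norm (G' u (axis j 1) - B (axis j 1))" by (rule Finite_Cartesian_Product.norm_nth_le)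
      also have "\<dots> \<le> ?A * norm (u - u0)" using G'_near_B[OF that False, of "axis j 1"] by simp
      finally show ?thesis .
    qed (use A in simp)
    moreover have "\<forall>\<^sub>F u in nhds u0. u \<in> ball u0 r"
      using r by (intro eventually_nhds_in_open) auto
    ultimately show ?thesis
      unfolding lipschitz_at_def using A by (intro exI[of _ ?A]) (auto elim: eventually_mono)
  qed
  then have "lipschitz_at X u0" by (intro lipschitz_at_vec)
  then have "lipschitz_at (\<lambda>u. det (X u)) u0"
    by (rule lipschitz_at_compose) (rule lipschitz_at_det)
  then obtain A' where A': "A' \<ge> 0" "\<forall>\<^sub>F u in nhds u0. norm (det (X u) - det (X u0)) \<le> A' * norm (u - u0)"
    by (auto simp: lipschitz_at_def)
  have "\<forall>\<^sub>F u in nhds u0. u \<noteq> u0 \<longrightarrow> \<bar>\<bar>det (matrix (G' u))\<bar> - \<bar>det (matrix B)\<bar>\<bar> \<le> A' * norm (u - u0)"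
    using A'(2) by eventually_elim (auto simp: X_def)
  then show ?thesis using A'(1) by blast
qed

lemma det_G'_continuous: "continuous_on (ball u0 r - {u0}) (\<lambda>u. det (matrix (G' u)))"
proof (rule continuous_on_det)
  fix i j
  have cF: "continuous_on (ball u0 r - {u0}) F"
    using derivative by (meson DiffD1 continuous_at_imp_continuous_on has_derivative_continuous)
  have cF': "continuous_on (ball u0 r - {u0}) (\<lambda>u. F' u v)" for v
    by (rule continuous_on_subset[OF derivative_continuous]) auto
  have cB: "continuous_on (ball u0 r - {u0}) (\<lambda>u. B (u - u0))"
    by (rule linear_continuous_on_compose[OF _ linear_B]) (intro continuous_intros)
  have ne: "F u - F u0 \<noteq> 0" "B (u - u0) \<noteq> 0" if "u \<in> ball u0 r - {u0}" for u
    using that displacement_nonzero by auto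
  have "continuous_on (ball u0 r - {u0}) (\<lambda>u. G' u (axis j 1))"
    unfolding G'_def sgn_div_norm
    by (intro continuous_intros cF cF' cB) (use ne in auto)
  then have "continuous_on (ball u0 r - {u0}) (\<lambda>u. G' u (axis j 1) $ i)"
    by (rule continuous_on_component)
  then show "continuous_on (ball u0 r - {u0}) (\<lambda>u. matrix (G' u) $ i $ j)"
    by (simp add: matrix_def)
qed

end

section \<open>Kernel integrals in a straightened chart\<close>

lemma integral_norm_power_exp_scaled:
  assumes a: "a > 0" and h: "h > 0"
  shows "integrable lborel (\<lambda>u::'a::euclidean_space. norm (u - u0) ^ p * exp (- a * norm (u - u0) / h))"
    and "(\<integral>u. norm (u - u0 :: 'a) ^ p * exp (- a * norm (u - u0) / h) \<partial>lborel)
       = h ^ (DIM('a) + p) * (\<integral>z. norm (z :: 'a) ^ p * exp (- a * norm z) \<partial>lborel)"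
proof -
  let ?f = "\<lambda>u::'a. norm (u - u0) ^ p * exp (- a * norm (u - u0) / h)"
  have eq: "?f (u0 + h *\<^sub>R z) = h ^ p * (norm z ^ p * exp (- a * norm z))" for z
    using h by (simp add: power_mult_distrib)
  have m: "?f \<in> borel_measurable borel" by measurable
  have "integrable lborel (\<lambda>z. ?f (u0 + h *\<^sub>R z))"
    unfolding eq using a by (intro integrable_mult_right integrable_norm_power_exp)
  then show "integrable lborel ?f"
    using integrable_lborel_affine[OF m, of h u0] h by blast
  show "(\<integral>u. ?f u \<partial>lborel) = h ^ (DIM('a) + p) * (\<integral>z. norm (z :: 'a) ^ p * exp (- a * norm z) \<partial>lborel)"
    using integral_lborel_affine[OF m, of h u0] h unfolding eq by (simp add: power_add)
qed

context decaying_kernel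
begin

lemma measurable_kernel_scaled:
  assumes "h > 0" "f \<in> borel_measurable M"
  shows "(\<lambda>x. K (norm (f x :: 'b::euclidean_space) / h)) \<in> borel_measurable M"
  using assms by (intro measurable_kernel) auto

lemma
  fixes L :: "'a::euclidean_space \<Rightarrow> 'b::euclidean_space"
  assumes h: "h > 0" and S: "S \<in> sets borel" and cone: "\<And>z. h *\<^sub>R z \<in> S \<longleftrightarrow> z \<in> S"
    and L: "linear L" "\<And>z. norm (L z) \<le> norm z"
  shows integrable_scaled_cone_moment: "integrable lborel (\<lambda>z. indicator S z *\<^sub>R (K (norm z / h) *\<^sub>R L z))"
    and scaled_cone_moment: "(\<integral>z. indicator S z *\<^sub>R (K (norm z / h) *\<^sub>R L z) \<partial>lborel)
      = h ^ (DIM('a) + 1) *\<^sub>R (\<integral>z. indicator S z *\<^sub>R (K (norm z) *\<^sub>R L z) \<partial>lborel)"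
proof -
  have [measurable]: "S \<in> sets borel" by fact
  have [measurable]: "L \<in> borel_measurable borel"
    using L(1) by (intro borel_measurable_continuous_onI linear_continuous_on) (simp add: linear_conv_bounded_linear)
  have [measurable]: "(\<lambda>z::'a. K (norm z / h)) \<in> borel_measurable borel"
    using h by (intro measurable_kernel_scaled) auto
  let ?f = "\<lambda>z. indicator S z *\<^sub>R (K (norm z / h) *\<^sub>R L z)"
  have m: "?f \<in> borel_measurable borel" by measurable
  have eq: "?f (0 + h *\<^sub>R z) = h *\<^sub>R (indicator S z *\<^sub>R (K (norm z) *\<^sub>R L z))" for z
    using h cone[of z] by (simp add: indicator_def linear_scale[OF L(1)])
  have "integrable lborel (\<lambda>z. indicator S z *\<^sub>R (K (norm z) *\<^sub>R L z))"
    using L(2) by (intro integrable_kernel_vector) auto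
  then have "integrable lborel (\<lambda>z. ?f (0 + h *\<^sub>R z))"
    unfolding eq by (rule integrable_scaleR_right)
  then show "integrable lborel ?f"
    using integrable_lborel_affine[OF m, of h 0] h by blast
  have "(\<integral>z. ?f z \<partial>lborel) = \<bar>h\<bar> ^ DIM('a) *\<^sub>R (\<integral>z. ?f (0 + h *\<^sub>R z) \<partial>lborel)"
    by (rule integral_lborel_affine[OF m]) (use h in simp)
  also have "\<dots> = h ^ (DIM('a) + 1) *\<^sub>R (\<integral>z. indicator S z *\<^sub>R (K (norm z) *\<^sub>R L z) \<partial>lborel)"
    unfolding eq integral_scaleR_right using h by (simp add: mult.commute)
  finally show "(\<integral>z. ?f z \<partial>lborel)
      = h ^ (DIM('a) + 1) *\<^sub>R (\<integral>z. indicator S z *\<^sub>R (K (norm z) *\<^sub>R L z) \<partial>lborel)" .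
qed

text \<open>On the removed part of the cone a factor \<open>norm z / \<delta> \<ge> 1\<close> can be
  inserted, which gains one power of \<open>h\<close> after rescaling.\<close>

lemma truncated_cone_moment:
  fixes L :: "'a::euclidean_space \<Rightarrow> 'b::euclidean_space"
  assumes h: "h > 0" and \<delta>: "\<delta> > 0" and S: "S \<in> sets borel" and cone: "\<And>z. h *\<^sub>R z \<in> S \<longleftrightarrow> z \<in> S"
    and L: "linear L" "\<And>z. norm (L z) \<le> norm z"
  shows "norm ((\<integral>z. indicator {z \<in> S. norm z < \<delta>} z *\<^sub>R (K (norm z / h) *\<^sub>R L z) \<partial>lborel)
       - h ^ (DIM('a) + 1) *\<^sub>R (\<integral>z. indicator S z *\<^sub>R (K (norm z) *\<^sub>R L z) \<partial>lborel))
     \<le> h ^ (DIM('a) + 2) * ((\<integral>z. K (norm z) * norm (z::'a) ^ 2 \<partial>lborel) / \<delta>)"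
proof -
  have [measurable]: "S \<in> sets borel" by fact
  have [measurable]: "{z. norm z < \<delta>} \<in> sets (borel :: 'a measure)"
    by (intro borel_open open_Collect_less continuous_intros)
  have [measurable]: "L \<in> borel_measurable borel"
    using L(1) by (intro borel_measurable_continuous_onI linear_continuous_on) (simp add: linear_conv_bounded_linear)
  have mK [measurable]: "(\<lambda>z::'a. K (norm z / h)) \<in> borel_measurable borel"
    using h by (intro measurable_kernel_scaled) auto
  have T: "{z \<in> S. norm z < \<delta>} = S \<inter> {z. norm z < \<delta>}" by auto
  let ?f = "\<lambda>z. indicator S z *\<^sub>R (K (norm z / h) *\<^sub>R L z)"
  let ?g = "\<lambda>z. indicator {z \<in> S. norm z < \<delta>} z *\<^sub>R (K (norm z / h) *\<^sub>R L z)"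
  let ?b = "\<lambda>z::'a. K (norm z / h) * norm z ^ 2"
  note intf = integrable_scaled_cone_moment[OF h S cone L]
  have intg: "integrable lborel ?g"
  proof (rule Bochner_Integration.integrable_bound[OF intf])
    show "?g \<in> borel_measurable lborel" unfolding T by measurable
    show "AE z in lborel. norm (?g z) \<le> norm (?f z)"
      by (intro always_eventually allI) (auto simp: indicator_def)
  qed
  have eqb: "?b (0 + h *\<^sub>R z) = h ^ 2 * (K (norm z) * norm z ^ 2)" for z
    using h by (simp add: power_mult_distrib)
  have mb: "?b \<in> borel_measurable borel" by measurable
  have "integrable lborel (\<lambda>z. ?b (0 + h *\<^sub>R z))"
    unfolding eqb by (intro integrable_mult_right integrable_kernel_moment)
  then have intb: "integrable lborel ?b"
    using integrable_lborel_affine[OF mb, of h 0] h by blast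
  have "norm ((\<integral>z. ?g z \<partial>lborel) - (\<integral>z. ?f z \<partial>lborel)) = norm (\<integral>z. ?g z - ?f z \<partial>lborel)"
    using intf intg by simp
  also have "\<dots> \<le> (\<integral>z. ?b z / \<delta> \<partial>lborel)"
  proof (rule Bochner_Integration.integral_norm_bound_integral)
    fix z :: 'a
    have K: "K (norm z / h) \<ge> 0" using h by (intro kernel_nonneg) auto
    show "norm (?g z - ?f z) \<le> ?b z / \<delta>"
    proof (cases "z \<in> S \<and> \<not> norm z < \<delta>")
      case True
      then have "norm z * \<delta> \<le> norm z * norm z" by (intro mult_left_mono) auto
      then have "norm (L z) \<le> norm z ^ 2 / \<delta>"
        using L(2)[of z] \<delta> by (simp add: pos_le_divide_eq power2_eq_square order_trans[OF mult_right_mono[of _ _ \<delta>]])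
      then have "K (norm z / h) * norm (L z) \<le> K (norm z / h) * (norm z ^ 2 / \<delta>)"
        using K by (rule mult_left_mono)
      then show ?thesis using True K by simp
    next
      case False
      then have "?g z = ?f z" by (auto simp: indicator_def)
      then have "norm (?g z - ?f z) = 0" by (simp only: diff_self norm_zero)
      also have "0 \<le> ?b z / \<delta>" using K \<delta> by simp
      finally show ?thesis .
    qed
  qed (use intf intg intb in auto)
  also have "\<dots> = h ^ (DIM('a) + 2) * ((\<integral>z. K (norm z) * norm (z::'a) ^ 2 \<partial>lborel) / \<delta>)"
  proof -
    have "(\<integral>z. ?b z \<partial>lborel) = \<bar>h\<bar> ^ DIM('a) *\<^sub>R (\<integral>z. ?b (0 + h *\<^sub>R z) \<partial>lborel)"
      by (rule integral_lborel_affine[OF mb]) (use h in simp)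
    also have "\<dots> = h ^ DIM('a) * (h ^ 2 * (\<integral>z. K (norm z) * norm (z::'a) ^ 2 \<partial>lborel))"
      unfolding eqb integral_mult_right_zero using h by simp
    finally show ?thesis by (simp only: power_add integral_divide_zero mult.assoc times_divide_eq_right)
  qed
  finally have *: "norm ((\<integral>z. ?g z \<partial>lborel) - (\<integral>z. ?f z \<partial>lborel))
      \<le> h ^ (DIM('a) + 2) * ((\<integral>z. K (norm z) * norm (z::'a) ^ 2 \<partial>lborel) / \<delta>)" .
  show ?thesis
    using * by (simp only: scaled_cone_moment[OF h S cone L])
qed

end

context straightened_chart
begin

text \<open>The change of variables \<open>z = G u\<close>: since \<open>norm (G u)\<close> is the true
  distance, the kernel values on the two sides agree exactly. The centre is removed, since
  \<open>G\<close> is differentiable only away from it.\<close>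

lemma straightened_kernel_integral:
  fixes \<kappa> :: "real \<Rightarrow> real"
  assumes Q: "\<And>v t. v \<in> Q \<Longrightarrow> t \<ge> 0 \<Longrightarrow> t *\<^sub>R v \<in> Q" "0 \<in> Q" and \<delta>: "0 < \<delta>" "\<delta> \<le> c * r / 4"
    and S_def: "S = {u \<in> ball u0 r. u - u0 \<in> Q \<and> norm (F u - F u0) < \<delta>}"
    and S: "S \<in> sets borel"
    and \<kappa>: "\<And>g. g \<in> borel_measurable (restrict_space borel S) \<Longrightarrow>
       (\<lambda>u. \<kappa> (norm (g u :: 'a))) \<in> borel_measurable (restrict_space borel S)"
    and int: "integrable lborel (\<lambda>z. indicator {z \<in> B ` Q. norm z < \<delta>} z *\<^sub>R (\<kappa> (norm z) *\<^sub>R z))"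
  shows "integrable lborel (\<lambda>u. indicator S u *\<^sub>R ((\<bar>det (matrix (G' u))\<bar> * \<kappa> (norm (F u - F u0))) *\<^sub>R G u))"
    and "(\<integral>u. indicator S u *\<^sub>R ((\<bar>det (matrix (G' u))\<bar> * \<kappa> (norm (F u - F u0))) *\<^sub>R G u) \<partial>lborel)
       = (\<integral>z. indicator {z \<in> B ` Q. norm z < \<delta>} z *\<^sub>R (\<kappa> (norm z) *\<^sub>R z) \<partial>lborel)"
proof -
  let ?Z = "{z \<in> B ` Q. norm z < \<delta>}"
  have GS: "G ` S = ?Z" unfolding S_def using Q \<delta> by (rule G_image)
  have G0: "G u = 0 \<longleftrightarrow> u = u0" if "u \<in> ball u0 r" for u
    using norm_G[OF that] displacement_nonzero[OF that] by (metis cancel_comm_monoid_add_class.diff_cancel norm_eq_zero)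
  let ?S = "S - {u0}"
  have Sr: "?S \<subseteq> ball u0 r - {u0}" by (auto simp: S_def)
  have inj: "inj_on G ?S" using inj_on_G by (rule inj_on_subset) (use Sr in auto)
  have GS': "G ` ?S = ?Z - {0}"
  proof
    show "G ` ?S \<subseteq> ?Z - {0}" using GS Sr G0 by auto
    show "?Z - {0} \<subseteq> G ` ?S"
    proof
      fix z assume z: "z \<in> ?Z - {0}"
      then obtain u where "u \<in> S" "z = G u" using GS by auto
      then show "z \<in> G ` ?S" using z G0[of u] S_def by auto
    qed
  qed
  have S': "?S \<in> sets borel" using S by simp
  have der: "(G has_derivative G' u) (at u within ?S)" if "u \<in> ?S" for u
  proof -
    have "u \<in> ball u0 r" "u \<noteq> u0" using that Sr by auto
    from G_has_derivative[OF this] show ?thesis by (rule has_derivative_at_withinI)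
  qed
  have contG: "continuous_on ?S G"
    using der by (rule has_derivative_continuous_on)
  have "continuous_on (ball u0 r) F"
    using has_derivative_at_withinI[OF derivative] by (rule has_derivative_continuous_on)
  then have contF: "continuous_on S F"
    by (rule continuous_on_subset) (auto simp: S_def)
  have m1: "(\<lambda>u. \<bar>det (matrix (G' u))\<bar>) \<in> borel_measurable (restrict_space borel ?S)"
    by (intro borel_measurable_abs borel_measurable_continuous_on_restrict continuous_on_subset[OF det_G'_continuous] Sr)
  have m2: "(\<lambda>u. \<kappa> (norm (F u - F u0))) \<in> borel_measurable (restrict_space borel S)"
    by (intro \<kappa> borel_measurable_continuous_on_restrict continuous_intros contF)
  then have m2': "(\<lambda>u. \<kappa> (norm (F u - F u0))) \<in> borel_measurable (restrict_space borel ?S)"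
    using measurable_restrict_mono[of _ borel S borel ?S] by blast
  have m3: "G \<in> borel_measurable (restrict_space borel ?S)"
    using contG by (rule borel_measurable_continuous_on_restrict)
  have ng: "norm (G u) = norm (F u - F u0)" if "u \<in> ?S" for u
    using norm_G that Sr by blast
  have "(\<lambda>u. (\<bar>det (matrix (G' u))\<bar> * \<kappa> (norm (F u - F u0))) *\<^sub>R G u) \<in> borel_measurable (restrict_space borel ?S)"
    using m1 m2' m3 by measurable
  then have "(\<lambda>u. indicator ?S u *\<^sub>R ((\<bar>det (matrix (G' u))\<bar> * \<kappa> (norm (F u - F u0))) *\<^sub>R G u)) \<in> borel_measurable borel"
    using S' by (subst (asm) borel_measurable_restrict_space_iff) auto
  also have eq1: "(\<lambda>u. indicator ?S u *\<^sub>R ((\<bar>det (matrix (G' u))\<bar> * \<kappa> (norm (F u - F u0))) *\<^sub>R G u))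
      = (\<lambda>u. indicator ?S u *\<^sub>R (\<bar>det (matrix (G' u))\<bar> *\<^sub>R (\<kappa> (norm (G u)) *\<^sub>R G u)))"
  proof
    show "indicator ?S u *\<^sub>R ((\<bar>det (matrix (G' u))\<bar> * \<kappa> (norm (F u - F u0))) *\<^sub>R G u)
      = indicator ?S u *\<^sub>R (\<bar>det (matrix (G' u))\<bar> *\<^sub>R (\<kappa> (norm (G u)) *\<^sub>R G u))" for u
      using ng[of u] by (cases "u \<in> ?S") simp_all
  qed
  finally have meas: "(\<lambda>u. indicator ?S u *\<^sub>R (\<bar>det (matrix (G' u))\<bar> *\<^sub>R (\<kappa> (norm (G u)) *\<^sub>R G u))) \<in> borel_measurable borel" .
  have eq2: "(\<lambda>z. indicator (?Z - {0}) z *\<^sub>R (\<kappa> (norm z) *\<^sub>R z)) = (\<lambda>z. indicator ?Z z *\<^sub>R (\<kappa> (norm z) *\<^sub>R z))"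
    by (auto simp: indicator_def)
  have int': "set_integrable lborel (G ` ?S) (\<lambda>z. \<kappa> (norm z) *\<^sub>R z)"
    unfolding GS' set_integrable_def eq2 by (rule int)
  have eq3: "(\<lambda>u. indicator ?S u *\<^sub>R ((\<bar>det (matrix (G' u))\<bar> * \<kappa> (norm (F u - F u0))) *\<^sub>R G u))
     = (\<lambda>u. indicator S u *\<^sub>R ((\<bar>det (matrix (G' u))\<bar> * \<kappa> (norm (F u - F u0))) *\<^sub>R G u))"
  proof
    show "indicator ?S u *\<^sub>R ((\<bar>det (matrix (G' u))\<bar> * \<kappa> (norm (F u - F u0))) *\<^sub>R G u)
      = indicator S u *\<^sub>R ((\<bar>det (matrix (G' u))\<bar> * \<kappa> (norm (F u - F u0))) *\<^sub>R G u)" for u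
      using G0[of u0] r by (cases "u = u0") (simp_all add: indicator_def)
  qed
  note cv = change_of_variables_lborel[OF S' der inj meas int',
      unfolded GS' set_integrable_def set_lebesgue_integral_def eq2 eq1[symmetric] eq3]
  show "integrable lborel (\<lambda>u. indicator S u *\<^sub>R ((\<bar>det (matrix (G' u))\<bar> * \<kappa> (norm (F u - F u0))) *\<^sub>R G u))"
    by (rule cv(1))
  show "(\<integral>u. indicator S u *\<^sub>R ((\<bar>det (matrix (G' u))\<bar> * \<kappa> (norm (F u - F u0))) *\<^sub>R G u) \<partial>lborel)
       = (\<integral>z. indicator ?Z z *\<^sub>R (\<kappa> (norm z) *\<^sub>R z) \<partial>lborel)"
    by (rule cv(2))
qed

end

context straightened_chart
begin

lemma
  assumes u: "u \<in> ball u0 r"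
  shows displacement_minus_G: "norm (F u - F u0 - L (G u)) \<le> 2 * C * (norm (u - u0))\<^sup>2"
    and norm_LG: "norm (L (G u)) \<le> 2 * onorm B * norm (u - u0)"
proof -
  let ?p = "F u - F u0" and ?b = "B (u - u0)"
  have t: "norm (?p - L ?b) \<le> C * (norm (u - u0))\<^sup>2"
    using taylor[OF u] by (simp add: LB)
  have "norm (L ?b - L (G u)) \<le> norm (?p - L ?b)"
  proof (cases "?b = 0")
    case True
    then show ?thesis by (simp add: G_def linear_0[OF linear_L] linear_0[OF linear_B])
  next
    case False
    have "L ?b - L (G u) = (1 - norm ?p / norm ?b) *\<^sub>R L ?b"
      by (simp add: G_def linear_scale[OF linear_L] scaleR_diff_left)
    also have "norm \<dots> = \<bar>(1 - norm ?p / norm ?b) * norm ?b\<bar>"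
      by (simp add: norm_L abs_mult)
    also have "(1 - norm ?p / norm ?b) * norm ?b = norm (L ?b) - norm ?p"
      using False by (simp add: norm_L algebra_simps)
    finally show ?thesis
      using norm_triangle_ineq3[of "L ?b" ?p] by (simp add: norm_minus_commute)
  qed
  then have "norm ((?p - L ?b) + (L ?b - L (G u))) \<le> C * (norm (u - u0))\<^sup>2 + C * (norm (u - u0))\<^sup>2"
    using t by (intro order_trans[OF norm_triangle_ineq] add_mono) auto
  then show "norm (?p - L (G u)) \<le> 2 * C * (norm (u - u0))\<^sup>2" by simp
  have blB: "bounded_linear B" using linear_B by (simp add: linear_conv_bounded_linear)
  have "norm (L (G u)) = norm ?p" using norm_G[OF u] by (simp add: norm_L)
  also have "norm ?p \<le> norm (L ?b) + norm (?p - L ?b)"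
    using norm_triangle_ineq[of "L ?b" "?p - L ?b"] by simp
  also have "\<dots> \<le> norm ?b + norm ?b"
  proof -
    have "norm (?p - L ?b) \<le> norm ?b"
      using displacement_relative[OF u] norm_ge_zero[of ?b] by linarith
    then show ?thesis by (simp add: norm_L)
  qed
  also have "\<dots> \<le> 2 * onorm B * norm (u - u0)"
    using onorm[OF blB, of "u - u0"] by simp
  finally show "norm (L (G u)) \<le> 2 * onorm B * norm (u - u0)" .
qed

text \<open>With \<open>j\<close> the volume density, \<open>d\<close> the Jacobian of \<open>G\<close> and
  \<open>f0\<close> the value at the centre, the three factors of the integrand are replaced one
  after the other.\<close>

lemma integrand_remainder:
  assumes u: "u \<in> ball u0 r" and f0: "f0 \<ge> 0" and N: "N \<ge> 0" and A: "A \<ge> 0" and A2: "A2 \<ge> 0"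
    and J: "\<bar>j\<bar> \<le> J1" "\<bar>j - d\<bar> \<le> A2 * norm (u - u0)"
    and f: "\<bar>f - f0\<bar> \<le> N * norm (u - u0) + A * (norm (u - u0))\<^sup>2"
  shows "norm ((j * f) *\<^sub>R (F u - F u0) - (d * f0) *\<^sub>R L (G u))
      \<le> (2 * C * J1 * (1 + r) + 2 * onorm B * (J1 + A2)) * ((f0 + N) * (norm (u - u0))\<^sup>2 + A * (norm (u - u0)) ^ 3)"
proof -
  let ?p = "F u - F u0" and ?g = "L (G u)" and ?w = "norm (u - u0)"
  let ?D = "f0 + N" and ?\<beta> = "onorm B"
  have blB: "bounded_linear B" using linear_B by (simp add: linear_conv_bounded_linear)
  have \<beta>: "?\<beta> \<ge> 0" using onorm_pos_le[OF blB] .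
  have J1: "J1 \<ge> 0" using J(1) by linarith
  have w: "0 \<le> ?w" "?w \<le> r" using u by (auto simp: dist_norm norm_minus_commute)
  have "\<bar>f\<bar> \<le> f0 + (N * ?w + A * ?w\<^sup>2)" using f f0 by linarith
  also have "\<dots> \<le> f0 * (1 + r) + (N * (1 + r) + A * ?w * (1 + r))"
  proof (intro add_mono)
    show "f0 \<le> f0 * (1 + r)" using f0 r by (simp add: distrib_left)
    show "N * ?w \<le> N * (1 + r)" using w N by (intro mult_left_mono) auto
    have "A * ?w * ?w \<le> A * ?w * (1 + r)" using w A by (intro mult_left_mono) auto
    then show "A * ?w\<^sup>2 \<le> A * ?w * (1 + r)" by (simp add: power2_eq_square mult.assoc)
  qed
  finally have fb: "\<bar>f\<bar> \<le> (1 + r) * (?D + A * ?w)" by (simp add: algebra_simps)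
  have e: "\<bar>j * f - d * f0\<bar> \<le> (J1 + A2) * (?D * ?w + A * ?w\<^sup>2)"
  proof -
    have "j * f - d * f0 = j * (f - f0) + (j - d) * f0" by (simp add: algebra_simps)
    then have "\<bar>j * f - d * f0\<bar> \<le> \<bar>j\<bar> * \<bar>f - f0\<bar> + \<bar>j - d\<bar> * f0"
      using f0 by (metis abs_mult abs_of_nonneg abs_triangle_ineq)
    also have "\<dots> \<le> J1 * (N * ?w + A * ?w\<^sup>2) + (A2 * ?w) * f0"
      using J f J1 f0 by (intro add_mono mult_mono) auto
    also have "\<dots> \<le> J1 * (?D * ?w + A * ?w\<^sup>2) + A2 * (?D * ?w + A * ?w\<^sup>2)"
    proof (rule add_mono)
      have "N * ?w + A * ?w\<^sup>2 \<le> ?D * ?w + A * ?w\<^sup>2"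
        using f0 w by (simp add: distrib_right)
      then show "J1 * (N * ?w + A * ?w\<^sup>2) \<le> J1 * (?D * ?w + A * ?w\<^sup>2)"
        using J1 by (rule mult_left_mono)
      have "f0 * ?w \<le> ?D * ?w + A * ?w\<^sup>2" using N A w by (simp add: distrib_right)
      then have "A2 * (f0 * ?w) \<le> A2 * (?D * ?w + A * ?w\<^sup>2)" using A2 by (rule mult_left_mono)
      then show "A2 * ?w * f0 \<le> A2 * (?D * ?w + A * ?w\<^sup>2)" by (simp add: mult_ac)
    qed
    finally show ?thesis by (simp add: algebra_simps)
  qed
  have "(j * f) *\<^sub>R ?p - (d * f0) *\<^sub>R ?g = (j * f) *\<^sub>R (?p - ?g) + (j * f - d * f0) *\<^sub>R ?g"
    by (simp add: algebra_simps)
  also have "norm \<dots> \<le> \<bar>j * f\<bar> * norm (?p - ?g) + \<bar>j * f - d * f0\<bar> * norm ?g"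
    by (rule order_trans[OF norm_triangle_ineq]) simp
  also have "\<dots> \<le> (J1 * ((1 + r) * (?D + A * ?w))) * (2 * C * ?w\<^sup>2)
      + ((J1 + A2) * (?D * ?w + A * ?w\<^sup>2)) * (2 * ?\<beta> * ?w)"
  proof -
    have jf: "\<bar>j * f\<bar> \<le> J1 * ((1 + r) * (?D + A * ?w))"
      unfolding abs_mult using J(1) fb J1 by (intro mult_mono) auto
    show ?thesis
      by (intro add_mono mult_mono jf e displacement_minus_G[OF u] norm_LG[OF u])
         (use J1 A2 f0 N A w r in auto)
  qed
  also have "\<dots> = (2 * C * J1 * (1 + r) + 2 * ?\<beta> * (J1 + A2)) * (?D * ?w\<^sup>2 + A * ?w ^ 3)"
    by (simp add: algebra_simps power2_eq_square power3_eq_cube)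
  finally show ?thesis .
qed

end

locale kernel_chart = straightened_chart F F' u0 r C c L B + decaying_kernel K a1 a2
  for F :: "real^'m::finite \<Rightarrow> 'a::euclidean_space" and F' u0 r C c L B K a1 a2
begin

text \<open>The constant \<open>E\<close> is chosen before \<open>f\<close>, \<open>f0\<close>,
  \<open>N\<close>, \<open>A\<close> and \<open>h\<close>. In the application \<open>N\<close>
  is a multiple of the norm of the gradient and \<open>A\<close> a second-order Taylor constant.\<close>

lemma kernel_chart_integral_expansion:
  fixes J :: "real^'m \<Rightarrow> real"
  assumes Q: "\<And>v t. v \<in> Q \<Longrightarrow> t \<ge> 0 \<Longrightarrow> t *\<^sub>R v \<in> Q" "0 \<in> Q" and BQ: "B ` Q \<in> sets borel"
    and \<delta>: "0 < \<delta>" "\<delta> \<le> c * r / 4"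
    and S_def: "S = {u \<in> ball u0 r. u - u0 \<in> Q \<and> norm (F u - F u0) < \<delta>}"
    and S: "S \<in> sets borel"
    and A2: "A2 \<ge> 0" and J1: "\<And>u. u \<in> S \<Longrightarrow> \<bar>J u\<bar> \<le> J1"
    and J2: "\<And>u. u \<in> S \<Longrightarrow> u \<noteq> u0 \<Longrightarrow> \<bar>J u - \<bar>det (matrix (G' u))\<bar>\<bar> \<le> A2 * norm (u - u0)"
  obtains E where "E \<ge> 0" "\<And>f f0 N A h. f0 \<ge> 0 \<Longrightarrow> N \<ge> 0 \<Longrightarrow> A \<ge> 0 \<Longrightarrow> h > 0 \<Longrightarrow>
      (\<And>u. u \<in> S \<Longrightarrow> \<bar>f u - f0\<bar> \<le> N * norm (u - u0) + A * (norm (u - u0))\<^sup>2) \<Longrightarrow>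
      (\<lambda>u. indicator S u *\<^sub>R ((J u * f u * K (norm (F u - F u0) / h)) *\<^sub>R (F u - F u0))) \<in> borel_measurable borel \<Longrightarrow>
      norm ((\<integral>u. indicator S u *\<^sub>R ((J u * f u * K (norm (F u - F u0) / h)) *\<^sub>R (F u - F u0)) \<partial>lborel)
        - (f0 * h ^ (CARD('m) + 1)) *\<^sub>R L (cone_moment (B ` Q)))
      \<le> E * ((f0 + N) * h ^ (CARD('m) + 2) + A * h ^ (CARD('m) + 3))"
proof -
  define a where "a = a2 * (c / 2)"
  have a: "a > 0" using a2 c by (simp add: a_def)
  define I where "I p = (\<integral>z. norm (z :: real^'m) ^ p * exp (- a * norm z) \<partial>lborel)" for p
  have I: "I p \<ge> 0" for p unfolding I_def by (intro integral_nonneg_AE) auto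
  define M2 where "M2 = (\<integral>z. K (norm z) * norm (z :: real^'m) ^ 2 \<partial>lborel) / \<delta>"
  have M2: "M2 \<ge> 0"
    unfolding M2_def using \<delta>(1) kernel_nonneg by (intro divide_nonneg_nonneg integral_nonneg_AE) auto
  have blB: "bounded_linear B" and blL: "bounded_linear L"
    using linear_B linear_L by (simp_all add: linear_conv_bounded_linear)
  have u0S: "u0 \<in> S" using Q(2) r \<delta>(1) by (simp add: S_def)
  define E0 where "E0 = 2 * C * J1 * (1 + r) + 2 * onorm B * (J1 + A2)"
  have "J1 \<ge> 0" using J1[OF u0S] by linarith
  then have E0: "E0 \<ge> 0"
    unfolding E0_def using C r A2 onorm_pos_le[OF blB] by simp
  define E where "E = E0 * a1 * (I 2 + I 3) + M2"
  show ?thesis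
  proof (rule that[of E])
    show "E \<ge> 0" using E0 a1 I M2 by (simp add: E_def)
    fix f :: "real^'m \<Rightarrow> real" and f0 N A h :: real
    assume f0: "f0 \<ge> 0" and N: "N \<ge> 0" and A: "A \<ge> 0" and h: "h > 0"
      and f: "\<And>u. u \<in> S \<Longrightarrow> \<bar>f u - f0\<bar> \<le> N * norm (u - u0) + A * (norm (u - u0))\<^sup>2"
      and meas: "(\<lambda>u. indicator S u *\<^sub>R ((J u * f u * K (norm (F u - F u0) / h)) *\<^sub>R (F u - F u0))) \<in> borel_measurable borel"
    let ?m = "CARD('m)"
    let ?T = "\<lambda>u. indicator S u *\<^sub>R ((J u * f u * K (norm (F u - F u0) / h)) *\<^sub>R (F u - F u0))"
    let ?Gk = "\<lambda>u. indicator S u *\<^sub>R ((\<bar>det (matrix (G' u))\<bar> * K (norm (F u - F u0) / h)) *\<^sub>R G u)"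
    let ?Z = "{z \<in> B ` Q. norm z < \<delta>}"
    have cone: "h *\<^sub>R z \<in> B ` Q \<longleftrightarrow> z \<in> B ` Q" for z
    proof
      assume "z \<in> B ` Q"
      then show "h *\<^sub>R z \<in> B ` Q"
        using Q(1) h by (auto simp: linear_scale[OF linear_B, symmetric])
    next
      assume "h *\<^sub>R z \<in> B ` Q"
      then obtain q where q: "q \<in> Q" "h *\<^sub>R z = B q" by auto
      have "z = (1 / h) *\<^sub>R (h *\<^sub>R z)" using h by simp
      also have "\<dots> = B ((1 / h) *\<^sub>R q)" using q(2) by (simp add: linear_scale[OF linear_B])
      finally show "z \<in> B ` Q" using Q(1)[OF q(1), of "1 / h"] h by auto
    qed
    have lid: "linear (\<lambda>z::real^'m. z)" by (rule linearI) auto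
    have [measurable]: "{z. norm z < \<delta>} \<in> sets (borel :: (real^'m) measure)"
      by (intro borel_open open_Collect_less continuous_intros)
    have intZ: "integrable lborel (\<lambda>z. indicator ?Z z *\<^sub>R (K (norm z / h) *\<^sub>R z))"
    proof (rule Bochner_Integration.integrable_bound[OF integrable_scaled_cone_moment[OF h BQ cone lid]])
      have [measurable]: "(\<lambda>z::real^'m. K (norm z / h)) \<in> borel_measurable borel"
        using h by (intro measurable_kernel_scaled) auto
      have [measurable]: "B ` Q \<in> sets borel" by fact
      have "?Z = B ` Q \<inter> {z. norm z < \<delta>}" by auto
      then show "(\<lambda>z. indicator ?Z z *\<^sub>R (K (norm z / h) *\<^sub>R z)) \<in> borel_measurable lborel"
        by simp measurable
      show "AE z in lborel. norm (indicator ?Z z *\<^sub>R (K (norm z / h) *\<^sub>R z))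
          \<le> norm (indicator (B ` Q) z *\<^sub>R (K (norm z / h) *\<^sub>R z))"
        by (intro always_eventually allI) (auto simp: indicator_def)
    qed simp
    have cv1: "integrable lborel ?Gk"
      by (rule straightened_kernel_integral(1)[where \<kappa> = "\<lambda>t. K (t / h)" and Q = Q and \<delta> = \<delta>])
         (fact Q \<delta> S_def S intZ measurable_kernel_scaled[OF h])+
    have cv2: "(\<integral>u. ?Gk u \<partial>lborel) = (\<integral>z. indicator ?Z z *\<^sub>R (K (norm z / h) *\<^sub>R z) \<partial>lborel)"
      by (rule straightened_kernel_integral(2)[where \<kappa> = "\<lambda>t. K (t / h)" and Q = Q and \<delta> = \<delta>])
         (fact Q \<delta> S_def S intZ measurable_kernel_scaled[OF h])+
    let ?U = "\<lambda>u. L (?Gk u)"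
    have intU: "integrable lborel ?U" by (rule integrable_bounded_linear[OF blL cv1])
    have "(\<integral>u. ?U u \<partial>lborel) = L (\<integral>u. ?Gk u \<partial>lborel)"
      by (rule integral_bounded_linear[OF blL cv1])
    then have LU: "(\<integral>u. ?U u \<partial>lborel) = L (\<integral>z. indicator ?Z z *\<^sub>R (K (norm z / h) *\<^sub>R z) \<partial>lborel)"
      unfolding cv2 .
    have trunc: "norm (L (\<integral>z. indicator ?Z z *\<^sub>R (K (norm z / h) *\<^sub>R z) \<partial>lborel)
        - h ^ (?m + 1) *\<^sub>R L (cone_moment (B ` Q))) \<le> h ^ (?m + 2) * M2"
      using truncated_cone_moment[OF h \<delta>(1) BQ cone lid]
      by (simp add: M2_def norm_L flip: linear_scale[OF linear_L] linear_diff[OF linear_L])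
    have main: "norm (f0 *\<^sub>R (\<integral>u. ?U u \<partial>lborel)
        - (f0 * h ^ (?m + 1)) *\<^sub>R L (cone_moment (B ` Q))) \<le> f0 * (h ^ (?m + 2) * M2)"
    proof -
      have "f0 *\<^sub>R X - (f0 * k) *\<^sub>R Y = f0 *\<^sub>R (X - k *\<^sub>R Y)" for X Y :: 'a and k
        by (simp add: scaleR_diff_right)
      then show ?thesis
        unfolding LU using mult_left_mono[OF trunc f0] f0 by (simp only: norm_scaleR abs_of_nonneg)
    qed
    let ?V = "\<lambda>u. ?T u - f0 *\<^sub>R ?U u"
    let ?e = "\<lambda>p u. norm (u - u0) ^ p * exp (- a * norm (u - u0) / h)"
    let ?b = "\<lambda>u. E0 * a1 * ((f0 + N) * ?e 2 u + A * ?e 3 u)"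
    note inte = integral_norm_power_exp_scaled[OF a h, where ?u0.0 = u0, folded I_def]
    have intb: "integrable lborel ?b"
      by (intro integrable_mult_right Bochner_Integration.integrable_add inte(1))
    \<comment> \<open>the distance to the centre is at least c / 2 times norm (u - u0), which gives the rate a = a2 * c / 2\<close>
    have Vb: "norm (?V u) \<le> ?b u" for u
    proof (cases "u \<in> S")
      case False
      have "0 \<le> ?b u" using E0 a1 f0 N A by simp
      then show ?thesis using False by (simp add: linear_0[OF linear_L])
    next
      case u: True
      then have ub: "u \<in> ball u0 r" by (simp add: S_def)
      let ?k = "K (norm (F u - F u0) / h)" and ?w = "norm (u - u0)"
      let ?R = "(J u * f u) *\<^sub>R (F u - F u0) - (\<bar>det (matrix (G' u))\<bar> * f0) *\<^sub>R L (G u)"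
      have "norm ?R \<le> E0 * ((f0 + N) * ?w\<^sup>2 + A * ?w ^ 3)"
      proof (cases "u = u0")
        case True
        then have "?R = 0" by (simp add: G_def linear_0[OF linear_B] linear_0[OF linear_L])
        then show ?thesis using E0 f0 N A by simp
      next
        case False
        show ?thesis
          unfolding E0_def
          by (rule integrand_remainder[OF ub f0 N A A2 J1[OF u] J2[OF u False] f[OF u]])
      qed
      moreover have k0: "?k \<ge> 0" using h by (intro kernel_nonneg) auto
      moreover have "?k \<le> a1 * exp (- a * ?w / h)"
      proof -
        have "?k \<le> a1 * exp (- a2 * (norm (F u - F u0) / h))"
          using h by (intro decay) auto
        also have "\<dots> \<le> a1 * exp (- a * ?w / h)"
        proof -
          have "a2 * (c / 2 * ?w) \<le> a2 * norm (F u - F u0)"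
            using displacement_lower_norm[OF ub] a2 by (intro mult_left_mono) auto
          then have "- a2 * (norm (F u - F u0) / h) \<le> - a * ?w / h"
            using h by (simp add: a_def field_simps)
          then show ?thesis using a1 by simp
        qed
        finally show ?thesis .
      qed
      ultimately have kR: "?k * norm ?R \<le> (a1 * exp (- a * ?w / h)) * (E0 * ((f0 + N) * ?w\<^sup>2 + A * ?w ^ 3))"
        using a1 by (intro mult_mono) auto
      have "?V u = ?k *\<^sub>R ?R"
        using u by (simp add: linear_scale[OF linear_L] scaleR_diff_right mult_ac)
      then have "norm (?V u) = ?k * norm ?R"
        using k0 by (simp only: norm_scaleR abs_of_nonneg)
      also note kR
      also have "(a1 * exp (- a * ?w / h)) * (E0 * ((f0 + N) * ?w\<^sup>2 + A * ?w ^ 3)) = ?b u"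
        by (simp add: algebra_simps)
      finally show ?thesis .
    qed
    have intV: "integrable lborel ?V"
    proof (rule Bochner_Integration.integrable_bound[OF intb])
      show "?V \<in> borel_measurable lborel"
        using meas borel_measurable_integrable[OF intU] by measurable
      show "AE u in lborel. norm (?V u) \<le> norm (?b u)"
      proof (intro always_eventually allI)
        show "norm (?V u) \<le> norm (?b u)" for u
          unfolding real_norm_def using Vb[of u] abs_ge_self[of "?b u"] by (rule order_trans)
      qed
    qed
    have "integrable lborel (\<lambda>u. ?V u + f0 *\<^sub>R ?U u)"
      using intV intU by (intro Bochner_Integration.integrable_add integrable_scaleR_right)
    then have "integrable lborel ?T" by simp
    then have v1: "(\<integral>u. ?V u \<partial>lborel) = (\<integral>u. ?T u \<partial>lborel) - f0 *\<^sub>R (\<integral>u. ?U u \<partial>lborel)"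
      using intU by (subst Bochner_Integration.integral_diff) (auto simp: integrable_scaleR_right)
    have v2: "norm (\<integral>u. ?V u \<partial>lborel) \<le> (\<integral>u. ?b u \<partial>lborel)"
      by (rule Bochner_Integration.integral_norm_bound_integral[OF intV intb Vb])
    have v3: "(\<integral>u. ?b u \<partial>lborel) = E0 * a1 * ((f0 + N) * (h ^ (?m + 2) * I 2) + A * (h ^ (?m + 3) * I 3))"
      using inte(1)[of 2] inte(1)[of 3] inte(2)[of 2] inte(2)[of 3]
      by simp
    have rem: "norm ((\<integral>u. ?T u \<partial>lborel) - f0 *\<^sub>R (\<integral>u. ?U u \<partial>lborel))
        \<le> E0 * a1 * ((f0 + N) * (h ^ (?m + 2) * I 2) + A * (h ^ (?m + 3) * I 3))"
      using v2 unfolding v1 v3 .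
    let ?X = "(f0 + N) * h ^ (?m + 2) + A * h ^ (?m + 3)"
    have "norm ((\<integral>u. ?T u \<partial>lborel) - (f0 * h ^ (?m + 1)) *\<^sub>R L (cone_moment (B ` Q)))
      \<le> E0 * a1 * ((f0 + N) * (h ^ (?m + 2) * I 2) + A * (h ^ (?m + 3) * I 3)) + f0 * (h ^ (?m + 2) * M2)"
      using norm_triangle_le[OF add_mono[OF rem main]] by simp
    also have "\<dots> \<le> E0 * a1 * ((I 2 + I 3) * ?X) + M2 * ?X"
    proof (rule add_mono)
      have "(f0 + N) * (h ^ (?m + 2) * I 2) \<le> (f0 + N) * h ^ (?m + 2) * (I 2 + I 3)"
        using f0 N h I by (simp add: mult.assoc mult_left_mono)
      moreover have "A * (h ^ (?m + 3) * I 3) \<le> A * h ^ (?m + 3) * (I 2 + I 3)"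
        using A h I by (simp add: mult.assoc mult_left_mono)
      ultimately have "(f0 + N) * (h ^ (?m + 2) * I 2) + A * (h ^ (?m + 3) * I 3) \<le> (I 2 + I 3) * ?X"
        by (simp add: algebra_simps)
      then show "E0 * a1 * ((f0 + N) * (h ^ (?m + 2) * I 2) + A * (h ^ (?m + 3) * I 3))
          \<le> E0 * a1 * ((I 2 + I 3) * ?X)"
        using E0 a1 by (intro mult_left_mono) auto
      have "f0 * h ^ (?m + 2) \<le> ?X"
        using f0 N A h by (simp add: distrib_right)
      then have "M2 * (f0 * h ^ (?m + 2)) \<le> M2 * ?X" using M2 by (rule mult_left_mono)
      then show "f0 * (h ^ (?m + 2) * M2) \<le> M2 * ?X" by (simp add: mult_ac)
    qed
    also have "\<dots> = E * ?X" by (simp add: E_def algebra_simps)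
    finally show "norm ((\<integral>u. ?T u \<partial>lborel) - (f0 * h ^ (?m + 1)) *\<^sub>R L (cone_moment (B ` Q)))
      \<le> E * ?X" .
  qed
qed

end

section \<open>Intrinsic distance to the boundary\<close>

lemma C1_curve_derivative:
  fixes \<gamma> :: "real \<Rightarrow> 'a::euclidean_space"
  assumes "Ck_on 1 \<gamma> {0..1}"
  shows "\<And>t. t \<in> {0..1} \<Longrightarrow> (\<gamma> has_vector_derivative vector_derivative \<gamma> (at t within {0..1})) (at t within {0..1})"
    and "continuous_on {0..1} (\<lambda>t. vector_derivative \<gamma> (at t within {0..1}))"
proof -
  let ?v = "\<lambda>t. vector_derivative \<gamma> (at t within {0..1})"
  have *: "(\<gamma> has_vector_derivative ?v t) (at t within {0..1}) \<and> continuous (at t within {0..1}) ?v"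
    if t: "t \<in> {0..1}" for t
  proof -
    obtain U F where U: "open U" "t \<in> U" and F: "\<forall>j. enat j \<le> 1 \<longrightarrow> Ck_open j F U"
      and eq: "\<forall>s\<in>U \<inter> {0..1}. F s = \<gamma> s"
      using Ck_on_extension[OF assms t] .
    have F1: "Ck_open (Suc 0) F U" using F[rule_format, of "Suc 0"] by (simp add: one_enat_def del: Ck_open.simps)
    let ?F' = "\<lambda>s. frechet_derivative F (at s)"
    have vs: "(\<gamma> has_vector_derivative ?F' s 1) (at s within {0..1}) \<and> ?v s = ?F' s 1"
      if s: "s \<in> U \<inter> {0..1}" for s
    proof -
      have dF: "(F has_derivative ?F' s) (at s)"
        using F1 by (rule Ck_open_differentiable) (use s in auto)
      have "?F' s = (\<lambda>h. h *\<^sub>R ?F' s 1)"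
      proof
        show "?F' s h = h *\<^sub>R ?F' s 1" for h
          using linear_scale[OF has_derivative_linear[OF dF], of h 1] unfolding real_scaleR_def mult_1_right .
      qed
      then have "(F has_derivative (\<lambda>h. h *\<^sub>R ?F' s 1)) (at s within U \<inter> {0..1})"
        by (rule subst[where P = "\<lambda>D. (F has_derivative D) (at s within U \<inter> {0..1})"])
           (rule has_derivative_at_withinI[OF dF])
      then have "(\<gamma> has_derivative (\<lambda>h. h *\<^sub>R ?F' s 1)) (at s within U \<inter> {0..1})"
        by (rule has_derivative_transform[OF s, rotated]) (use eq in simp)
      moreover have "at s within U \<inter> {0..1} = at s within {0..1}"
        by (rule at_within_nhd[of s U]) (use s U in auto)
      ultimately have d: "(\<gamma> has_vector_derivative ?F' s 1) (at s within {0..1})"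
        by (simp add: has_vector_derivative_def)
      then show ?thesis
        using vector_derivative_within_closed_interval[of 0 1 s \<gamma>] s by auto
    qed
    have tU: "t \<in> U \<inter> {0..1}" using t U(2) by simp
    have "continuous_on U (\<lambda>s. ?F' s 1)"
      using F1 unfolding Ck_open.simps(2)[of 0] Ck_open.simps(1) by blast
    then have "isCont (\<lambda>s. ?F' s 1) t"
      using U by (simp add: continuous_on_eq_continuous_at)
    then have c: "((\<lambda>s. ?F' s 1) \<longlongrightarrow> ?F' t 1) (at t within {0..1})"
      using continuous_at_imp_continuous_at_within continuous_within by blast
    have "\<forall>\<^sub>F s in at t within {0..1}. s \<in> U \<and> s \<in> {0..1}"
      using U unfolding eventually_at_topological by blast
    then have "\<forall>\<^sub>F s in at t within {0..1}. ?F' s 1 = ?v s"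
      by (rule eventually_mono) (use vs in auto)
    with c have "(?v \<longlongrightarrow> ?F' t 1) (at t within {0..1})"
      by (rule Lim_transform_eventually)
    then show ?thesis
      using vs[OF tU] by (simp add: continuous_within)
  qed
  then show "\<And>t. t \<in> {0..1} \<Longrightarrow> (\<gamma> has_vector_derivative ?v t) (at t within {0..1})" by blast
  show "continuous_on {0..1} ?v"
    using * by (simp add: continuous_on_eq_continuous_within)
qed

text \<open>A curve is at least as long as the segment between its end points. So a boundary point other
  than \<open>x\<close> has positive intrinsic distance from \<open>x\<close>.\<close>

lemma intrinsic_dist_ge_norm:
  fixes x y :: "'a::euclidean_space"
  shows "ereal (norm (x - y)) \<le> intrinsic_dist M x y"
  unfolding intrinsic_dist_def
proof (rule INF_greatest)
  fix \<gamma> :: "real \<Rightarrow> 'a"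
  assume "\<gamma> \<in> {\<gamma>. Ck_on 1 \<gamma> {0..1} \<and> \<gamma> ` {0..1} \<subseteq> M \<and> \<gamma> 0 = x \<and> \<gamma> 1 = y}"
  then have \<gamma>: "Ck_on 1 \<gamma> {0..1}" "\<gamma> 0 = x" "\<gamma> 1 = y" by auto
  let ?v = "\<lambda>t. vector_derivative \<gamma> (at t within {0..1})"
  have "(?v has_integral (\<gamma> 1 - \<gamma> 0)) {0..1}"
    by (rule fundamental_theorem_of_calculus[OF _ C1_curve_derivative(1)[OF \<gamma>(1)]]) auto
  moreover have "norm (integral {0..1} ?v) \<le> integral {0..1} (\<lambda>t. norm (?v t))"
    by (rule integral_norm_bound_integral)
       (use C1_curve_derivative(2)[OF \<gamma>(1)] in \<open>auto intro!: integrable_continuous_real continuous_intros\<close>)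
  ultimately show "ereal (norm (x - y)) \<le> ereal (curve_length \<gamma>)"
    using \<gamma> by (simp add: curve_length_def integral_unique norm_minus_commute)
qed

lemma intrinsic_dist_self:
  assumes "x \<in> M"
  shows "intrinsic_dist M x x = 0"
proof (rule antisym)
  let ?\<gamma> = "\<lambda>_::real. x"
  have "Ck_open j ?\<gamma> UNIV" if "enat j \<le> 1" for j
  proof -
    have "j = 0 \<or> j = Suc 0" using that by (auto simp: one_enat_def)
    then show ?thesis by auto
  qed
  then have C1: "Ck_on 1 ?\<gamma> {0..1}"
    unfolding Ck_on_def by (intro ballI exI[of _ UNIV] exI[of _ ?\<gamma>]) auto
  have "vector_derivative ?\<gamma> (at t within {0..1}) = 0" if "t \<in> {0..1}" for t
    using that by (intro vector_derivative_within_closed_interval) auto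
  then have "curve_length ?\<gamma> = integral {0..1} (\<lambda>t::real. 0::real)"
    unfolding curve_length_def by (intro integral_cong) simp
  then have "curve_length ?\<gamma> = 0" by simp
  then show "intrinsic_dist M x x \<le> 0"
    unfolding intrinsic_dist_def using C1 assms
    by (intro INF_lower2[of ?\<gamma>]) auto
  show "0 \<le> intrinsic_dist M x x"
    using intrinsic_dist_ge_norm[of x x M] by (simp add: zero_ereal_def)
qed

section \<open>Expectation of the estimator\<close>

text \<open>All samples have the same distribution, so by linearity the expectation is that of a single
  summand.\<close>

lemma iid_boundary_estimator:
  fixes X :: "nat \<Rightarrow> 'w \<Rightarrow> 'a::euclidean_space"
  assumes iid: "iid_samples P dV f N X" and N: "N \<ge> 1"
    and int: "integrable (density dV (\<lambda>y. ennreal (f y))) (\<lambda>y. K (norm (x - y) / h) *\<^sub>R (y - x))"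
  shows "integrable P (boundary_estimator TYPE('m::finite) K h N X x)"
    and "(\<integral>\<omega>. boundary_estimator TYPE('m) K h N X x \<omega> \<partial>P)
      = (1 / h ^ (CARD('m) + 1)) *\<^sub>R (\<integral>y. K (norm (x - y) / h) *\<^sub>R (y - x) \<partial>density dV (\<lambda>y. ennreal (f y)))"
proof -
  let ?k = "\<lambda>y. K (norm (x - y) / h) *\<^sub>R (y - x)" and ?\<mu> = "density dV (\<lambda>y. ennreal (f y))"
  have D: "distr P dV (X i) = ?\<mu>" "X i \<in> P \<rightarrow>\<^sub>M dV" if "i \<in> {1..N}" for i
    using iid that by (auto simp: iid_samples_def distributed_def)
  have km: "?k \<in> borel_measurable dV"
    using borel_measurable_integrable[OF int] by simp
  have intX: "integrable P (\<lambda>\<omega>. ?k (X i \<omega>))" and eqX: "(\<integral>\<omega>. ?k (X i \<omega>) \<partial>P) = (\<integral>y. ?k y \<partial>?\<mu>)"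
    if "i \<in> {1..N}" for i
    using integrable_distr_eq[OF D(2)[OF that] km] integral_distr[OF D(2)[OF that] km] int D(1)[OF that]
    by auto
  have est: "boundary_estimator TYPE('m) K h N X x
      = (\<lambda>\<omega>. (1 / (real N * h ^ (CARD('m) + 1))) *\<^sub>R (\<Sum>i=1..N. ?k (X i \<omega>)))"
    by (simp add: boundary_estimator_def fun_eq_iff)
  show "integrable P (boundary_estimator TYPE('m) K h N X x)"
    unfolding est by (intro integrable_scaleR_right Bochner_Integration.integrable_sum intX)
  have "(\<integral>\<omega>. boundary_estimator TYPE('m) K h N X x \<omega> \<partial>P)
      = (1 / (real N * h ^ (CARD('m) + 1))) *\<^sub>R (\<integral>\<omega>. (\<Sum>i=1..N. ?k (X i \<omega>)) \<partial>P)"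
    unfolding est by (rule integral_scaleR_right)
  also have "(\<integral>\<omega>. (\<Sum>i=1..N. ?k (X i \<omega>)) \<partial>P) = (\<Sum>i=1..N. (\<integral>\<omega>. ?k (X i \<omega>) \<partial>P))"
    by (rule Bochner_Integration.integral_sum) (rule intX)
  also have "\<dots> = (\<Sum>i=1..N. (\<integral>y. ?k y \<partial>?\<mu>))"
    by (rule sum.cong) (use eqX in auto)
  also have "\<dots> = real N *\<^sub>R (\<integral>y. ?k y \<partial>?\<mu>)"
    by (simp add: sum_constant_scaleR)
  finally show "(\<integral>\<omega>. boundary_estimator TYPE('m) K h N X x \<omega> \<partial>P)
      = (1 / h ^ (CARD('m) + 1)) *\<^sub>R (\<integral>y. ?k y \<partial>?\<mu>)"
    using N by simp
qed

context decaying_kernel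
begin

text \<open>Away from the centre the kernel is smaller than every power of \<open>h\<close>.\<close>

lemma kernel_tail_bound:
  assumes h: "h > 0" and t: "t > 0"
  shows "K (t / h) * t \<le> a1 * fact (p + 1) / a2 ^ (p + 1) * h ^ (p + 1) / t ^ p"
proof -
  have "K (t / h) * t \<le> a1 * exp (- a2 * (t / h)) * t"
    using h t by (intro mult_right_mono decay) auto
  also have "\<dots> = a1 * ((t / h) ^ (p + 1) * exp (- a2 * (t / h))) * h ^ (p + 1) / t ^ p"
    using h t by (simp add: power_divide)
  also have "\<dots> \<le> a1 * (fact (p + 1) / a2 ^ (p + 1)) * h ^ (p + 1) / t ^ p"
    using power_exp_bound[OF a2, of "t / h" "p + 1"] h t a1
    by (intro divide_right_mono mult_right_mono mult_left_mono) auto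
  finally show ?thesis by simp
qed

end

text \<open>The polynomial bound makes the density bounded on bounded sets; this extends the local Taylor
  estimate to a neighbourhood that does not depend on \<open>f\<close>.\<close>

lemma density_bounded_near:
  assumes "density_on_manifold M dV f" "bounded S" "S \<subseteq> M"
  obtains b where "b \<ge> 0" "\<And>y. y \<in> S \<Longrightarrow> \<bar>f y\<bar> \<le> b"
proof -
  obtain p where p: "real_polynomial_function p" "\<forall>y\<in>M. f y \<le> p y" and nn: "\<forall>y\<in>M. 0 \<le> f y"
    using assms(1) by (auto simp: density_on_manifold_def)
  have "continuous_on (closure S) p"
    using continuous_real_polymonial_function[OF p(1)] by (intro continuous_at_imp_continuous_on) auto
  then have "bounded (p ` closure S)"
    using assms(2) by (intro compact_imp_bounded compact_continuous_image) auto
  then obtain b where b: "\<And>y. y \<in> closure S \<Longrightarrow> \<bar>p y\<bar> \<le> b" "b > 0"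
    unfolding bounded_pos by auto
  show ?thesis
  proof (rule that[of b])
    show "\<bar>f y\<bar> \<le> b" if "y \<in> S" for y
      using b(1)[of y] p(2) nn that assms(3) closure_subset[of S] by (force simp: abs_le_iff)
  qed (use b in simp)
qed

text \<open>The Riemannian volume density of a chart, written with the derivative of a smooth extension, for
  which differentiability at the centre makes sense also at boundary points.\<close>

definition chart_density :: "(real^'m::finite \<Rightarrow> real^'m \<Rightarrow> 'a::euclidean_space) \<Rightarrow> real^'m \<Rightarrow> real" where
  "chart_density F' u = sqrt (det (\<chi> i j. F' u (axis i 1) \<bullet> F' u (axis j 1)))"

lemma chart_density_continuous:
  assumes "\<And>v. continuous_on S (\<lambda>u. F' u v)"
  shows "continuous_on S (chart_density F')"
  unfolding chart_density_def[abs_def]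
  by (intro continuous_on_real_sqrt continuous_on_det) (simp add: continuous_on_inner assms)

lemma chart_density_lipschitz_at:
  assumes diff: "\<And>v. (\<lambda>u. F' u v) differentiable (at u0)" and pos: "chart_density F' u0 > 0"
  shows "lipschitz_at (chart_density F') u0"
proof -
  let ?g = "\<lambda>u. \<chi> i j. F' u (axis i 1) \<bullet> F' u (axis j 1)"
  have "lipschitz_at (\<lambda>u. F' u v \<bullet> F' u w) u0" for v w
    by (intro differentiable_imp_lipschitz_at differentiable_inner diff)
  then have "lipschitz_at ?g u0"
    by (intro lipschitz_at_vec) simp
  then have "lipschitz_at (\<lambda>u. det (?g u)) u0"
    by (rule lipschitz_at_compose) (rule lipschitz_at_det)
  moreover have "lipschitz_at sqrt (det (?g u0))"
  proof (rule differentiable_imp_lipschitz_at)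
    have "det (?g u0) > 0" using pos by (simp add: chart_density_def)
    then show "sqrt differentiable (at (det (?g u0)))"
      unfolding real_differentiable_def using DERIV_real_sqrt by blast
  qed
  ultimately show ?thesis
    unfolding chart_density_def[abs_def] by (rule lipschitz_at_compose)
qed

lemma chart_density_eq_abs_det:
  assumes "\<And>v w. F' u v \<bullet> F' u w = B v \<bullet> B w"
  shows "chart_density F' u = \<bar>det (matrix B)\<bar>"
proof -
  have "(\<chi> i j. F' u (axis i 1) \<bullet> F' u (axis j 1)) = transpose (matrix B) ** matrix B"
    by (simp add: vec_eq_iff assms matrix_matrix_mult_def transpose_def matrix_def inner_vec_def)
  then show ?thesis
    by (simp add: chart_density_def det_mul power2_eq_square[symmetric])
qed

lemma gram_matrix_extension:
  assumes W: "openin (top_of_set (half_space k)) W" "u \<in> W" and eq: "\<And>w. w \<in> W \<Longrightarrow> \<phi> w = F w"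
    and der: "(F has_derivative F' u) (at u)"
  shows "sqrt (det (gram_matrix W \<phi> u)) = chart_density F' u"
proof -
  have d: "(\<phi> has_derivative F' u) (at u within W)"
    by (rule has_derivative_transform[OF W(2) eq has_derivative_at_withinI[OF der]])
  then have "(\<phi> has_derivative frechet_derivative \<phi> (at u within W)) (at u within W)"
    by (meson differentiableI frechet_derivative_works)
  then have "frechet_derivative \<phi> (at u within W) = F' u"
    using d by (rule has_derivative_unique_half_space[OF W])
  then show ?thesis by (simp add: gram_matrix_def chart_density_def)
qed

lemma openin_half_space_borel:
  assumes "openin (top_of_set (half_space k)) W"
  shows "W \<in> sets borel"
proof -
  have "closed (half_space k)"
    unfolding half_space_def by (intro closed_Collect_le continuous_intros)
  moreover obtain O1 where "open O1" "W = half_space k \<inter> O1"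
    using assms by (auto simp: openin_open)
  ultimately show ?thesis by auto
qed

context decaying_kernel
begin

lemma integrable_kernel_bounded:
  assumes \<mu>: "prob_space \<mu>" and h: "h > 0" and m: "(\<lambda>y::'a::euclidean_space. y) \<in> borel_measurable \<mu>"
  shows "integrable \<mu> (\<lambda>y. K (norm (x - y) / h) *\<^sub>R (y - x))"
proof -
  interpret prob_space \<mu> by fact
  have bound: "norm (K (norm (x - y) / h) *\<^sub>R (y - x)) \<le> a1 / a2 * h" for y
  proof (cases "y = x")
    case True
    then show ?thesis using a1 a2 h by simp
  next
    case False
    then have "K (norm (x - y) / h) * norm (x - y) \<le> a1 / a2 * h"
      using kernel_tail_bound[OF h, of "norm (x - y)" 0] by simp
    then show ?thesis
      using kernel_nonneg[of "norm (x - y) / h"] h by (simp add: norm_minus_commute)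
  qed
  have "(\<lambda>y. K (norm (x - y) / h)) \<in> borel_measurable \<mu>"
    using m by (intro measurable_kernel_scaled[OF h]) measurable
  then have meas: "(\<lambda>y. K (norm (x - y) / h) *\<^sub>R (y - x)) \<in> borel_measurable \<mu>"
    using m by measurable
  show ?thesis
    by (rule integrable_const_bound[where B = "a1 / a2 * h"]) (use bound meas in auto)
qed

text \<open>The integral is split at distance \<open>\<delta>\<close> from \<open>x\<close>. The outer part
  is bounded by the tail of the kernel, and the inner part is pulled back to the chart. The cone
  \<open>Q\<close> is the chart domain seen from \<open>u0\<close>: a half space or everything.\<close>

lemma chart_moment_expansion:
  fixes M :: "'a::euclidean_space set" and \<phi> :: "real^'m::finite \<Rightarrow> 'a" and L :: "real^'m \<Rightarrow> 'a"
  assumes vol: "volume_measure TYPE('m) M dV"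
    and lp: "local_param M k W \<phi>" "u0 \<in> W" "(\<phi> has_derivative D) (at u0 within W)"
    and \<rho>: "\<rho> > 0" "\<And>u. u \<in> ball u0 \<rho> \<Longrightarrow> u \<in> half_space k \<longleftrightarrow> u - u0 \<in> Q"
    and Q: "\<And>v t. v \<in> Q \<Longrightarrow> t \<ge> 0 \<Longrightarrow> t *\<^sub>R v \<in> Q" "0 \<in> Q"
    and L: "linear L" "\<And>z. norm (L z) = norm z" and B: "linear B" "\<And>v. D v = L (B v)"
    and BQ: "B ` Q \<in> sets borel"
  obtains C where "C \<ge> 0" "\<And>f. density_on_manifold M dV f \<Longrightarrow>
     \<exists>A\<ge>0. \<forall>h>0. integrable (density dV (\<lambda>y. ennreal (f y))) (\<lambda>y. K (norm (\<phi> u0 - y) / h) *\<^sub>R (y - \<phi> u0)) \<and>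
       norm ((1 / h ^ (CARD('m) + 1)) *\<^sub>R kernel_mean (density dV (\<lambda>y. ennreal (f y))) (\<phi> u0) h
           - f (\<phi> u0) *\<^sub>R L (cone_moment (B ` Q)))
       \<le> C * (h * norm (manifold_gradient TYPE('m) M f (\<phi> u0)) + h * f (\<phi> u0)) + A * h\<^sup>2"
proof -
  let ?x = "\<phi> u0"
  have W: "openin (top_of_set (half_space k)) W" using lp(1) by (simp add: local_param_def)
  have sdV: "sets dV = sets (restrict_space borel M)" using vol by (simp add: volume_measure_def)
  have spdV: "space dV = M" using sets_eq_imp_space_eq[OF sdV] by (simp add: space_restrict_space)
  obtain F r1 C c where rc: "regular_chart F (\<lambda>u. frechet_derivative F (at u)) u0 r1 C c"
    and W1: "half_space k \<inter> ball u0 r1 \<subseteq> W" and \<phi>F: "\<And>u. u \<in> half_space k \<inter> ball u0 r1 \<Longrightarrow> \<phi> u = F u"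
    and D': "(\<phi> has_derivative frechet_derivative F (at u0)) (at u0 within W)"
    and diff: "\<And>v. (\<lambda>u. frechet_derivative F (at u) v) differentiable (at u0)"
    by (rule local_param_regular_chart[OF lp(1,2)])
       (rule that, assumption, assumption, simp, assumption, simp)
  define F' where "F' u = frechet_derivative F (at u)" for u
  have D: "F' u0 = D"
    unfolding F'_def by (rule has_derivative_unique_half_space[OF W lp(2) D' lp(3)])
  have "(\<lambda>u. frechet_derivative F (at u)) = F'" by (rule ext) (simp only: F'_def)
  then have rc: "regular_chart F F' u0 r1 C c" using rc by (simp only:)
  interpret R1: regular_chart F F' u0 r1 C c by (rule rc)
  interpret R1: straightened_chart F F' u0 r1 C c L B
    by (intro straightened_chart.intro[OF rc] straightened_chart_axioms.intro)
       (simp_all add: L B D)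
  have inner: "F' u0 v \<bullet> F' u0 w = B v \<bullet> B w" for v w
    by (simp add: R1.LB R1.inner_L)
  have J0: "chart_density F' u0 = \<bar>det (matrix B)\<bar>"
    by (rule chart_density_eq_abs_det) (rule inner)
  have "inj B"
    using R1.B_eq_0_iff B(1) by (simp add: linear_injective_0)
  then have J0pos: "chart_density F' u0 > 0"
    using det_nz_iff_inj[OF B(1)] by (simp add: J0)
  have lipJ: "lipschitz_at (chart_density F') u0"
    using diff J0pos by (intro chart_density_lipschitz_at) (simp_all add: F'_def)
  obtain AJ where AJ: "AJ \<ge> 0" "\<forall>\<^sub>F u in nhds u0. norm (chart_density F' u - chart_density F' u0) \<le> AJ * norm (u - u0)"
    using lipJ unfolding lipschitz_at_def by (elim exE conjE)
  have Jpos: "\<forall>\<^sub>F u in nhds u0. chart_density F' u > 0"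
    by (rule order_tendstoD(1)[OF lipschitz_at_tendsto[OF lipJ] J0pos])
  obtain AG where AG: "AG \<ge> 0"
    "\<forall>\<^sub>F u in nhds u0. u \<noteq> u0 \<longrightarrow> \<bar>\<bar>det (matrix (R1.G' u))\<bar> - \<bar>det (matrix B)\<bar>\<bar> \<le> AG * norm (u - u0)"
    using R1.det_G'_lipschitz by blast
  have "\<forall>\<^sub>F u in nhds u0. norm (chart_density F' u - chart_density F' u0) \<le> AJ * norm (u - u0)
      \<and> chart_density F' u > 0
      \<and> (u \<noteq> u0 \<longrightarrow> \<bar>\<bar>det (matrix (R1.G' u))\<bar> - \<bar>det (matrix B)\<bar>\<bar> \<le> AG * norm (u - u0))"
    by (intro eventually_conj AJ(2) Jpos AG(2))
  then obtain r2 where r2: "r2 > 0" "\<forall>u. dist u u0 < r2 \<longrightarrow>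
      norm (chart_density F' u - chart_density F' u0) \<le> AJ * norm (u - u0)
      \<and> chart_density F' u > 0
      \<and> (u \<noteq> u0 \<longrightarrow> \<bar>\<bar>det (matrix (R1.G' u))\<bar> - \<bar>det (matrix B)\<bar>\<bar> \<le> AG * norm (u - u0))"
    unfolding eventually_nhds_metric by (elim exE conjE)
  \<comment> \<open>one radius for the chart estimates, the Jacobian estimates and the cone shape of the domain\<close>
  define r where "r = min (min r1 r2) \<rho>"
  have r: "r > 0" "r \<le> r1" "r \<le> r2" "r \<le> \<rho>" using R1.r r2(1) \<rho>(1) by (auto simp: r_def)
  interpret R: regular_chart F F' u0 r C c
    by (rule regular_chart_shrink[OF rc r(1,2)])
  interpret R: kernel_chart F F' u0 r C c L B K a1 a2
    by (intro kernel_chart.intro straightened_chart.intro straightened_chart_axioms.intro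
        R.regular_chart_axioms decaying_kernel_axioms) (simp_all add: L B D)
  define W0 where "W0 = half_space k \<inter> ball u0 r"
  have W0Q: "u \<in> W0 \<longleftrightarrow> u \<in> ball u0 r \<and> u - u0 \<in> Q" for u
    using \<rho>(2)[of u] r(4) by (auto simp: W0_def)
  have W0W: "W0 \<subseteq> W" using W1 r(2) by (auto simp: W0_def)
  have W0o: "openin (top_of_set (half_space k)) W0"
    unfolding W0_def by (intro openin_open_Int) simp
  have lp0: "local_param M k W0 \<phi>" by (rule local_param_subset[OF lp(1) W0o W0W])
  have u0W: "u0 \<in> W0" using Q(2) r(1) by (simp add: W0Q)
  have \<phi>F0: "\<phi> u = F u" if "u \<in> W0" for u
    using \<phi>F[of u] that r(2) by (auto simp: W0_def)
  have xF: "F u0 = ?x" using \<phi>F0[OF u0W] by simp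
  have D0: "(\<phi> has_derivative D) (at u0 within W0)"
    using lp(3) W0W by (rule has_derivative_subset)
  obtain O1 where O1: "open O1" "\<phi> ` W0 = M \<inter> O1"
    using lp0 by (auto simp: local_param_def openin_open)
  have xM: "?x \<in> M" "?x \<in> O1" using O1(2) u0W by auto
  obtain \<delta>1 where \<delta>1: "\<delta>1 > 0" "ball ?x \<delta>1 \<subseteq> O1"
    using O1(1) xM(2) by (auto simp: open_contains_ball)
  \<comment> \<open>within this distance of the centre the manifold lies in the chart, and the straightened image is a full truncated cone\<close>
  define \<delta> where "\<delta> = min \<delta>1 (c * r / 4)"
  have \<delta>: "0 < \<delta>" "\<delta> \<le> c * r / 4" "\<delta> \<le> \<delta>1" using \<delta>1 R.c r(1) by (auto simp: \<delta>_def)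
  define N where "N = M \<inter> ball ?x \<delta>"
  define S where "S = {u \<in> ball u0 r. u - u0 \<in> Q \<and> norm (F u - F u0) < \<delta>}"
  have SW: "S \<subseteq> W0" by (auto simp: S_def W0Q)
  have NW: "N \<subseteq> \<phi> ` W0" using O1(2) \<delta>1(2) \<delta>(3) by (auto simp: N_def)
  have "N \<in> sets (restrict_space borel M)"
    by (auto simp: N_def sets_restrict_space)
  then have N: "N \<in> sets dV" using sdV by simp
  have W0M: "\<phi> ` W0 \<subseteq> M" using O1(2) by auto
  have S_eq: "S = W0 \<inter> \<phi> -` N"
  proof (intro set_eqI)
    fix u
    have "u \<in> W0 \<Longrightarrow> u \<in> \<phi> -` N \<longleftrightarrow> norm (F u - F u0) < \<delta>"
      using W0M \<phi>F0[of u] xF by (auto simp: N_def dist_norm norm_minus_commute)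
    then show "u \<in> S \<longleftrightarrow> u \<in> W0 \<inter> \<phi> -` N"
      using W0Q[of u] by (auto simp: S_def)
  qed
  have "S = W0 \<inter> \<phi> -` ball ?x \<delta>"
    unfolding S_eq using W0M by (auto simp: N_def)
  then have Sb: "S \<in> sets borel"
    using local_param_preimage(1)[OF lp0 u0W open_ball, of ?x \<delta>] \<delta>(1) by (simp add: openin_half_space_borel)
  define J where "J = chart_density F'"
  have near: "norm (J u - J u0) \<le> AJ * norm (u - u0)" "J u > 0"
    "u \<noteq> u0 \<Longrightarrow> \<bar>\<bar>det (matrix (R1.G' u))\<bar> - \<bar>det (matrix B)\<bar>\<bar> \<le> AG * norm (u - u0)" if "u \<in> ball u0 r" for u
  proof -
    have "dist u u0 < r2" using that r(3) by (simp add: dist_commute)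
    then show "norm (J u - J u0) \<le> AJ * norm (u - u0)" "J u > 0"
      "u \<noteq> u0 \<Longrightarrow> \<bar>\<bar>det (matrix (R1.G' u))\<bar> - \<bar>det (matrix B)\<bar>\<bar> \<le> AG * norm (u - u0)"
      using r2(2) unfolding J_def by blast+
  qed
  have Sball: "u \<in> ball u0 r" if "u \<in> S" for u using that by (simp add: S_def)
  have J1: "\<bar>J u\<bar> \<le> J u0 + AJ * r" if "u \<in> S" for u
  proof -
    have "AJ * norm (u - u0) \<le> AJ * r"
      using Sball[OF that] AJ(1) by (intro mult_left_mono) (auto simp: dist_norm norm_minus_commute)
    then show ?thesis using near(1,2)[OF Sball[OF that]] by auto
  qed
  have J2: "\<bar>J u - \<bar>det (matrix (R.G' u))\<bar>\<bar> \<le> (AJ + AG) * norm (u - u0)" if "u \<in> S" "u \<noteq> u0" for u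
    using near(1,3)[OF Sball[OF that(1)]] that(2) J0 by (simp add: J_def distrib_right)
  have AA: "AJ + AG \<ge> 0" using AJ AG by simp
  obtain E where E: "E \<ge> 0" and exp: "\<And>f f0 N A h. f0 \<ge> 0 \<Longrightarrow> N \<ge> 0 \<Longrightarrow> A \<ge> 0 \<Longrightarrow> h > 0 \<Longrightarrow>
      (\<And>u. u \<in> S \<Longrightarrow> \<bar>f u - f0\<bar> \<le> N * norm (u - u0) + A * (norm (u - u0))\<^sup>2) \<Longrightarrow>
      (\<lambda>u. indicator S u *\<^sub>R ((J u * f u * K (norm (F u - F u0) / h)) *\<^sub>R (F u - F u0))) \<in> borel_measurable borel \<Longrightarrow>
      norm ((\<integral>u. indicator S u *\<^sub>R ((J u * f u * K (norm (F u - F u0) / h)) *\<^sub>R (F u - F u0)) \<partial>lborel)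
        - (f0 * h ^ (CARD('m) + 1)) *\<^sub>R L (cone_moment (B ` Q)))
      \<le> E * ((f0 + N) * h ^ (CARD('m) + 2) + A * h ^ (CARD('m) + 3))"
    by (rule R.kernel_chart_integral_expansion[OF Q BQ \<delta>(1,2) S_def Sb AA J1 J2]) blast+
  have blD: "bounded_linear D" using lp(3) by (rule has_derivative_bounded_linear)
  have oD: "onorm D \<ge> 0" by (rule onorm_pos_le[OF blD])
  show ?thesis
  proof (rule that[of "E * (1 + onorm D)"])
    show "0 \<le> E * (1 + onorm D)" using E oD by simp
    fix f assume f: "density_on_manifold M dV f"
    let ?grad = "manifold_gradient TYPE('m) M f ?x"
    have fC: "Ck_on 4 f M" and fnn: "\<And>y. y \<in> M \<Longrightarrow> 0 \<le> f y" and prob: "prob_space (density dV (\<lambda>y. ennreal (f y)))"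
      using f by (auto simp: density_on_manifold_def)
    have "\<forall>\<^sub>F u in nhds u0. u \<in> ball u0 r" using r(1) by (intro eventually_nhds_in_open) auto
    then have tay: "\<forall>\<^sub>F u in nhds u0. u \<in> W0 \<longrightarrow> norm (\<phi> u - \<phi> u0 - D (u - u0)) \<le> C * (norm (u - u0))\<^sup>2"
      using R.taylor \<phi>F0 xF D by (auto elim!: eventually_mono)
    obtain A where A: "A \<ge> 0" and ev: "\<forall>\<^sub>F u in nhds u0. u \<in> W0 \<longrightarrow> \<bar>f (\<phi> u) - f ?x\<bar>
       \<le> onorm D * norm ?grad * norm (u - u0) + A * (norm (u - u0))\<^sup>2"
      using density_expansion_along_chart[OF lp0 u0W D0 fC tay] .
    obtain d where d: "d > 0" and dA: "\<forall>u. dist u u0 < d \<longrightarrow> u \<in> W0 \<longrightarrow> \<bar>f (\<phi> u) - f ?x\<bar>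
       \<le> onorm D * norm ?grad * norm (u - u0) + A * (norm (u - u0))\<^sup>2"
      using ev unfolding eventually_nhds_metric by (elim exE conjE)
    have "bounded N" unfolding N_def by (rule bounded_subset[OF bounded_ball]) auto
    then obtain b where b: "b \<ge> 0" "\<And>y. y \<in> N \<Longrightarrow> \<bar>f y\<bar> \<le> b"
      using density_bounded_near[OF f] by (metis N_def Int_lower1)
    \<comment> \<open>at distance at least d from the centre the bound 2 b is absorbed into the quadratic term\<close>
    define A' where "A' = A + 2 * b / d\<^sup>2"
    have A': "A' \<ge> 0" using A b d by (simp add: A'_def)
    have xN: "?x \<in> N" using xM(1) \<delta>(1) by (simp add: N_def)
    have fS: "\<bar>f (\<phi> u) - f ?x\<bar> \<le> onorm D * norm ?grad * norm (u - u0) + A' * (norm (u - u0))\<^sup>2" if u: "u \<in> S" for u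
    proof (cases "dist u u0 < d")
      case True
      have "A * (norm (u - u0))\<^sup>2 \<le> A' * (norm (u - u0))\<^sup>2"
        using b d by (intro mult_right_mono) (auto simp: A'_def)
      then show ?thesis using dA True u SW by fastforce
    next
      case False
      have "\<phi> u \<in> N" using u S_eq by simp
      then have "\<bar>f (\<phi> u) - f ?x\<bar> \<le> 2 * b" using b(2)[of "\<phi> u"] b(2)[OF xN] by linarith
      also have "\<dots> = 2 * b / d\<^sup>2 * d\<^sup>2" using d by simp
      also have "\<dots> \<le> A' * (norm (u - u0))\<^sup>2"
        using False d b A A' by (intro mult_mono power_mono) (auto simp: A'_def dist_norm)
      also have "\<dots> \<le> onorm D * norm ?grad * norm (u - u0) + A' * (norm (u - u0))\<^sup>2"
        using oD by simp
      finally show ?thesis .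
    qed
    define T where "T = a1 * fact (CARD('m) + 2 + 1) / a2 ^ (CARD('m) + 2 + 1) / \<delta> ^ (CARD('m) + 2)"
    have T: "T \<ge> 0" using a1 a2 \<delta>(1) by (simp add: T_def)
    show "\<exists>A\<ge>0. \<forall>h>0. integrable (density dV (\<lambda>y. ennreal (f y))) (\<lambda>y. K (norm (?x - y) / h) *\<^sub>R (y - ?x)) \<and>
       norm ((1 / h ^ (CARD('m) + 1)) *\<^sub>R kernel_mean (density dV (\<lambda>y. ennreal (f y))) ?x h
           - f ?x *\<^sub>R L (cone_moment (B ` Q)))
       \<le> E * (1 + onorm D) * (h * norm ?grad + h * f ?x) + A * h\<^sup>2"
    proof (intro exI[of _ "E * A' + T"] conjI allI impI)
      show "0 \<le> E * A' + T" using E A' T by simp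
      fix h :: real assume h: "h > 0"
      let ?\<mu> = "density dV (\<lambda>y. ennreal (f y))" and ?k = "\<lambda>y. K (norm (?x - y) / h) *\<^sub>R (y - ?x)" and ?m = "CARD('m)"
      let ?I = "L (cone_moment (B ` Q))"
      interpret P: prob_space ?\<mu> by (rule prob)
      have "(\<lambda>y. y) \<in> borel_measurable (restrict_space borel M)"
        by (rule measurable_restrict_space1) simp
      then have idm: "(\<lambda>y. y) \<in> borel_measurable dV"
        using measurable_cong_sets[OF sdV refl] by blast
      show int: "integrable ?\<mu> ?k"
        by (rule integrable_kernel_bounded[OF prob h]) (use idm in simp)
      have km [measurable]: "?k \<in> borel_measurable dV"
        using borel_measurable_integrable[OF int] by simp
      have "f \<in> borel_measurable (restrict_space borel M)"
        using Ck_on_imp_continuous_on[OF fC] by (rule borel_measurable_continuous_on_restrict)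
      then have fm [measurable]: "f \<in> borel_measurable dV"
        using measurable_cong_sets[OF sdV refl] by blast
      have Nm [measurable]: "N \<in> sets dV" by (rule N)
      have i1: "integrable ?\<mu> (\<lambda>y. indicator N y *\<^sub>R ?k y)" and i2: "integrable ?\<mu> (\<lambda>y. indicator (M - N) y *\<^sub>R ?k y)"
      proof -
        have MN: "M - N \<in> sets dV" using N spdV by (metis sets.compl_sets)
        show "integrable ?\<mu> (\<lambda>y. indicator N y *\<^sub>R ?k y)"
          by (rule integrable_mult_indicator[OF _ int]) (use N in simp)
        show "integrable ?\<mu> (\<lambda>y. indicator (M - N) y *\<^sub>R ?k y)"
          by (rule integrable_mult_indicator[OF _ int]) (use MN in simp)
      qed
      have "(\<integral>y. ?k y \<partial>?\<mu>) = (\<integral>y. indicator N y *\<^sub>R ?k y + indicator (M - N) y *\<^sub>R ?k y \<partial>?\<mu>)"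
        by (rule Bochner_Integration.integral_cong) (auto simp: spdV indicator_def)
      also have "\<dots> = (\<integral>y. indicator N y *\<^sub>R ?k y \<partial>?\<mu>) + (\<integral>y. indicator (M - N) y *\<^sub>R ?k y \<partial>?\<mu>)"
        by (rule Bochner_Integration.integral_add[OF i1 i2])
      finally have split: "(\<integral>y. ?k y \<partial>?\<mu>) = (\<integral>y. indicator N y *\<^sub>R ?k y \<partial>?\<mu>) + (\<integral>y. indicator (M - N) y *\<^sub>R ?k y \<partial>?\<mu>)" .
      have tail: "norm (\<integral>y. indicator (M - N) y *\<^sub>R ?k y \<partial>?\<mu>) \<le> T * h ^ (?m + 3)"
      proof -
        have pt: "norm (indicator (M - N) y *\<^sub>R ?k y) \<le> T * h ^ (?m + 3)" for y
        proof (cases "y \<in> M - N")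
          case False
          then show ?thesis using T h by simp
        next
          case True
          then have y: "norm (?x - y) \<ge> \<delta>" by (auto simp: N_def dist_norm)
          then have pos: "norm (?x - y) > 0" using \<delta>(1) by linarith
          from kernel_tail_bound[OF h pos, of "?m + 2"]
          have "K (norm (?x - y) / h) * norm (?x - y)
              \<le> a1 * fact (?m + 2 + 1) / a2 ^ (?m + 2 + 1) * h ^ (?m + 2 + 1) / norm (?x - y) ^ (?m + 2)" .
          also have "\<dots> \<le> a1 * fact (?m + 2 + 1) / a2 ^ (?m + 2 + 1) * h ^ (?m + 2 + 1) / \<delta> ^ (?m + 2)"
          proof (rule divide_left_mono)
            show "\<delta> ^ (?m + 2) \<le> norm (?x - y) ^ (?m + 2)"
              using y \<delta>(1) by (intro power_mono) auto
            show "0 \<le> a1 * fact (?m + 2 + 1) / a2 ^ (?m + 2 + 1) * h ^ (?m + 2 + 1)"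
              using a1 a2 h by simp
            show "0 < norm (?x - y) ^ (?m + 2) * \<delta> ^ (?m + 2)"
              by (intro mult_pos_pos zero_less_power pos \<delta>(1))
          qed
          also have "\<dots> = T * h ^ (?m + 3)" by (simp add: T_def power_add power3_eq_cube)
          finally show ?thesis
            using True kernel_nonneg[of "norm (?x - y) / h"] h by (simp add: norm_minus_commute)
        qed
        have "norm (\<integral>y. indicator (M - N) y *\<^sub>R ?k y \<partial>?\<mu>) \<le> (\<integral>y. T * h ^ (?m + 3) \<partial>?\<mu>)"
          by (rule Bochner_Integration.integral_norm_bound_integral[OF i2]) (use pt in auto)
        also have "\<dots> = T * h ^ (?m + 3)" using P.prob_space by simp
        finally show ?thesis .
      qed
      let ?G = "\<lambda>y. f y *\<^sub>R ?k y"
      have Gm: "?G \<in> borel_measurable dV" by measurable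
      have "(\<integral>y. indicator N y *\<^sub>R ?k y \<partial>?\<mu>) = (\<integral>y. f y *\<^sub>R (indicator N y *\<^sub>R ?k y) \<partial>dV)"
      proof (rule integral_density)
        show "(\<lambda>y. indicator N y *\<^sub>R ?k y) \<in> borel_measurable dV"
          by (intro borel_measurable_scaleR borel_measurable_indicator N km)
        show "f \<in> borel_measurable dV" by (rule fm)
        show "AE y in dV. 0 \<le> f y" using fnn spdV by (intro AE_I2) simp
      qed
      also have "\<dots> = (\<integral>y. indicator N y *\<^sub>R ?G y \<partial>dV)"
        by (intro Bochner_Integration.integral_cong) (auto simp: indicator_def)
      finally have dens: "(\<integral>y. indicator N y *\<^sub>R ?k y \<partial>?\<mu>) = (\<integral>y. indicator N y *\<^sub>R ?G y \<partial>dV)" .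
      have Jc: "continuous_on W0 J"
        unfolding J_def by (intro chart_density_continuous continuous_on_subset[OF R.derivative_continuous]) (auto simp: W0_def)
      have Jg: "J u = sqrt (det (gram_matrix W0 \<phi> u))" if "u \<in> W0" for u
        unfolding J_def using that R.derivative
        by (intro gram_matrix_extension[OF W0o _ \<phi>F0, symmetric]) (auto simp: W0_def)
      have Jnn: "J u \<ge> 0" if "u \<in> W0" for u
        using near(2)[of u] that by (auto simp: W0_def)
      note vc = volume_measure_chart_integral[OF vol lp0 N NW Gm Jc Jg Jnn, folded S_eq]
      have eqS: "(\<lambda>u. indicator S u *\<^sub>R (J u *\<^sub>R ?G (\<phi> u)))
          = (\<lambda>u. indicator S u *\<^sub>R ((J u * f (\<phi> u) * K (norm (F u - F u0) / h)) *\<^sub>R (F u - F u0)))"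
      proof
        fix u
        show "indicator S u *\<^sub>R (J u *\<^sub>R ?G (\<phi> u))
          = indicator S u *\<^sub>R ((J u * f (\<phi> u) * K (norm (F u - F u0) / h)) *\<^sub>R (F u - F u0))"
        proof (cases "u \<in> S")
          case True
          then have "\<phi> u = F u" using SW \<phi>F0 by blast
          then show ?thesis by (simp add: xF norm_minus_commute mult_ac)
        qed simp
      qed
      have "(\<integral>y. indicator N y *\<^sub>R ?G y \<partial>dV) = (\<integral>u. indicator S u *\<^sub>R (J u *\<^sub>R ?G (\<phi> u)) \<partial>lborel)"
        by (rule vc(1))
      also have "\<dots> = (\<integral>u. indicator S u *\<^sub>R ((J u * f (\<phi> u) * K (norm (F u - F u0) / h)) *\<^sub>R (F u - F u0)) \<partial>lborel)"
        by (rule arg_cong[OF eqS])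
      finally have pull: "(\<integral>y. indicator N y *\<^sub>R ?G y \<partial>dV)
          = (\<integral>u. indicator S u *\<^sub>R ((J u * f (\<phi> u) * K (norm (F u - F u0) / h)) *\<^sub>R (F u - F u0)) \<partial>lborel)" .
      have ms: "(\<lambda>u. indicator S u *\<^sub>R ((J u * f (\<phi> u) * K (norm (F u - F u0) / h)) *\<^sub>R (F u - F u0))) \<in> borel_measurable borel"
        using vc(2) by (simp only: eqS)
      have loc: "norm ((\<integral>y. indicator N y *\<^sub>R ?k y \<partial>?\<mu>) - (f ?x * h ^ (?m + 1)) *\<^sub>R ?I)
          \<le> E * ((f ?x + onorm D * norm ?grad) * h ^ (?m + 2) + A' * h ^ (?m + 3))"
        unfolding dens pull
        by (rule exp[OF fnn[OF xM(1)] _ A' h fS ms]) (use oD in auto)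
      have hp: "h ^ (?m + 1) > 0" using h by simp
      have "(1 / h ^ (?m + 1)) *\<^sub>R (\<integral>y. ?k y \<partial>?\<mu>) - f ?x *\<^sub>R ?I
          = (1 / h ^ (?m + 1)) *\<^sub>R (((\<integral>y. indicator N y *\<^sub>R ?k y \<partial>?\<mu>) - (f ?x * h ^ (?m + 1)) *\<^sub>R ?I)
              + (\<integral>y. indicator (M - N) y *\<^sub>R ?k y \<partial>?\<mu>))"
        unfolding split using h by (simp add: scaleR_add_right scaleR_diff_right)
      then have "norm ((1 / h ^ (?m + 1)) *\<^sub>R (\<integral>y. ?k y \<partial>?\<mu>) - f ?x *\<^sub>R ?I)
          = (1 / h ^ (?m + 1)) * norm (((\<integral>y. indicator N y *\<^sub>R ?k y \<partial>?\<mu>) - (f ?x * h ^ (?m + 1)) *\<^sub>R ?I)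
              + (\<integral>y. indicator (M - N) y *\<^sub>R ?k y \<partial>?\<mu>))"
        using hp by simp
      also have "\<dots> \<le> (1 / h ^ (?m + 1)) * (E * ((f ?x + onorm D * norm ?grad) * h ^ (?m + 2) + A' * h ^ (?m + 3)) + T * h ^ (?m + 3))"
        using hp by (intro mult_left_mono norm_triangle_mono loc tail) auto
      also have "\<dots> = E * ((f ?x + onorm D * norm ?grad) * h + A' * h\<^sup>2) + T * h\<^sup>2"
      proof -
        have "h ^ (?m + 2) = h ^ (?m + 1) * h" "h ^ (?m + 3) = h ^ (?m + 1) * h\<^sup>2"
          by (simp_all add: power_add power2_eq_square power3_eq_cube)
        moreover have "(1 / p) * (E * (q * (p * h) + A' * (p * s)) + T * (p * s)) = E * (q * h + A' * s) + T * s"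
          if "p > 0" for p q s :: real
          using that by (simp add: field_simps)
        ultimately show ?thesis using hp by presburger
      qed
      also have "\<dots> \<le> E * (1 + onorm D) * (h * norm ?grad + h * f ?x) + (E * A' + T) * h\<^sup>2"
      proof -
        have "(f ?x + onorm D * norm ?grad) * h \<le> (1 + onorm D) * (h * norm ?grad + h * f ?x)"
          using fnn[OF xM(1)] oD h by (simp add: algebra_simps)
        then have "E * ((f ?x + onorm D * norm ?grad) * h) \<le> E * ((1 + onorm D) * (h * norm ?grad + h * f ?x))"
          using E by (rule mult_left_mono)
        then show ?thesis by (simp add: algebra_simps)
      qed
      finally show "norm ((1 / h ^ (?m + 1)) *\<^sub>R (\<integral>y. ?k y \<partial>?\<mu>) - f ?x *\<^sub>R ?I)
          \<le> E * (1 + onorm D) * (h * norm ?grad + h * f ?x) + (E * A' + T) * h\<^sup>2" .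
    qed
  qed
qed

end

lemma boundary_dist_boundary_point:
  fixes M :: "'a::euclidean_space set"
  assumes "x \<in> manifold_boundary TYPE('m::finite) M" "x \<in> M"
  shows "boundary_dist TYPE('m) M x = 0"
proof (rule antisym)
  show "boundary_dist TYPE('m) M x \<le> 0"
    unfolding boundary_dist_def using assms by (intro INF_lower2[of x]) (simp_all add: intrinsic_dist_self)
  show "0 \<le> boundary_dist TYPE('m) M x"
    unfolding boundary_dist_def
  proof (rule INF_greatest)
    show "0 \<le> intrinsic_dist M x y" for y
      using intrinsic_dist_ge_norm[of x y M] by (rule order_trans[rotated]) simp
  qed
qed

lemma boundary_dist_interior_point:
  fixes M :: "'a::euclidean_space set"
  assumes dir: "boundary_direction TYPE('m::finite) M x \<eta>" and x: "x \<notin> manifold_boundary TYPE('m) M"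
  obtains b where "b > 0" "boundary_dist TYPE('m) M x = ereal b"
proof -
  obtain xs where fin: "boundary_dist TYPE('m) M x < \<infinity>" and xs: "xs \<in> manifold_boundary TYPE('m) M"
    and eq: "intrinsic_dist M x xs = boundary_dist TYPE('m) M x"
    using dir by (auto simp: boundary_direction_def)
  have "x \<noteq> xs" using x xs by auto
  then have "0 < ereal (norm (x - xs))" by simp
  also have "\<dots> \<le> boundary_dist TYPE('m) M x"
    using intrinsic_dist_ge_norm[of x xs M] by (simp add: eq)
  finally have "0 < boundary_dist TYPE('m) M x" .
  with fin show ?thesis
    by (cases "boundary_dist TYPE('m) M x") (auto intro: that)
qed

context decaying_kernel
begin

text \<open>\<open>B\<close> is the derivative followed by the adjoint of the isometry \<open>L\<close>,
  which inverts \<open>L\<close> on the tangent space.\<close>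

lemma tangent_coordinates:
  fixes M :: "'a::euclidean_space set" and \<phi> :: "real^'m::finite \<Rightarrow> 'a"
  assumes lp: "local_param M k W \<phi>" "u0 \<in> W" "(\<phi> has_derivative D) (at u0 within W)"
    and \<eta>: "\<eta> \<in> range D" "norm \<eta> = 1" and b: "boundary_dist TYPE('m) M (\<phi> u0) = ereal b"
  obtains L :: "real^'m \<Rightarrow> 'a" and B :: "real^'m \<Rightarrow> real^'m" and e where
    "linear L" "\<forall>z. norm (L z) = norm z" "linear B" "\<forall>v. D v = L (B v)" "surj B" "e \<in> Basis" "L e = \<eta>"
    "\<forall>h. m1_boundary TYPE('m) M K (\<phi> u0) \<eta> h
       = - (half_space_flux e (b / h))"
proof -
  let ?T = "tangent_space TYPE('m) M (\<phi> u0)"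
  have T: "?T = range D" by (rule tangent_space_eq_range[OF lp])
  have linD: "linear D" using lp(3) by (rule has_derivative_linear)
  obtain c where c: "c > 0" "\<And>v. c * norm v \<le> norm (D v)"
    using local_param_derivative_bounded_below[OF lp] by blast
  have inj: "inj D"
    unfolding linear_injective_0[OF linD]
  proof (intro allI impI)
    fix v assume "D v = 0"
    then have "c * norm v \<le> 0" using c(2)[of v] by simp
    then show "v = 0" using c(1) by (simp add: mult_le_0_iff)
  qed
  have sub: "subspace ?T" unfolding T using linD by (simp add: linear_subspace_image)
  have dim: "dim ?T = DIM(real^'m)"
    unfolding T using dim_image_eq[OF linD, of UNIV] inj by simp
  have \<eta>T: "\<eta> \<in> ?T" using \<eta>(1) T by simp
  obtain L :: "real^'m \<Rightarrow> 'a" and e where L: "linear L" "\<And>z. norm (L z) = norm z" "range L = ?T"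
    and e: "e \<in> Basis" "L e = \<eta>"
    and m1: "\<forall>h. m1_boundary TYPE('m) M K (\<phi> u0) \<eta> h
       = - (half_space_flux e (b / h))"
  proof (rule subspace_integral_coordinates[OF sub dim \<eta>T \<eta>(2)], goal_cases)
    case (1 L e)
    show ?case
      by (rule 1(1)[OF 1(2-6)], rule allI, rule m1_boundary_coordinates[OF 1(2,3) b 1(5) 1(7)])
  qed
  have adj: "adjoint L (L z) = z" for z
  proof (rule vector_eq_ldot[THEN iffD1], rule allI)
    fix y
    have "y \<bullet> adjoint L (L z) = L y \<bullet> L z" by (rule adjoint_works[OF L(1)])
    also have "\<dots> = y \<bullet> z" by (simp add: dot_norm L(2) flip: linear_add[OF L(1)])
    finally show "y \<bullet> adjoint L (L z) = y \<bullet> z" .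
  qed
  define B where "B v = adjoint L (D v)" for v
  have linB: "linear B"
    unfolding B_def using linear_compose[OF linD adjoint_linear[OF L(1)]] by (simp add: o_def)
  have DLB: "D v = L (B v)" for v
  proof -
    have "D v \<in> range L" unfolding L(3) T by blast
    then obtain z where "D v = L z" by auto
    then show ?thesis by (simp add: B_def adj)
  qed
  have "surj B"
  proof -
    have "inj B" unfolding linear_injective_0[OF linB]
    proof (intro allI impI)
      fix v assume "B v = 0"
      then have "D v = 0" by (simp add: DLB linear_0[OF L(1)])
      then show "v = 0" using inj linear_injective_0[OF linD] by blast
    qed
    then show ?thesis using linear_injective_imp_surjective[OF linB] by simp
  qed
  show ?thesis
    by (rule that[of L B e, OF L(1) allI[OF L(2)] linB allI[OF DLB] \<open>surj B\<close> e(1,2) m1])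
qed

text \<open>At a boundary point the chart that witnesses the outward normal is used: its derivative maps
  inward coordinate vectors to the tangent vectors with nonpositive inner product with
  \<open>\<eta>\<close>, so the cone is exactly the half space in the definition of
  \<open>m1\<close> with \<open>b = 0\<close>. At an interior point the chart domain contains a
  full ball around the centre, and the cone is the whole space.\<close>

lemma boundary_moment_expansion:
  fixes M :: "'a::euclidean_space set"
  assumes mfd: "submanifold_with_boundary TYPE('m::finite) M" and vol: "volume_measure TYPE('m) M dV"
    and xM: "x \<in> M" and dir: "boundary_direction TYPE('m) M x \<eta>"
  obtains C where "\<forall>f. density_on_manifold M dV f \<longrightarrow>
     (\<exists>A. \<forall>h>0. integrable (density dV (\<lambda>y. ennreal (f y))) (\<lambda>y. K (norm (x - y) / h) *\<^sub>R (y - x)) \<and>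
       norm ((1 / h ^ (CARD('m) + 1)) *\<^sub>R kernel_mean (density dV (\<lambda>y. ennreal (f y))) x h
           - (- ((f x * m1_boundary TYPE('m) M K x \<eta> h) *\<^sub>R \<eta>)))
       \<le> C * (h * norm (manifold_gradient TYPE('m) M f x) + h * f x) + A * h\<^sup>2)"
proof -
  have "\<exists>(k::'m) W \<phi> u0 D (Q :: (real^'m) set) (L :: real^'m \<Rightarrow> 'a) B \<rho> C.
      local_param M k W \<phi> \<and> u0 \<in> W \<and> (\<phi> has_derivative D) (at u0 within W) \<and> \<phi> u0 = x \<and>
      \<rho> > 0 \<and> (\<forall>u\<in>ball u0 \<rho>. u \<in> half_space k \<longleftrightarrow> u - u0 \<in> Q) \<and>
      (\<forall>v\<in>Q. \<forall>t\<ge>0. t *\<^sub>R v \<in> Q) \<and> 0 \<in> Q \<and> linear L \<and> (\<forall>z. norm (L z) = norm z) \<and>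
      linear B \<and> (\<forall>v. D v = L (B v)) \<and> B ` Q \<in> sets borel \<and> C \<ge> 0 \<and>
      (\<forall>h>0. norm (L (cone_moment (B ` Q))
           + m1_boundary TYPE('m) M K x \<eta> h *\<^sub>R \<eta>) \<le> C * h)"
  proof (cases "x \<in> manifold_boundary TYPE('m) M")
    case True
    then have out: "outward_normal TYPE('m) M x \<eta>"
      using dir by (auto simp: boundary_direction_def)
    then obtain k :: 'm and W \<phi> u0 D v where \<eta>: "norm \<eta> = 1"
      and lp: "local_param M k W \<phi>" "u0 \<in> W" "(\<phi> has_derivative D) (at u0 within W)"
      and u0: "u0 $ k = 0" "\<phi> u0 = x" and v: "D v = \<eta>" "v $ k < 0"
      and orth: "\<forall>w. w $ k = 0 \<longrightarrow> \<eta> \<bullet> D w = 0"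
      unfolding outward_normal_def by blast
    have b: "boundary_dist TYPE('m) M (\<phi> u0) = ereal 0"
      using boundary_dist_boundary_point[OF True xM] u0(2) by (simp add: zero_ereal_def)
    have \<eta>D: "\<eta> \<in> range D" using v(1) by blast
    obtain L :: "real^'m \<Rightarrow> 'a" and B :: "real^'m \<Rightarrow> real^'m" and e where L: "linear L" "\<forall>z. norm (L z) = norm z" and B: "linear B" "\<forall>v. D v = L (B v)" "surj B"
      and e: "e \<in> Basis" "L e = \<eta>"
      and m1: "\<forall>h. m1_boundary TYPE('m) M K (\<phi> u0) \<eta> h
       = - (half_space_flux e (0 / h))"
      using tangent_coordinates[OF lp \<eta>D \<eta> b] .
    let ?Q = "{w :: real^'m. 0 \<le> w $ k}"
    have linD: "linear D" using lp(3) by (rule has_derivative_linear)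
    have comp: "B w \<bullet> e = w $ k / v $ k" for w
    proof -
      have LL: "L p \<bullet> L q = p \<bullet> q" for p q
        using L(2) by (simp add: dot_norm flip: linear_add[OF L(1)])
      let ?c = "w $ k / v $ k"
      have "(w - ?c *\<^sub>R v) $ k = 0" using v(2) by simp
      then have "\<eta> \<bullet> D (w - ?c *\<^sub>R v) = 0" using orth by blast
      then have "\<eta> \<bullet> D w = ?c * (\<eta> \<bullet> \<eta>)"
        by (simp add: linear_diff[OF linD] linear_scale[OF linD] v(1) inner_diff_right)
      then have "\<eta> \<bullet> D w = ?c" using \<eta> by (simp add: norm_eq_1)
      then show ?thesis using LL[of e "B w"] B(2) e(2) by (simp add: inner_commute)
    qed
    have BQ: "B ` ?Q = {z. z \<bullet> e \<le> 0}"
    proof (intro equalityI subsetI)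
      fix z assume "z \<in> B ` ?Q"
      then obtain w where w: "z = B w" "0 \<le> w $ k" by auto
      have "w $ k / v $ k \<le> 0" using w(2) v(2) by (simp add: divide_nonneg_neg)
      then show "z \<in> {z. z \<bullet> e \<le> 0}" by (simp add: comp w(1))
    next
      fix z assume z: "z \<in> {z. z \<bullet> e \<le> 0}"
      obtain w where w: "z = B w" using B(3) by (meson surjD)
      have "w $ k / v $ k \<le> 0" using z by (simp add: w comp)
      then have "0 \<le> w $ k" using v(2) by (simp add: divide_le_0_iff)
      then show "z \<in> B ` ?Q" using w by blast
    qed
    have "(cone_moment (B ` ?Q))
        = (half_space_flux e 0) *\<^sub>R e"
      unfolding BQ by (rule half_space_kernel_moment[OF e(1)])
    then have "L (cone_moment (B ` ?Q))
        = (half_space_flux e 0) *\<^sub>R \<eta>"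
      by (simp only: linear_scale[OF L(1)] e(2))
    then have zero: "norm (L (cone_moment (B ` ?Q))
           + m1_boundary TYPE('m) M K x \<eta> h *\<^sub>R \<eta>) \<le> 0 * h" for h
      using m1 u0(2) by simp
    have "{z. z \<bullet> e \<le> 0} \<in> sets borel"
      by (intro borel_closed closed_Collect_le continuous_intros)
    then have BQb: "B ` ?Q \<in> sets borel" by (simp only: BQ)
    have half: "\<forall>u\<in>ball u0 1. u \<in> half_space k \<longleftrightarrow> u - u0 \<in> ?Q"
      using u0(1) by (simp add: half_space_def)
    have cone: "\<forall>w\<in>?Q. \<forall>t\<ge>0. t *\<^sub>R w \<in> ?Q" "0 \<in> ?Q" by simp_all
    show ?thesis
      by (rule exI[of _ k], rule exI[of _ W], rule exI[of _ \<phi>], rule exI[of _ u0], rule exI[of _ D],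
          rule exI[of _ ?Q], rule exI[of _ L], rule exI[of _ B], rule exI[of _ 1], rule exI[of _ 0])
         (intro conjI lp u0(2) half cone L B(1,2) BQb allI impI zero zero_less_one order_refl)
  next
    case False
    obtain b where b: "b > 0" "boundary_dist TYPE('m) M x = ereal b"
      using boundary_dist_interior_point[OF dir False] .
    obtain k :: 'm and W \<phi> where lpx: "local_param M k W \<phi>" "x \<in> \<phi> ` W"
      using bspec[OF mfd[unfolded submanifold_with_boundary_def] xM] by (elim exE conjE)
    then obtain u0 where lp: "local_param M k W \<phi>" "u0 \<in> W" and u0: "\<phi> u0 = x" by blast
    have "u0 $ k \<noteq> 0"
      using False lp u0 unfolding manifold_boundary_def by blast
    moreover have "u0 \<in> half_space k"
      using lp openin_imp_subset[of euclidean "half_space k" W] by (auto simp: local_param_def)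
    ultimately have uk: "u0 $ k > 0" by (simp add: half_space_def)
    obtain D where D: "(\<phi> has_derivative D) (at u0 within W)"
      by (rule local_param_regular_chart[OF lp]) blast
    have \<eta>: "\<eta> \<in> tangent_space TYPE('m) M x" "norm \<eta> = 1"
      using dir False by (auto simp: boundary_direction_def)
    have \<eta>D: "\<eta> \<in> range D" using \<eta>(1) tangent_space_eq_range[OF lp D] u0 by simp
    have b': "boundary_dist TYPE('m) M (\<phi> u0) = ereal b" using b(2) u0 by simp
    obtain L :: "real^'m \<Rightarrow> 'a" and B :: "real^'m \<Rightarrow> real^'m" and e where L: "linear L" "\<forall>z. norm (L z) = norm z" and B: "linear B" "\<forall>v. D v = L (B v)" "surj B"
      and e: "e \<in> Basis" "L e = \<eta>"
      and m1: "\<forall>h. m1_boundary TYPE('m) M K (\<phi> u0) \<eta> h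
       = - (half_space_flux e (b / h))"
      using tangent_coordinates[OF lp D \<eta>D \<eta>(2) b'] .
    define M2 where "M2 = (\<integral>z. K (norm z) * norm (z :: real^'m) ^ 2 \<partial>lborel) / b"
    have M2: "M2 \<ge> 0"
      unfolding M2_def using b(1) kernel_nonneg by (intro divide_nonneg_nonneg integral_nonneg_AE) auto
    have "(cone_moment (B ` UNIV)) = 0"
      using full_space_kernel_moment[where 'a = "real^'m"] B(3) by simp
    then have bound: "norm (L (cone_moment (B ` UNIV))
           + m1_boundary TYPE('m) M K x \<eta> h *\<^sub>R \<eta>) \<le> M2 * h" if "h > 0" for h
      using kernel_flux_bound[OF e(1) b(1) that] m1 u0 \<eta>(2)
      by (simp add: linear_0[OF L(1)] M2_def mult.commute)
    have half: "\<forall>u\<in>ball u0 (u0 $ k). u \<in> half_space k \<longleftrightarrow> u - u0 \<in> UNIV"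
    proof
      fix u assume "u \<in> ball u0 (u0 $ k)"
      then have "norm (u0 - u) < u0 $ k" by (simp add: dist_norm)
      then have "u0 $ k - u $ k < u0 $ k"
        using component_le_norm_cart[of "u0 - u" k] by simp
      then show "u \<in> half_space k \<longleftrightarrow> u - u0 \<in> UNIV" by (simp add: half_space_def)
    qed
    have BQb: "B ` UNIV \<in> sets borel" using B(3) by simp
    have cone: "\<forall>w\<in>UNIV. \<forall>t\<ge>0. t *\<^sub>R w \<in> (UNIV :: (real^'m) set)" "0 \<in> (UNIV :: (real^'m) set)" by simp_all
    show ?thesis
      by (rule exI[of _ k], rule exI[of _ W], rule exI[of _ \<phi>], rule exI[of _ u0], rule exI[of _ D],
          rule exI[of _ UNIV], rule exI[of _ L], rule exI[of _ B], rule exI[of _ "u0 $ k"], rule exI[of _ M2])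
         (intro conjI lp D u0 uk half cone L B(1,2) BQb M2 allI impI bound)
  qed
  then obtain k :: 'm and W \<phi> u0 D and Q :: "(real^'m) set" and L :: "real^'m \<Rightarrow> 'a" and B \<rho> C5 where
      lp: "local_param M k W \<phi>" "u0 \<in> W" "(\<phi> has_derivative D) (at u0 within W)" and u0: "\<phi> u0 = x"
    and \<rho>: "\<rho> > 0" and half: "\<forall>u\<in>ball u0 \<rho>. u \<in> half_space k \<longleftrightarrow> u - u0 \<in> Q"
    and Q: "\<forall>v\<in>Q. \<forall>t\<ge>0. t *\<^sub>R v \<in> Q" "0 \<in> Q" and L: "linear L" "\<forall>z. norm (L z) = norm z"
    and B: "linear B" "\<forall>v. D v = L (B v)" and BQ: "B ` Q \<in> sets borel" and C5: "C5 \<ge> 0"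
    and m1: "\<forall>h>0. norm (L (cone_moment (B ` Q))
           + m1_boundary TYPE('m) M K x \<eta> h *\<^sub>R \<eta>) \<le> C5 * h"
    by (elim exE conjE) (rule that)
  let ?I = "L (cone_moment (B ` Q))"
  let ?E = "\<lambda>f h. (1 / h ^ (CARD('m) + 1)) *\<^sub>R kernel_mean (density dV (\<lambda>y. ennreal (f y))) x h"
  have half': "\<And>u. u \<in> ball u0 \<rho> \<Longrightarrow> u \<in> half_space k \<longleftrightarrow> u - u0 \<in> Q"
    using half by blast
  have Q1: "\<And>v t. v \<in> Q \<Longrightarrow> t \<ge> 0 \<Longrightarrow> t *\<^sub>R v \<in> Q" using Q(1) by blast
  have L2: "\<And>z. norm (L z) = norm z" and B2: "\<And>v. D v = L (B v)"
    using L(2) B(2) by blast+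
  have "\<exists>C\<ge>0. \<forall>f. density_on_manifold M dV f \<longrightarrow> (\<exists>A\<ge>0. \<forall>h>0. integrable (density dV (\<lambda>y. ennreal (f y))) (\<lambda>y. K (norm (x - y) / h) *\<^sub>R (y - x)) \<and>
       norm (?E f h - f x *\<^sub>R ?I)
       \<le> C * (h * norm (manifold_gradient TYPE('m) M f x) + h * f x) + A * h\<^sup>2)"
  proof (rule chart_moment_expansion[OF vol lp \<rho>, where Q = Q and L = L and B = B, unfolded u0])
    fix C
    assume C0: "C \<ge> 0" and Cf: "\<And>f. density_on_manifold M dV f \<Longrightarrow> (\<exists>A\<ge>0. \<forall>h>0. integrable (density dV (\<lambda>y. ennreal (f y))) (\<lambda>y. K (norm (x - y) / h) *\<^sub>R (y - x)) \<and>
       norm (?E f h - f x *\<^sub>R ?I)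
       \<le> C * (h * norm (manifold_gradient TYPE('m) M f x) + h * f x) + A * h\<^sup>2)"
    show "\<exists>C\<ge>0. \<forall>f. density_on_manifold M dV f \<longrightarrow> (\<exists>A\<ge>0. \<forall>h>0. integrable (density dV (\<lambda>y. ennreal (f y))) (\<lambda>y. K (norm (x - y) / h) *\<^sub>R (y - x)) \<and>
       norm (?E f h - f x *\<^sub>R ?I)
       \<le> C * (h * norm (manifold_gradient TYPE('m) M f x) + h * f x) + A * h\<^sup>2)"
      by (rule exI[of _ C], rule conjI[OF C0], rule allI, rule impI, rule Cf)
  qed (fact half' Q1 Q(2) L(1) L2 B(1) B2 BQ)+
  then obtain C where C: "C \<ge> 0" and exp: "\<forall>f. density_on_manifold M dV f \<longrightarrow> (\<exists>A\<ge>0. \<forall>h>0. integrable (density dV (\<lambda>y. ennreal (f y))) (\<lambda>y. K (norm (x - y) / h) *\<^sub>R (y - x)) \<and>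
       norm (?E f h - f x *\<^sub>R ?I)
       \<le> C * (h * norm (manifold_gradient TYPE('m) M f x) + h * f x) + A * h\<^sup>2)"
    by (elim exE conjE)
  show ?thesis
  proof (rule that[of "C + C5"], intro allI impI)
    fix f assume f: "density_on_manifold M dV f"
    then have fx: "f x \<ge> 0" using xM by (simp add: density_on_manifold_def)
    obtain A where A: "\<forall>h>0. integrable (density dV (\<lambda>y. ennreal (f y))) (\<lambda>y. K (norm (x - y) / h) *\<^sub>R (y - x)) \<and>
       norm (?E f h - f x *\<^sub>R ?I) \<le> C * (h * norm (manifold_gradient TYPE('m) M f x) + h * f x) + A * h\<^sup>2"
      using exp f by blast
    show "\<exists>A. \<forall>h>0. integrable (density dV (\<lambda>y. ennreal (f y))) (\<lambda>y. K (norm (x - y) / h) *\<^sub>R (y - x)) \<and>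
       norm (?E f h - (- ((f x * m1_boundary TYPE('m) M K x \<eta> h) *\<^sub>R \<eta>)))
       \<le> (C + C5) * (h * norm (manifold_gradient TYPE('m) M f x) + h * f x) + A * h\<^sup>2"
    proof (intro exI[of _ A] allI impI conjI)
      fix h :: real assume h: "h > 0"
      show "integrable (density dV (\<lambda>y. ennreal (f y))) (\<lambda>y. K (norm (x - y) / h) *\<^sub>R (y - x))"
        using A h by blast
      let ?X = "h * norm (manifold_gradient TYPE('m) M f x) + h * f x"
      have eq: "?E f h - (- ((f x * m1_boundary TYPE('m) M K x \<eta> h) *\<^sub>R \<eta>))
          = (?E f h - f x *\<^sub>R ?I) + f x *\<^sub>R (?I + m1_boundary TYPE('m) M K x \<eta> h *\<^sub>R \<eta>)"
        by (simp add: scaleR_add_right)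
      have 1: "norm (?E f h - f x *\<^sub>R ?I) \<le> C * ?X + A * h\<^sup>2"
        using A h by blast
      have "norm (f x *\<^sub>R (?I + m1_boundary TYPE('m) M K x \<eta> h *\<^sub>R \<eta>)) \<le> f x * (C5 * h)"
        unfolding norm_scaleR using fx m1 h by (simp add: mult_left_mono)
      also have "\<dots> = C5 * (h * f x)" by simp
      also have "\<dots> \<le> C5 * ?X"
        using C5 h by (intro mult_left_mono) auto
      finally have 2: "norm (f x *\<^sub>R (?I + m1_boundary TYPE('m) M K x \<eta> h *\<^sub>R \<eta>)) \<le> C5 * ?X" .
      show "norm (?E f h - (- ((f x * m1_boundary TYPE('m) M K x \<eta> h) *\<^sub>R \<eta>))) \<le> (C + C5) * ?X + A * h\<^sup>2"
        unfolding eq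
        by (rule order_trans[OF norm_triangle_mono[OF 1 2]]) (simp add: algebra_simps)
    qed
  qed
qed

end

theorem theorem3p2:
  fixes M :: "(real^'n) set" and x \<eta> :: "real^'n" and K :: "real \<Rightarrow> real"
    and dV :: "(real^'n) measure"
  assumes "submanifold_with_boundary TYPE('m::finite) M"
    and "bounded_boundary_curvature TYPE('m) M"
    and "volume_measure TYPE('m) M dV"
    and "x \<in> M"
    and "boundary_direction TYPE('m) M x \<eta>"
    and "tangible TYPE('m) M x \<eta>"
    and "kernel_function K"
    and "exponential_decay K"
  shows "\<exists>C. \<forall>f. density_on_manifold M dV f \<longrightarrow>
           (\<exists>D. \<forall>\<^sub>F h in at_right 0. \<forall>N\<ge>1. \<forall>(P :: 'w measure) X. iid_samples P dV f N X \<longrightarrow>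
              integrable P (boundary_estimator TYPE('m) K h N X x) \<and>
              norm ((\<integral>\<omega>. boundary_estimator TYPE('m) K h N X x \<omega> \<partial>P)
                    - (- ((f x * m1_boundary TYPE('m) M K x \<eta> h) *\<^sub>R \<eta>)))
                \<le> C * (h * norm (manifold_gradient TYPE('m) M f x) + h * f x) + D * h\<^sup>2)"
proof -
  obtain a1 a2 where a: "a1 > 0" "a2 > 0" "\<forall>z\<ge>0. K z < a1 * exp (- a2 * z)"
    using assms(8) by (auto simp: exponential_decay_def)
  interpret decaying_kernel K a1 a2
    by unfold_locales (use a assms(7) in \<open>auto intro: less_imp_le\<close>)
  obtain C where C: "\<forall>f. density_on_manifold M dV f \<longrightarrow>
     (\<exists>A. \<forall>h>0. integrable (density dV (\<lambda>y. ennreal (f y))) (\<lambda>y. K (norm (x - y) / h) *\<^sub>R (y - x)) \<and>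
       norm ((1 / h ^ (CARD('m) + 1)) *\<^sub>R (\<integral>y. K (norm (x - y) / h) *\<^sub>R (y - x) \<partial>density dV (\<lambda>y. ennreal (f y)))
           - (- ((f x * m1_boundary TYPE('m) M K x \<eta> h) *\<^sub>R \<eta>)))
       \<le> C * (h * norm (manifold_gradient TYPE('m) M f x) + h * f x) + A * h\<^sup>2)"
    using boundary_moment_expansion[OF assms(1,3,4,5)] .
  show ?thesis
  proof (rule exI[of _ C], intro allI impI)
    fix f assume "density_on_manifold M dV f"
    then obtain A where A: "\<forall>h>0. integrable (density dV (\<lambda>y. ennreal (f y))) (\<lambda>y. K (norm (x - y) / h) *\<^sub>R (y - x)) \<and>
       norm ((1 / h ^ (CARD('m) + 1)) *\<^sub>R (\<integral>y. K (norm (x - y) / h) *\<^sub>R (y - x) \<partial>density dV (\<lambda>y. ennreal (f y)))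
           - (- ((f x * m1_boundary TYPE('m) M K x \<eta> h) *\<^sub>R \<eta>)))
       \<le> C * (h * norm (manifold_gradient TYPE('m) M f x) + h * f x) + A * h\<^sup>2"
      using C by blast
    show "\<exists>D. \<forall>\<^sub>F h in at_right 0. \<forall>N\<ge>1. \<forall>(P :: 'w measure) X. iid_samples P dV f N X \<longrightarrow>
              integrable P (boundary_estimator TYPE('m) K h N X x) \<and>
              norm ((\<integral>\<omega>. boundary_estimator TYPE('m) K h N X x \<omega> \<partial>P)
                    - (- ((f x * m1_boundary TYPE('m) M K x \<eta> h) *\<^sub>R \<eta>)))
                \<le> C * (h * norm (manifold_gradient TYPE('m) M f x) + h * f x) + D * h\<^sup>2"
    proof (rule exI[of _ A], rule eventually_mono[OF eventually_at_right_less[of 0]], intro allI impI conjI)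
      fix h :: real and N :: nat and P :: "'w measure" and X
      assume h: "0 < h" and N: "1 \<le> N" and iid: "iid_samples P dV f N X"
      have int: "integrable (density dV (\<lambda>y. ennreal (f y))) (\<lambda>y. K (norm (x - y) / h) *\<^sub>R (y - x))"
        using A h by blast
      note est = iid_boundary_estimator[OF iid N int, where 'm = 'm]
      show "integrable P (boundary_estimator TYPE('m) K h N X x)" by (rule est(1))
      show "norm ((\<integral>\<omega>. boundary_estimator TYPE('m) K h N X x \<omega> \<partial>P)
                    - (- ((f x * m1_boundary TYPE('m) M K x \<eta> h) *\<^sub>R \<eta>)))
                \<le> C * (h * norm (manifold_gradient TYPE('m) M f x) + h * f x) + A * h\<^sup>2"
        unfolding est(2) using A h by blast
    qed
  qed
qed

end
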